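(* (a) Let $n\in\mathbb{N}$ with $n\geq 7$, and let $\langle A\mid R\rangle$ be any monoid presentation for the symmetric group $S_n$, with associated surjective homomorphism $\pi:A^*\to S_n$ (so that $\ker\pi=R^{\sharp}$). Let $\zeta,\eta\notin A$ be two new letters. Define permutations $\alpha,\beta,\gamma,\delta\in S_n$ by: if $n$ is odd, $\alpha=(3,4,\ldots,n)$, $\beta=(4,6)$, $\gamma=(2,3,\ldots,n)$, $\delta=(2,3)(4,6)$; if $n$ is even, $\alpha=(3,5,4)$, $\beta=(3,4,\ldots,n)$, $\gamma=(2,3,5,4)$, $\delta=(2,3,\ldots,n)$. Then the partial transformation monoid $PT_n$ is defined by the monoid presentation with generators $A\cup\{\zeta,\eta\}$ and relations $R$ together with the following $8$ relations: $$(1,n)(2,3)\,\zeta\,(1,n)(2,3)\,\zeta=\zeta\,(1,n)(2,3)\,\zeta\,(1,n)(2,3),$$ $$(2,3)\,\zeta\,(2,3)\,\zeta\,(2,3)\,\zeta\,(2,3)=\zeta\,(2,3)\,\zeta,$$ $$(1,3)\,\eta\,(1,3)\,\zeta=\zeta\,(1,3)\,\eta\,(1,3),$$ $$(1,2)\,\eta\,(1,2)\,\eta\,(1,2)=\zeta\,\eta,$$ $$\alpha^{-1}\,\zeta\,\alpha=(1,2)\,\zeta\,(1,2)\,\eta\,(1,2),$$ $$\beta^{-1}\,\zeta\,\beta=\zeta\,(1,2)\,\eta\,(1,2),$$ $$\gamma^{-1}\,\eta\,\gamma=\eta\,(1,2)\,\zeta\,(1,2),$$ $$\delta^{-1}\,\eta\,\delta=\eta\,(1,2)\,\zeta\,(1,2),$$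 where the permutations (including $\alpha^{\pm1},\beta^{\pm1},\gamma^{\pm1},\delta^{\pm1}$) denote any words in $A^*$ representing them under $\pi$; the letter $\zeta$ represents the idempotent full transformation of rank $n-1$ mapping $2$ to $1$ (and fixing every other point); and the letter $\eta$ represents the idempotent partial bijection of rank $n-1$ with $1\notin\operatorname{dom}(\eta)$ (the identity map on $\{2,\ldots,n\}$). (b) Furthermore, if $n\geq 4$, then every monoid presentation for $PT_n$ requires at least $8$ non-$S_n$ relations; that is, if $n\geq 4$ and $\langle A,B\mid R,S\rangle$ is a monoid presentation for $PT_n$, where $\langle A\mid R\rangle$ is a monoid presentation for the symmetric group $S_n\leq PT_n$, then $|S|\geq 8$.
   Context: Maps act on the right and are composed from left to right: $(x)(fg)=((x)f)g$. $PT_n$ is the monoid of all partial maps from $\{1,\ldots,n\}$ to itself (functions from a subset of $\{1,\ldots,n\}$, the domain, into $\{1,\ldots,n\}$) under composition of partial maps; the rank of an element is the size of its image. Its group of units is $S_n$. Permutations are written in disjoint cycle notation. A (monoid) presentation is a pair $\langle X\mid Q\rangle$ with $X$ an alphabet and $Q\subseteq X^*\times X^*$; only finite presentations are considered. It defines the quotient $X^*/Q^{\sharp}$, where $Q^{\sharp}$ is the least congruence on the free monoid $X^*$ containing $Q$. Saying that a monoid $M$ is defined by $\langle X\mid Q\rangle$, where each letter represents a specified element of $M$, means that the homomorphism $X^*\to M$ sending each letter to the element it represents is surjective with kernel $Q^{\sharp}$. In (a), each letter of $A$ represents its image under $\pi$. The notation $\langle A,B\mid R,S\rangle$ means $\langle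 A\cup B\mid R\cup S\rangle$, with $A\cap B=\varnothing$ and $R\subseteq A^*\times A^*$. In (b), if $\phi:(A\cup B)^*\to PT_n$ is the surjective homomorphism associated to the presentation of $PT_n$, then "$\langle A\mid R\rangle$ is a monoid presentation for $S_n\leq PT_n$" means that the restriction of $\phi$ to $A^*$ has image $S_n$ and kernel equal to the congruence on $A^*$ generated by $R$. The relations in $S$ are called the non-$S_n$ relations. *)

theory Defs
  imports "HOL-Algebra.Group" "HOL-Combinatorics.Cycles"
begin

section \<open>Monoid presentations\<close>

text \<open>The least congruence on the free monoid \<open>lists X\<close> containing \<open>Q\<close>.\<close>

inductive_set cong_gen :: "'a set \<Rightarrow> ('a list \<times> 'a list) set \<Rightarrow> ('a list \<times> 'a list) set"
  for X Q where
  base: "(u, v) \<in> Q \<Longrightarrow> (u, v) \<in> cong_gen X Q"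
| refl: "w \<in> lists X \<Longrightarrow> (w, w) \<in> cong_gen X Q"
| sym: "(u, v) \<in> cong_gen X Q \<Longrightarrow> (v, u) \<in> cong_gen X Q"
| trans: "(u, v) \<in> cong_gen X Q \<Longrightarrow> (v, w) \<in> cong_gen X Q \<Longrightarrow> (u, w) \<in> cong_gen X Q"
| append: "(u, v) \<in> cong_gen X Q \<Longrightarrow> (u', v') \<in> cong_gen X Q
    \<Longrightarrow> (u @ u', v @ v') \<in> cong_gen X Q"

text \<open>A homomorphism from a free monoid is given by its values on letters;
  \<open>word_value M f\<close> is the homomorphism extending \<open>f\<close>.\<close>

definition word_value :: "('m, 'k) monoid_scheme \<Rightarrow> ('a \<Rightarrow> 'm) \<Rightarrow> 'a list \<Rightarrow> 'm" where
  "word_value M f w = foldr (\<otimes>\<^bsub>M\<^esub>) (map f w) \<one>\<^bsub>M\<^esub>"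

text \<open>Only finite presentations are considered.\<close>

definition presentation_for ::
  "('m, 'k) monoid_scheme \<Rightarrow> 'a set \<Rightarrow> ('a list \<times> 'a list) set \<Rightarrow> ('a \<Rightarrow> 'm) \<Rightarrow> bool" where
  "presentation_for M X Q f \<longleftrightarrow>
     finite X \<and> finite Q \<and> Q \<subseteq> lists X \<times> lists X \<and>
     f ` X \<subseteq> carrier M \<and>
     word_value M f ` lists X = carrier M \<and>
     {(u, v). u \<in> lists X \<and> v \<in> lists X \<and> word_value M f u = word_value M f v} = cong_gen X Q"


section \<open>Partial transformations\<close>

text \<open>Maps act on the right, so \<open>f \<otimes> g\<close> applies \<open>f\<close> first.\<close>

definition PT :: "nat \<Rightarrow> (nat \<rightharpoonup> nat) monoid" where
  "PT n = \<lparr> carrier = {f. dom f \<subseteq> {1..n} \<and> ran f \<subseteq> {1..n}},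
            monoid.mult = (\<lambda>f g. g \<circ>\<^sub>m f),
            one = Some |` {1..n} \<rparr>"

definition full_map :: "nat \<Rightarrow> (nat \<Rightarrow> nat) \<Rightarrow> (nat \<rightharpoonup> nat)" where
  "full_map n f = (Some \<circ> f) |` {1..n}"

definition Sym :: "nat \<Rightarrow> (nat \<rightharpoonup> nat) monoid" where
  "Sym n = (PT n) \<lparr> carrier := full_map n ` {p. p permutes {1..n}} \<rparr>"

definition zeta_map :: "nat \<Rightarrow> (nat \<rightharpoonup> nat)" where
  "zeta_map n = full_map n (id(2 := 1))"

definition eta_map :: "nat \<Rightarrow> (nat \<rightharpoonup> nat)" where
  "eta_map n = Some |` {2..n}"


section \<open>The relations\<close>

text \<open>The relations are written as products of letters and permutations, where each occurrence of
  a permutation may be replaced by any word over \<open>A\<close> representing it, and different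
  occurrences of the same permutation may be replaced by different words.\<close>

datatype 'a factor = Perm "nat \<Rightarrow> nat" | Letter 'a

fun factor_words :: "nat \<Rightarrow> 'a set \<Rightarrow> ('a \<Rightarrow> (nat \<rightharpoonup> nat)) \<Rightarrow> 'a factor \<Rightarrow> 'a list set" where
  "factor_words n A \<pi> (Perm p) = {w \<in> lists A. word_value (Sym n) \<pi> w = full_map n p}"
| "factor_words n A \<pi> (Letter x) = {[x]}"

definition product_words ::
  "nat \<Rightarrow> 'a set \<Rightarrow> ('a \<Rightarrow> (nat \<rightharpoonup> nat)) \<Rightarrow> 'a factor list \<Rightarrow> 'a list set" where
  "product_words n A \<pi> fs = concat ` {ws. list_all2 (\<lambda>f w. w \<in> factor_words n A \<pi> f) fs ws}"

abbreviation cyc :: "nat list \<Rightarrow> nat \<Rightarrow> nat" where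
  "cyc \<equiv> cycle_of_list"

definition alpha_perm :: "nat \<Rightarrow> nat \<Rightarrow> nat" where
  "alpha_perm n = (if odd n then cyc [3..<Suc n] else cyc [3, 5, 4])"

definition beta_perm :: "nat \<Rightarrow> nat \<Rightarrow> nat" where
  "beta_perm n = (if odd n then cyc [4, 6] else cyc [3..<Suc n])"

definition gamma_perm :: "nat \<Rightarrow> nat \<Rightarrow> nat" where
  "gamma_perm n = (if odd n then cyc [2..<Suc n] else cyc [2, 3, 5, 4])"

definition delta_perm :: "nat \<Rightarrow> nat \<Rightarrow> nat" where
  "delta_perm n = (if odd n then cyc [2, 3] \<circ> cyc [4, 6] else cyc [2..<Suc n])"

definition PT_relations :: "nat \<Rightarrow> 'a \<Rightarrow> 'a \<Rightarrow> ('a factor list \<times> 'a factor list) list" where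
  "PT_relations n \<zeta> \<eta> =
    (let z = Letter \<zeta>; e = Letter \<eta>;
         t12 = Perm (cyc [1, 2]); t13 = Perm (cyc [1, 3]); t23 = Perm (cyc [2, 3]);
         s = Perm (cyc [1, n] \<circ> cyc [2, 3]);
         a = Perm (alpha_perm n); a' = Perm (inv_into UNIV (alpha_perm n));
         b = Perm (beta_perm n); b' = Perm (inv_into UNIV (beta_perm n));
         c = Perm (gamma_perm n); c' = Perm (inv_into UNIV (gamma_perm n));
         d = Perm (delta_perm n); d' = Perm (inv_into UNIV (delta_perm n))
     in [([s, z, s, z], [z, s, z, s]),
         ([t23, z, t23, z, t23, z, t23], [z, t23, z]),
         ([t13, e, t13, z], [z, t13, e, t13]),
         ([t12, e, t12, e, t12], [z, e]),
         ([a', z, a], [t12, z, t12, e, t12]),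
         ([b', z, b], [z, t12, e, t12]),
         ([c', e, c], [e, t12, z, t12]),
         ([d', e, d], [e, t12, z, t12])])"

end

theory Submission
  imports Defs
begin

text \<open>
  (a) Let \<open>e i j\<close> be the idempotent sending \<open>j\<close> to \<open>i\<close> and let \<open>et i\<close> be the identity with \<open>i\<close> removed
  from its domain. The last four relations make \<open>\<zeta>\<close> and \<open>\<eta>\<close> commute, up to a twist by the transposition
  of \<open>1\<close> and \<open>2\<close>, with the permutation \<open>\<alpha>\<beta>\<^sup>-\<^sup>1 = \<gamma>\<delta>\<^sup>-\<^sup>1\<close>; conjugating by \<open>\<alpha>\<close>, \<open>\<beta>\<close> and \<open>\<delta>\<close> produces
  enough further permutations of this kind to generate the full stabilisers. Then the twist disappears,
  all conjugates of \<open>\<zeta>\<close> and \<open>\<eta>\<close> are well defined, and the familiar commutation and absorption laws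
  follow. These bring every word into the form \<open>E \<cdot> p\<close>, where \<open>E\<close> is the idempotent that sends every
  point to the least element of its kernel class and \<open>p\<close> is a permutation that matters only on the
  image of \<open>E\<close>.

  (b) Relations are separated by the kernel type of their value. There are four kernel types of rank
  \<open>n - 2\<close>. Each of them is the kernel type of a product of two commuting idempotents of rank \<open>n - 1\<close> with different
  kernels, and if no relation had this type, the kernel of the shortest nonunit prefix of a word would be
  an invariant. For each of the two kernel types of rank \<open>n - 1\<close>, a single relation would allow
  the unit prefix of a word to change only by powers of one permutation, whereas the stabiliser of
  a kernel contains two different transpositions and is therefore not cyclic.
\<close>

section \<open>Groups of permutations containing three-cycles\<close>

text \<open>Each conjugation step in (a) has a price. Conjugation by \<beta> keeps the relation to
  \<zeta> only for permutations that already commute with \<eta>, and conjugation by \<delta> keeps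
  commutation with \<eta> only for those that also commute with \<zeta> without a twist. So the two
  families have to be enlarged in turn. The twisted permutations form a coset, and the first goal is
  to find a transposition in it. If n is odd, \<open>lam\<close> is a transposition times a disjoint
  cycle of odd length n - 4, and an odd power isolates the transposition. If n is even,
  \<open>lam\<close> is a single cycle of even length n - 2, and none of its powers is a
  transposition. Then three-cycles are made first, starting from a commutator, and they shorten an
  even cycle to a transposition. In (b) the bound is 2 + 2 + 1 + 1 + 1 + 1: two relations for each
  kernel type of rank n - 1 and one for each of rank n - 2.\<close>

abbreviation "T \<equiv> Transposition.transpose"
abbreviation "pinv \<equiv> inv_into UNIV"

lemma transpose_conj:
  assumes "bij p"
  shows "p \<circ> T a b \<circ> pinv p = T (p a) (p b)"
proof
  fix x
  obtain y where x: "x = p y" using assms by (metis bij_pointE)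
  show "(p \<circ> T a b \<circ> pinv p) x = T (p a) (p b) x"
    unfolding x using bij_is_inj[OF assms] by (auto simp: transpose_def inj_eq)
qed

definition perm_group :: "('a \<Rightarrow> 'a) set \<Rightarrow> bool" where
  "perm_group P \<longleftrightarrow> id \<in> P \<and> (\<forall>p\<in>P. bij p \<and> pinv p \<in> P) \<and> (\<forall>p\<in>P. \<forall>q\<in>P. p \<circ> q \<in> P)"

lemma perm_groupD:
  assumes "perm_group P"
  shows "id \<in> P" "\<And>p. p \<in> P \<Longrightarrow> bij p" "\<And>p. p \<in> P \<Longrightarrow> pinv p \<in> P"
    "\<And>p q. p \<in> P \<Longrightarrow> q \<in> P \<Longrightarrow> p \<circ> q \<in> P"
  using assms by (auto simp: perm_group_def)

text \<open>For distinct points the product is the cycle that sends a to b, b to c and c to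
  a.\<close>

definition three_cycle_in :: "('a \<Rightarrow> 'a) set \<Rightarrow> 'a \<Rightarrow> 'a \<Rightarrow> 'a \<Rightarrow> bool" where
  "three_cycle_in P a b c \<longleftrightarrow> T a b \<circ> T b c \<in> P"

lemma three_cycle_in_rotate:
  assumes "distinct [a, b, c]" "three_cycle_in P a b c"
  shows "three_cycle_in P b c a"
proof -
  have "T b c \<circ> T c a = T a b \<circ> T b c"
    using assms(1) by (auto simp: fun_eq_iff transpose_def)
  then show ?thesis using assms by (simp add: three_cycle_in_def)
qed

lemma three_cycle_in_conj:
  assumes "bij p" "three_cycle_in P a b c" "\<And>q. q \<in> P \<Longrightarrow> p \<circ> q \<circ> pinv p \<in> P"
  shows "three_cycle_in P (p a) (p b) (p c)"
proof -
  have "p \<circ> (T a b \<circ> T b c) \<circ> pinv p = (p \<circ> T a b \<circ> pinv p) \<circ> (p \<circ> T b c \<circ> pinv p)"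
    using assms(1) by (auto simp: fun_eq_iff bij_is_inj)
  then show ?thesis
    using assms by (metis transpose_conj three_cycle_in_def)
qed

definition three_cycles_in :: "('a \<Rightarrow> 'a) set \<Rightarrow> 'a set \<Rightarrow> bool" where
  "three_cycles_in P X \<longleftrightarrow>
     (\<forall>a\<in>X. \<forall>b\<in>X. \<forall>c\<in>X. distinct [a, b, c] \<longrightarrow> three_cycle_in P a b c)"

text \<open>Cancelling a common \<open>T q p\<close> between two of the given three-cycles yields
  \<open>T q x \<circ> T q y\<close> for all x and y, and every three-cycle is a short product of
  these.\<close>

lemma three_cycles_in_star:
  assumes P: "perm_group P" and q: "q \<in> X" and p: "p \<in> X" "p \<noteq> q"
    and star: "\<And>x. x \<in> X \<Longrightarrow> x \<noteq> p \<Longrightarrow> x \<noteq> q \<Longrightarrow> three_cycle_in P p q x"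
  shows "three_cycles_in P X"
proof -
  have 1: "T q p \<circ> T q x \<in> P" if "x \<in> X" "x \<noteq> q" for x
    using star[of x] that perm_groupD(1)[OF P]
    by (cases "x = p") (auto simp: three_cycle_in_def transpose_commute)
  have s: "T q x \<circ> T q y \<in> P" if "x \<in> X" "y \<in> X" "x \<noteq> q" "y \<noteq> q" for x y
  proof -
    have "T q x \<circ> T q y = pinv (T q p \<circ> T q x) \<circ> (T q p \<circ> T q y)"
      by (simp add: o_inv_distrib fun_eq_iff)
    then show ?thesis using 1 that perm_groupD[OF P] by metis
  qed
  show ?thesis
    unfolding three_cycles_in_def
  proof (intro ballI impI)
    fix a b c assume X: "a \<in> X" "b \<in> X" "c \<in> X" and d: "distinct [a, b, c]"
    consider "a = q" | "b = q" | "c = q" | "a \<noteq> q" "b \<noteq> q" "c \<noteq> q" by blast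
    then show "three_cycle_in P a b c"
    proof cases
      case 1
      then have "T a b \<circ> T b c = T q c \<circ> T q b"
        using d by (auto simp: fun_eq_iff transpose_def)
      then show ?thesis using s[of c b] X d 1 by (auto simp: three_cycle_in_def)
    next
      case 2
      then show ?thesis using s[of a c] X d by (auto simp: three_cycle_in_def transpose_commute)
    next
      case 3
      then have "T a b \<circ> T b c = T q b \<circ> T q a"
        using d by (auto simp: fun_eq_iff transpose_def)
      then show ?thesis using s[of b a] X d 3 by (auto simp: three_cycle_in_def)
    next
      case 4
      then have "T a b \<circ> T b c = (T q a \<circ> T q b) \<circ> ((T q a \<circ> T q b) \<circ> (T q c \<circ> T q b))"
        using d by (auto simp: fun_eq_iff transpose_def)
      moreover have "\<dots> \<in> P"
        using X 4 by (intro perm_groupD(4)[OF P] s) auto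
      ultimately show ?thesis by (simp add: three_cycle_in_def)
    qed
  qed
qed

text \<open>The pair p, q serves as the centre of a star; only the three-cycle through d is new, all
  others come from X.\<close>

lemma three_cycles_in_insert:
  assumes P: "perm_group P" and X: "three_cycles_in P X" and "p \<in> X" "q \<in> X" "p \<noteq> q"
    and "three_cycle_in P p q d"
  shows "three_cycles_in P (insert d X)"
proof (rule three_cycles_in_star[OF P, of q _ p])
  fix x assume "x \<in> insert d X" "x \<noteq> p" "x \<noteq> q"
  then show "three_cycle_in P p q x"
    using assms by (auto simp: three_cycles_in_def)
qed (use assms in auto)

lemma three_cycles_in_pair: "three_cycles_in P {p, q}"
  by (auto simp: three_cycles_in_def)

text \<open>Q is meant to be P itself or a coset of P, such as the twisted permutations. Multiplying
  by the inverse of the three-cycle on the first three points takes two points out of a cycle, so an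
  even cycle shrinks to a transposition.\<close>

lemma transposition_of_even_cycle:
  assumes "perm_group P" "three_cycles_in P X"
    and "\<And>p q. p \<in> P \<Longrightarrow> q \<in> Q \<Longrightarrow> p \<circ> q \<in> Q"
    and "distinct cs" "set cs \<subseteq> X" "even (length cs)" "cs \<noteq> []" "cycle_of_list cs \<in> Q"
  shows "\<exists>x\<in>X. \<exists>y\<in>X. x \<noteq> y \<and> T x y \<in> Q"
  using assms(4-8)
proof (induction cs rule: length_induct)
  case (1 cs)
  then obtain i j ds where cs: "cs = i # j # ds"
    by (cases cs; cases "tl cs") auto
  show ?case
  proof (cases ds)
    case Nil
    then show ?thesis using 1 cs by (auto simp: o_def id_def)
  next
    case (Cons k es)
    then obtain l fs where es: "es = l # fs" using 1 cs by (cases es) auto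
    let ?C = "T i j \<circ> T j k"
    have "?C \<in> P"
      using assms(2) 1 cs Cons by (auto simp: three_cycles_in_def three_cycle_in_def)
    then have "pinv ?C \<circ> cycle_of_list cs \<in> Q"
      using assms(1,3) 1 by (metis perm_groupD(3))
    moreover have "pinv ?C \<circ> cycle_of_list cs = cycle_of_list ds"
      unfolding cs Cons by (simp add: o_inv_distrib fun_eq_iff)
    ultimately have "cycle_of_list ds \<in> Q" by simp
    then show ?thesis
      using 1(2-5) cs Cons by (intro 1(1)[rule_format, of ds]) auto
  qed
qed

text \<open>A three-cycle on the left exchanges one of the two points of a transposition; two such
  moves reach every pair.\<close>

lemma transpositions_of_one:
  assumes "three_cycles_in P X"
    and "\<And>p q. p \<in> P \<Longrightarrow> q \<in> Q \<Longrightarrow> p \<circ> q \<in> Q"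
    and "x \<in> X" "y \<in> X" "x \<noteq> y" "T x y \<in> Q"
    and "a \<in> X" "b \<in> X" "a \<noteq> b"
  shows "T a b \<in> Q"
proof -
  have step: "T x z \<in> Q" if "T x y \<in> Q" "x \<in> X" "y \<in> X" "z \<in> X" "x \<noteq> y" "x \<noteq> z" for x y z
  proof (cases "z = y")
    case False
    then have "T z x \<circ> T x y \<in> P"
      using assms(1) that by (auto simp: three_cycles_in_def three_cycle_in_def)
    then have "(T z x \<circ> T x y) \<circ> T x y \<in> Q" using assms(2) that by blast
    moreover have "(T z x \<circ> T x y) \<circ> T x y = T x z"
      by (simp add: fun_eq_iff transpose_commute)
    ultimately show ?thesis by simp
  qed (use that in simp)
  show ?thesis
  proof (cases "a = x")
    case True
    then show ?thesis using step[of x y b] assms by blast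
  next
    case False
    then have "T a x \<in> Q" using step[of x y a] assms by (simp add: transpose_commute)
    then show ?thesis using step[of a x b] assms False by blast
  qed
qed

text \<open>Only closure under \<open>p \<circ> q \<circ> p\<close> is asked, because a product of
  three twisted permutations is twisted again, while two twists cancel.\<close>

lemma star_conj_transpositions:
  assumes "\<And>x. x \<in> X \<Longrightarrow> x \<noteq> c \<Longrightarrow> T c x \<in> Q"
    and "\<And>p q. p \<in> Q \<Longrightarrow> q \<in> Q \<Longrightarrow> p \<circ> q \<circ> p \<in> Q"
    and "a \<in> X" "b \<in> X" "a \<noteq> b" 
  shows "T a b \<in> Q"
proof -
  have "T a b = T c a \<circ> T c b \<circ> T c a" if "a \<noteq> c" "b \<noteq> c"
    using that assms by (auto simp: fun_eq_iff transpose_def)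
  then show ?thesis using assms by (metis transpose_commute)
qed

lemma cycle_of_upt:
  assumes "a < b"
  shows "cycle_of_list [a..<Suc b] x = (if x = b then a else if a \<le> x \<and> x < b then Suc x else x)"
  using assms
proof (induction "b - a" arbitrary: a x)
  case (Suc d)
  show ?case
  proof (cases "Suc a = b")
    case True
    then have "[a..<Suc b] = [a, b]" by (auto simp: upt_rec)
    then show ?thesis using True by (auto simp: transpose_def)
  next
    case False
    then have 1: "[a..<Suc b] = a # Suc a # [Suc (Suc a)..<Suc b]"
      "[Suc a..<Suc b] = Suc a # [Suc (Suc a)..<Suc b]"
      using Suc.prems by (auto simp: upt_rec)
    have "cycle_of_list [a..<Suc b] x = T a (Suc a) (cycle_of_list [Suc a..<Suc b] x)"
      unfolding 1 by simp
    also have "\<dots> = T a (Suc a) (if x = b then Suc a else if Suc a \<le> x \<and> x < b then Suc x else x)"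
      by (subst Suc.hyps(1)) (use Suc False in auto)
    also have "\<dots> = (if x = b then a else if a \<le> x \<and> x < b then Suc x else x)"
      using False Suc.prems by (auto simp: transpose_def)
    finally show ?thesis .
  qed
qed auto

text \<open>The points 4, 3, 5, 6, ..., n form one cycle of k, and n, 4, 3 are consecutive in it.
  Conjugation by k shifts the given three-cycle along this cycle, and each new one shares two points
  with those already reached.\<close>

lemma three_cycles_in_chain:
  assumes P: "perm_group P" and n: "n \<ge> 8"
    and k: "bij k" "\<And>p. p \<in> P \<Longrightarrow> k \<circ> p \<circ> pinv k \<in> P"
    and kv: "k 3 = 5" "k 4 = 3" "k n = 4" "\<And>x. 5 \<le> x \<Longrightarrow> x < n \<Longrightarrow> k x = Suc x"
    and t: "three_cycle_in P 3 n 4"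
  shows "three_cycles_in P {3..n::nat}"
proof -
  note conj = three_cycle_in_conj[OF k(1) _ k(2)]
  have t1: "three_cycle_in P 5 4 3" using conj[OF t] kv by simp
  have t2: "three_cycle_in P 6 3 5" using conj[OF t1] kv n by simp
  have t3: "three_cycle_in P 7 5 6" using conj[OF t2] kv n by simp
  have t4: "three_cycle_in P (Suc (Suc i)) i (Suc i)" if "5 \<le> i" "Suc (Suc i) \<le> n" for i
    using that
  proof (induction i rule: dec_induct)
    case base
    then show ?case using t3 by (simp add: eval_nat_numeral)
  next
    case (step i)
    then show ?case using conj[OF step.IH] kv by simp
  qed
  have "three_cycles_in P {3..m}" if "6 \<le> m" "m \<le> n" for m
    using that
  proof (induction m rule: dec_induct)
    case base
    have "three_cycles_in P (insert 5 {4, 3})"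
      by (rule three_cycles_in_insert[where p = 4 and q = 3, OF P three_cycles_in_pair])
        (use three_cycle_in_rotate[OF _ t1] in auto)
    then have "three_cycles_in P (insert 6 (insert 5 {4, 3}))"
      by (rule three_cycles_in_insert[OF P, of _ 3 5])
        (use three_cycle_in_rotate[OF _ t2] in auto)
    moreover have "insert 6 (insert 5 {4, 3}) = {3..6::nat}" by auto
    ultimately show ?case by simp
  next
    case (step m)
    have t5: "three_cycle_in P (m - 1) m (Suc m)"
      using three_cycle_in_rotate[OF _ t4[of "m - 1"]] step by (cases m) auto
    have "three_cycles_in P (insert (Suc m) {3..m})"
      by (rule three_cycles_in_insert[OF P, of _ "m - 1" m])
        (use step t5 in auto)
    moreover have "insert (Suc m) {3..m} = {3..Suc m}" using step by auto
    ultimately show ?case by simp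
  qed
  then show ?thesis using n by simp
qed

section \<open>Consequences of the relations\<close>

declare One_nat_def [simp del]

text \<open>Products in the monoid act from left to right, so \<open>g\<close> reverses the
  composition of functions.\<close>

locale sym_map =
  fixes n :: nat and g :: "(nat \<Rightarrow> nat) \<Rightarrow> 'm::monoid_mult"
  assumes n: "n \<ge> 7"
    and g_id: "g id = 1"
    and g_comp: "p permutes {1..n} \<Longrightarrow> q permutes {1..n} \<Longrightarrow> g (q \<circ> p) = g p * g q"
begin

abbreviation tau :: 'm where "tau \<equiv> g (T 1 2)"

lemma permutes_sub: "p permutes {k..n} \<Longrightarrow> 1 \<le> k \<Longrightarrow> p permutes {1..n}"
  by (erule permutes_subset) auto

lemma permutes_T: "a \<in> {k..n} \<Longrightarrow> b \<in> {k..n} \<Longrightarrow> T a b permutes {k..n}"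
  by (rule permutes_swap_id)

lemma g_inv_right: "p permutes {1..n} \<Longrightarrow> g p * g (pinv p) = 1"
  using g_comp[of p "pinv p"] permutes_inv_o(2)[of p] permutes_inv[of p] g_id by simp

lemma g_inv_left: "p permutes {1..n} \<Longrightarrow> g (pinv p) * g p = 1"
  using g_comp[of "pinv p" p] permutes_inv_o(1)[of p] permutes_inv[of p] g_id by simp

lemma g_inv_left': "p permutes {1..n} \<Longrightarrow> g (pinv p) * (g p * x) = x"
  using g_inv_left by (simp flip: mult.assoc)

lemma g_inv_right': "p permutes {1..n} \<Longrightarrow> g p * (g (pinv p) * x) = x"
  using g_inv_right by (simp flip: mult.assoc)

lemma g_T_sq: "a \<in> {1..n} \<Longrightarrow> b \<in> {1..n} \<Longrightarrow> g (T a b) * g (T a b) = 1"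
  using g_inv_right[OF permutes_T[of a 1 b]] by simp

lemma g_T_sq': "a \<in> {1..n} \<Longrightarrow> b \<in> {1..n} \<Longrightarrow> g (T a b) * (g (T a b) * x) = x"
  using g_inv_right'[OF permutes_T[of a 1 b]] by simp

lemma tau_sq: "tau * tau = 1" "tau * (tau * x) = x"
  using g_T_sq[of 1 2] g_T_sq'[of 1 2] n by auto

lemma tau_permutes: "T 1 2 permutes {1..n}"
  using n by (intro permutes_T) auto

lemma T_disjoint_comm:
  assumes "p permutes X" "a \<notin> X" "b \<notin> X"
  shows "T a b \<circ> p = p \<circ> T a b"
proof
  fix x
  have "bij p" by (rule permutes_bij[OF assms(1)])
  have p: "p a = a" "p b = b" using assms by (auto simp: permutes_def)
  have "p x = a \<longleftrightarrow> x = a" "p x = b \<longleftrightarrow> x = b"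
    using bij_is_inj[OF \<open>bij p\<close>] p by (metis injD)+
  then show "(T a b \<circ> p) x = (p \<circ> T a b) x"
    using p by (simp add: transpose_def)
qed

lemma tau_comm:
  assumes "p permutes {3..n}"
  shows "tau * g p = g p * tau"
proof -
  have "T 1 2 \<circ> p = p \<circ> T 1 2" by (rule T_disjoint_comm[OF assms]) auto
  then show ?thesis
    using g_comp[OF tau_permutes permutes_sub[OF assms]] g_comp[OF permutes_sub[OF assms] tau_permutes]
    by simp
qed

lemma tau_comm': "p permutes {3..n} \<Longrightarrow> tau * (g p * x) = g p * (tau * x)"
  using tau_comm by (simp flip: mult.assoc)

end

section \<open>Permutations commuting with \<eta>, or with \<zeta> up to a twist\<close>

locale pt_relations = sym_map n g for n :: nat and g :: "(nat \<Rightarrow> nat) \<Rightarrow> 'm::monoid_mult" +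
  fixes \<alpha> \<beta> :: "nat \<Rightarrow> nat" and z h :: 'm
  assumes alpha: "\<alpha> permutes {3..n}" and beta: "\<beta> permutes {3..n}"
    and alpha_beta: "odd n \<Longrightarrow> \<alpha> = cyc [3..<Suc n]" "odd n \<Longrightarrow> \<beta> = cyc [4, 6]"
      "even n \<Longrightarrow> \<alpha> = cyc [3, 5, 4]" "even n \<Longrightarrow> \<beta> = cyc [3..<Suc n]"
    and R1: "g (T 1 n \<circ> T 2 3) * z * g (T 1 n \<circ> T 2 3) * z = z * g (T 1 n \<circ> T 2 3) * z * g (T 1 n \<circ> T 2 3)"
    and R2: "g (T 2 3) * z * g (T 2 3) * z * g (T 2 3) * z * g (T 2 3) = z * g (T 2 3) * z"
    and R3: "g (T 1 3) * h * g (T 1 3) * z = z * g (T 1 3) * h * g (T 1 3)"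
    and R4: "tau * h * tau * h * tau = z * h"
    and R5: "g (pinv \<alpha>) * z * g \<alpha> = tau * z * tau * h * tau"
    and R6: "g (pinv \<beta>) * z * g \<beta> = z * tau * h * tau"
    and R7: "g (pinv (T 2 3 \<circ> \<alpha>)) * h * g (T 2 3 \<circ> \<alpha>) = h * tau * z * tau"
    and R8: "g (pinv (T 2 3 \<circ> \<beta>)) * h * g (T 2 3 \<circ> \<beta>) = h * tau * z * tau"
begin

text \<open>In the model this is the identity with 2, instead of 1, removed from its domain.\<close>

definition X :: 'm where "X = tau * h * tau"

abbreviation \<gamma> where "\<gamma> \<equiv> T 2 3 \<circ> \<alpha>"
abbreviation \<delta> where "\<delta> \<equiv> T 2 3 \<circ> \<beta>"

text \<open>Since \<open>g\<close> reverses composition, this is the product \<alpha>\<beta>^-1 of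
  the overview.\<close>

definition lam :: "nat \<Rightarrow> nat" where "lam = pinv \<beta> \<circ> \<alpha>"

text \<open>The flag counts factors \<open>tau\<close> modulo 2. A permutation may carry both flags;
  only \<open>tau_z\<close> will show that the two conditions coincide.\<close>

definition twist :: "bool \<Rightarrow> (nat \<Rightarrow> nat) set" where
  "twist b = {p. p permutes {3..n} \<and> z * g p = g p * (if b then tau * z else z)}"

definition H :: "(nat \<Rightarrow> nat) set" where
  "H = {p. p permutes {2..n} \<and> h * g p = g p * h}"

lemma twist_permutes: "p \<in> twist b \<Longrightarrow> p permutes {3..n}"
  by (simp add: twist_def)

lemma H_permutes: "p \<in> H \<Longrightarrow> p permutes {2..n}"
  by (simp add: H_def)

lemma permutes_1: "p permutes {3..n} \<Longrightarrow> p permutes {1..n}" "p permutes {2..n} \<Longrightarrow> p permutes {1..n}"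
  by (auto elim: permutes_sub)

lemma gamma: "\<gamma> permutes {2..n}" and delta: "\<delta> permutes {2..n}"
  using n by (auto intro!: permutes_compose permutes_T permutes_subset[OF alpha] permutes_subset[OF beta])

text \<open>\<open>tau\<close> commutes with permutations that fix 1 and 2, so twists can be
  collected and cancel in pairs.\<close>

lemma twist_comp:
  assumes "p \<in> twist a" "q \<in> twist b"
  shows "q \<circ> p \<in> twist (a \<noteq> b)"
proof -
  have p: "p permutes {3..n}" and q: "q permutes {3..n}"
    using assms by (auto simp: twist_def)
  have "z * g (q \<circ> p) = (z * g p) * g q"
    by (simp add: g_comp permutes_1 p q mult.assoc)
  also have "\<dots> = g p * (if a then tau * (z * g q) else z * g q)"
    using assms by (auto simp: twist_def mult.assoc)
  also have "\<dots> = g p * (g q * (if a \<noteq> b then tau * z else z))"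
    using assms by (auto simp: twist_def tau_comm' q tau_sq)
  also have "\<dots> = g (q \<circ> p) * (if a \<noteq> b then tau * z else z)"
    by (simp add: g_comp permutes_1 p q mult.assoc)
  finally show ?thesis using p q by (simp add: twist_def permutes_compose)
qed

lemma twist_inv:
  assumes "p \<in> twist a"
  shows "pinv p \<in> twist a"
proof -
  have p: "p permutes {3..n}" and p': "pinv p permutes {3..n}"
    using assms by (auto simp: twist_def permutes_inv)
  let ?w = "if a then tau else 1"
  have 0: "z * g p = g p * (?w * z)" using assms by (simp add: twist_def)
  have "z * g (pinv p) = g (pinv p) * (?w * (?w * (g p * (z * g (pinv p)))))"
    by (simp add: g_inv_left' g_inv_right' permutes_1 p tau_sq tau_comm')
  also have "?w * (g p * (z * g (pinv p))) = (g p * (?w * z)) * g (pinv p)"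
    by (simp add: tau_comm' p mult.assoc)
  also have "\<dots> = z"
    unfolding 0[symmetric] by (simp add: mult.assoc g_inv_right permutes_1 p)
  finally show ?thesis using p' by (simp add: twist_def)
qed

lemma twist_id: "id \<in> twist False"
  by (simp add: twist_def g_id permutes_id)

lemma twist_group: "perm_group (twist False)"
  unfolding perm_group_def
  using twist_id twist_inv twist_comp[of _ False _ False] twist_permutes permutes_bij by fastforce

lemma twist_conj: "p \<in> twist b \<Longrightarrow> q \<in> twist a \<Longrightarrow> p \<circ> q \<circ> pinv p \<in> twist a"
  using twist_comp[OF twist_comp[OF twist_inv[of p b], of q a], of p b]
  by (cases a; cases b) (auto simp: comp_assoc)

lemma H_group: "perm_group H"
  unfolding perm_group_def
proof (intro conjI ballI)
  show "id \<in> H" by (simp add: H_def g_id permutes_id)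
next
  fix p assume p: "p \<in> H"
  then show "bij p" by (auto simp: H_def permutes_bij)
  have pp: "p permutes {1..n}" using p by (auto simp: H_def permutes_1)
  have "h * g (pinv p) = g (pinv p) * ((g p * h) * g (pinv p))"
    by (simp add: g_inv_left' pp mult.assoc)
  also have "\<dots> = g (pinv p) * ((h * g p) * g (pinv p))"
    using p by (simp add: H_def)
  finally show "pinv p \<in> H"
    using p by (simp add: H_def mult.assoc g_inv_right pp permutes_inv)
next
  fix p q assume pq: "p \<in> H" "q \<in> H"
  then have h: "h * g p = g p * h" and q: "h * (g q * x) = g q * (h * x)" for x
    by (simp_all add: H_def flip: mult.assoc)
  then show "p \<circ> q \<in> H"
    using pq by (auto simp: H_def g_comp permutes_1 mult.assoc permutes_compose)
qed

lemma H_conj: "p \<in> H \<Longrightarrow> q \<in> H \<Longrightarrow> p \<circ> q \<circ> pinv p \<in> H"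
  using H_group by (auto simp: perm_group_def)

text \<open>The right-hand sides of R5 and R6 differ only by a factor \<open>tau\<close> on the
  left.\<close>

lemma lam_twist: "lam \<in> twist True"
proof -
  have b: "pinv \<beta> permutes {3..n}" by (rule permutes_inv[OF beta])
  have "z * g \<alpha> = g \<alpha> * (g (pinv \<alpha>) * z * g \<alpha>)"
    by (simp add: mult.assoc g_inv_right' permutes_1 alpha)
  also have "\<dots> = g \<alpha> * (tau * (g (pinv \<beta>) * z * g \<beta>))"
    unfolding R5 R6 by (simp add: mult.assoc)
  finally have "z * g \<alpha> * g (pinv \<beta>) = g \<alpha> * (g (pinv \<beta>) * (tau * z))"
    by (simp add: mult.assoc g_inv_right permutes_1 beta tau_comm' b)
  then show ?thesis
    by (simp add: twist_def lam_def g_comp permutes_1 alpha b permutes_compose mult.assoc)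
qed

text \<open>R7 and R8 have the same right-hand side, so \<gamma> and \<delta> conjugate h to the
  same element.\<close>

lemma lam_H: "lam \<in> H"
proof -
  have b: "pinv \<delta> permutes {2..n}" by (rule permutes_inv[OF delta])
  have "pinv \<delta> = pinv \<beta> \<circ> T 2 3"
    using permutes_bij[OF beta] by (subst o_inv_distrib) auto
  then have lam: "lam = pinv \<delta> \<circ> \<gamma>"
    by (simp add: lam_def fun_eq_iff)
  have "h * g \<gamma> = g \<gamma> * (g (pinv \<gamma>) * h * g \<gamma>)"
    by (simp only: mult.assoc g_inv_right' permutes_1 gamma)
  also have "\<dots> = g \<gamma> * (g (pinv \<delta>) * h * g \<delta>)"
    unfolding R7 R8 ..
  finally have "h * g \<gamma> * g (pinv \<delta>) = g \<gamma> * g (pinv \<delta>) * h"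
    by (simp only: mult.assoc g_inv_right permutes_1 delta mult_1_right)
  then have "h * g (pinv \<delta> \<circ> \<gamma>) = g (pinv \<delta> \<circ> \<gamma>) * h"
    by (simp only: g_comp permutes_1 gamma b mult.assoc)
  then show ?thesis
    using permutes_compose[OF gamma b] unfolding lam H_def by blast
qed

text \<open>By R8, \<delta> conjugates h to \<open>h * tau * z * tau\<close>. As p commutes with
  every factor of this product, its conjugate commutes with h.\<close>

lemma H_conj_delta:
  assumes "p \<in> H" "p \<in> twist False"
  shows "pinv \<delta> \<circ> p \<circ> \<delta> \<in> H"
proof -
  have p: "p permutes {3..n}" using assms by (simp add: twist_def)
  have d: "pinv \<delta> permutes {2..n}" by (rule permutes_inv[OF delta])
  note p2 = H_permutes[OF assms(1)]
  let ?k = "h * tau * z * tau"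
  have k: "?k * g p = g p * ?k"
    using assms by (auto simp: H_def twist_def mult.assoc tau_comm[OF p] tau_comm'[OF p])
      (metis (no_types, lifting) mult.assoc tau_comm'[OF p])
  have hd: "h * g \<delta> = g \<delta> * ?k"
    unfolding R8[symmetric] by (simp only: mult.assoc g_inv_right' permutes_1 delta)
  have kd: "?k * g (pinv \<delta>) = g (pinv \<delta>) * h"
    unfolding R8[symmetric] by (simp only: mult.assoc g_inv_right permutes_1 delta mult_1_right)
  have gg: "g (pinv \<delta> \<circ> p \<circ> \<delta>) = g \<delta> * (g p * g (pinv \<delta>))"
    by (simp only: g_comp permutes_1 delta p2 d permutes_compose comp_assoc mult.assoc)
  have "h * g (pinv \<delta> \<circ> p \<circ> \<delta>) = (h * g \<delta>) * (g p * g (pinv \<delta>))"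
    unfolding gg by (simp only: mult.assoc)
  also have "\<dots> = g \<delta> * ((?k * g p) * g (pinv \<delta>))"
    unfolding hd by (simp only: mult.assoc)
  also have "\<dots> = g \<delta> * (g p * (?k * g (pinv \<delta>)))"
    unfolding k by (simp only: mult.assoc)
  also have "\<dots> = g (pinv \<delta> \<circ> p \<circ> \<delta>) * h"
    unfolding kd gg by (simp only: mult.assoc)
  finally show ?thesis
    using p2 d delta by (simp add: H_def permutes_compose)
qed

lemma X_comm:
  assumes "p \<in> H" "p permutes {3..n}"
  shows "X * g p = g p * X"
proof -
  have h: "h * g p = g p * h" using assms by (simp add: H_def)
  then have "h * (g p * x) = g p * (h * x)" for x by (simp flip: mult.assoc)
  then show ?thesis
    using h by (simp add: X_def mult.assoc tau_comm tau_comm' assms)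
qed

text \<open>By R6, \<beta> conjugates z to \<open>z * X\<close>. As p commutes with
  \<open>X\<close>, it has the same twist with respect to \<open>z * X\<close> as to z.\<close>

lemma twist_conj_beta:
  assumes "p \<in> H" "p \<in> twist b"
  shows "pinv \<beta> \<circ> p \<circ> \<beta> \<in> twist b"
proof -
  have p: "p permutes {3..n}" using assms by (simp add: twist_def)
  have b: "pinv \<beta> permutes {3..n}" by (rule permutes_inv[OF beta])
  let ?w = "if b then tau else 1"
  have zp: "z * g p = g p * (?w * z)" using assms by (simp add: twist_def)
  have R6': "g (pinv \<beta>) * z * g \<beta> = z * X" using R6 by (simp add: X_def mult.assoc)
  have zb: "z * g \<beta> = g \<beta> * (z * X)"
    unfolding R6'[symmetric] by (simp only: mult.assoc g_inv_right' permutes_1 beta)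
  have bz: "z * X * g (pinv \<beta>) = g (pinv \<beta>) * z"
    unfolding R6'[symmetric] by (simp only: mult.assoc g_inv_right permutes_1 beta mult_1_right)
  have w: "?w * (g (pinv \<beta>) * x) = g (pinv \<beta>) * (?w * x)" for x by (simp add: tau_comm' b)
  have gg: "g (pinv \<beta> \<circ> p \<circ> \<beta>) = g \<beta> * (g p * g (pinv \<beta>))"
    by (simp only: g_comp permutes_1 beta p b permutes_compose comp_assoc mult.assoc)
  have "z * g (pinv \<beta> \<circ> p \<circ> \<beta>) = (z * g \<beta>) * (g p * g (pinv \<beta>))"
    unfolding gg by (simp only: mult.assoc)
  also have "\<dots> = g \<beta> * (z * (X * g p) * g (pinv \<beta>))"
    unfolding zb by (simp only: mult.assoc)
  also have "\<dots> = g \<beta> * ((z * g p) * (X * g (pinv \<beta>)))"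
    unfolding X_comm[OF assms(1) p] by (simp only: mult.assoc)
  also have "\<dots> = g \<beta> * (g p * (?w * (z * X * g (pinv \<beta>))))"
    unfolding zp by (simp only: mult.assoc)
  also have "\<dots> = g (pinv \<beta> \<circ> p \<circ> \<beta>) * (?w * z)"
    unfolding bz gg w by (simp only: mult.assoc)
  finally show ?thesis
    using p b beta by (simp add: twist_def permutes_compose)
qed

text \<open>\<alpha> is the composite of \<open>lam\<close> and \<beta>, and conjugation by a
  twisted permutation such as \<open>lam\<close> preserves the twist.\<close>

lemma twist_conj_alpha:
  assumes "p \<in> H" "p \<in> twist b"
  shows "pinv \<alpha> \<circ> p \<circ> \<alpha> \<in> twist b"
proof -
  have "pinv lam \<circ> (pinv \<beta> \<circ> p \<circ> \<beta>) \<circ> pinv (pinv lam) \<in> twist b"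
    by (rule twist_conj[OF twist_inv[OF lam_twist] twist_conj_beta[OF assms]])
  moreover have "pinv lam \<circ> (pinv \<beta> \<circ> p \<circ> \<beta>) \<circ> pinv (pinv lam) = pinv \<alpha> \<circ> p \<circ> \<alpha>"
  proof -
    have "pinv lam = pinv \<alpha> \<circ> \<beta>"
      using permutes_bij[OF alpha] permutes_bij[OF beta]
      by (simp add: lam_def o_inv_distrib inv_inv_eq bij_imp_bij_inv)
    moreover have "pinv (pinv lam) = lam"
      using permutes_bij[OF twist_permutes[OF lam_twist]] by (rule inv_inv_eq)
    ultimately show ?thesis
      by (simp add: lam_def fun_eq_iff permutes_inverses(1)[OF beta])
  qed
  ultimately show ?thesis by simp
qed

end

lemma comp_funpow_comm:
  assumes "f \<circ> k = k \<circ> f"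
  shows "(f \<circ> k) ^^ i = (f ^^ i) \<circ> (k ^^ i)"
proof (induction i)
  case (Suc i)
  have "k \<circ> (f ^^ i) = (f ^^ i) \<circ> k" for i
  proof (induction i)
    case (Suc i)
    have "k \<circ> (f ^^ Suc i) = f \<circ> (k \<circ> (f ^^ i))"
      using assms by (simp add: fun_eq_iff)
    then show ?case using Suc by (simp add: fun_eq_iff)
  qed simp
  then show ?case
    using Suc by (simp add: fun_eq_iff)
qed simp

text \<open>Conjugation by u and c keeps the point 5 of \<open>T 5 4\<close> and moves the other
  one: u leads from 4 through 7, ..., n to r, and c leads from n to 3 and on to 6. It is applied
  with r = 3 for \<zeta> and with r = 2 for \<eta>.\<close>

lemma transpose_conj_star:
  fixes Q :: "(nat \<Rightarrow> nat) set"
  assumes n: "n \<ge> 7"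
    and u: "bij u" "\<And>q. q \<in> Q \<Longrightarrow> u \<circ> q \<circ> pinv u \<in> Q"
    and c: "bij c" "\<And>q. q \<in> Q \<Longrightarrow> c \<circ> q \<circ> pinv c \<in> Q"
    and uv: "u 5 = 5" "u 4 = 7" "u n = r" "\<And>x. 7 \<le> x \<Longrightarrow> x < n \<Longrightarrow> u x = Suc x"
    and cv: "c 5 = 5" "c n = 3" "c 3 = 6"
    and t: "T 5 4 \<in> Q" and x: "x \<in> {3..n} \<union> {r}" "x \<noteq> 5"
  shows "T 5 x \<in> Q"
proof -
  have U: "T 5 (u x) \<in> Q" if "T 5 x \<in> Q" for x
    using u(2)[OF that] uv(1) by (simp add: transpose_conj u(1))
  have C: "T 5 (c x) \<in> Q" if "T 5 x \<in> Q" for x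
    using c(2)[OF that] cv(1) by (simp add: transpose_conj c(1))
  have 7: "T 5 i \<in> Q" if "7 \<le> i" "i \<le> n" for i
    using that
  proof (induction i rule: dec_induct)
    case base
    then show ?case using U[OF t] uv by simp
  next
    case (step i)
    then show ?case using U[OF step.IH] uv by simp
  qed
  have 3: "T 5 3 \<in> Q" using C[OF 7[of n]] n cv by simp
  have 6: "T 5 6 \<in> Q" using C[OF 3] cv by simp
  have r: "T 5 r \<in> Q" using U[OF 7[of n]] n uv by simp
  consider "x = 3" | "x = 4" | "x = 6" | "x = r" | "7 \<le> x" "x \<le> n"
    using x by force
  then show ?thesis using 3 6 r t 7 by cases auto
qed

lemma double_transpose_conj:
  assumes "bij p"
  shows "p \<circ> (T a b \<circ> T c d) \<circ> pinv p = T (p a) (p b) \<circ> T (p c) (p d)"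
proof -
  have "p \<circ> (T a b \<circ> T c d) \<circ> pinv p = (p \<circ> T a b \<circ> pinv p) \<circ> (p \<circ> T c d \<circ> pinv p)"
    using assms by (auto simp: fun_eq_iff bij_is_inj)
  then show ?thesis by (simp only: transpose_conj[OF assms])
qed

lemma (in pt_relations) twist_funpow: "p \<in> twist True \<Longrightarrow> p ^^ i \<in> twist (odd i)"
proof (induction i)
  case (Suc i)
  then show ?case using twist_comp[of "p ^^ i" "odd i" p True] by (simp add: comp_def)
qed (use twist_id in simp)

lemma (in pt_relations) H_funpow: "p \<in> H \<Longrightarrow> p ^^ i \<in> H"
  by (induction i) (use perm_groupD[OF H_group] in auto)

section \<open>Odd degree\<close>

locale pt_relations_odd = pt_relations n g \<alpha> \<beta> z h
  for n and g :: "(nat \<Rightarrow> nat) \<Rightarrow> 'm::monoid_mult" and \<alpha> \<beta> z h +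
  assumes odd: "odd n"
begin

text \<open>The part of \<open>lam\<close> that is disjoint from the transposition of 4 and 5; its
  length n - 4 is odd.\<close>

definition c :: "nat \<Rightarrow> nat" where "c = cyc (3 # [6..<Suc n])"

lemma beta_eq: "\<beta> = T 4 6"
  using alpha_beta(2)[OF odd] by simp

lemma c_eq: "c = T 3 6 \<circ> cyc [6..<Suc n]"
proof -
  have "[6..<Suc n] = 6 # [7..<Suc n]"
    using n by (simp add: upt_conv_Cons)
  then show ?thesis by (simp add: c_def)
qed

lemma c_val: "c x = (if x = n then 3 else if x = 3 then 6 else if 6 \<le> x \<and> x < n then Suc x else x)"
  unfolding c_eq comp_def using n by (subst cycle_of_upt) (auto simp: transpose_def)

lemma alpha_val: "\<alpha> x = (if x = n then 3 else if 3 \<le> x \<and> x < n then Suc x else x)"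
  unfolding alpha_beta(1)[OF odd] using n by (subst cycle_of_upt) auto

lemma c_funpow: "c ^^ (n - 4) = id"
proof -
  have "distinct (3 # [6..<Suc n])" by auto
  moreover have "length (3 # [6..<Suc n]) = n - 4" using n by simp
  ultimately show ?thesis
    using cycle_is_id_root[of "3 # [6..<Suc n]"] by (metis c_def)
qed

lemma c_bij: "bij c"
  unfolding c_def by (rule permutes_bij[OF cycle_permutes])

lemma lam_eq: "lam = c \<circ> T 4 5"
proof
  fix x
  show "lam x = (c \<circ> T 4 5) x"
    unfolding lam_def unfolding beta_eq comp_apply alpha_val c_val inv_transpose_eq
    using n by (auto simp: transpose_def)
qed

lemma T45_funpow: "T 4 (5::nat) ^^ i = (if odd i then T 4 5 else id)"
  by (induction i) auto

text \<open>The power n - 4 of \<open>lam\<close> kills the cycle \<open>c\<close>, and since n - 4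
  is odd, the transposition and the twist survive.\<close>

lemma T45: "T 4 5 \<in> twist True" "T 4 5 \<in> H"
proof -
  have comm: "c \<circ> T 4 5 = T 4 5 \<circ> c"
    unfolding c_def by (rule T_disjoint_comm[OF cycle_permutes, symmetric]) auto
  have "odd (n - 4)" using odd n by auto
  then have *: "lam ^^ (n - 4) = T 4 5"
    unfolding lam_eq comp_funpow_comm[OF comm] c_funpow T45_funpow by simp
  show "T 4 5 \<in> twist True"
    using twist_funpow[OF lam_twist, of "n - 4"] \<open>odd (n - 4)\<close> * by simp
  show "T 4 5 \<in> H"
    using H_funpow[OF lam_H, of "n - 4"] * by simp
qed

lemma c_lam: "c = lam \<circ> T 4 5"
  by (simp add: lam_eq comp_assoc)

lemma c: "c \<in> twist False" "c \<in> H"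
  unfolding c_lam using twist_comp[OF T45(1) lam_twist] perm_groupD(4)[OF H_group lam_H T45(2)]
  by auto

lemma twist_transpositions:
  assumes "a \<in> {3..n}" "b \<in> {3..n}" "a \<noteq> b"
  shows "T a b \<in> twist True"
proof -
  \<comment> \<open>This is \<open>c\<close> with 6 replaced by 4: the cycle 3, 4, 7, ...,
    n.\<close>
  let ?u = "pinv \<beta> \<circ> c \<circ> \<beta>"
  have u: "?u \<in> twist False" by (rule twist_conj_beta[OF c(2,1)])
  have star: "T 5 x \<in> twist True" if "x \<in> {3..n}" "x \<noteq> 5" for x
    by (rule transpose_conj_star[OF n, of ?u _ c 3])
      (use u c n T45(1) that permutes_bij[OF twist_permutes[OF u]] c_bij
        in \<open>auto simp: beta_eq c_val transpose_def transpose_commute intro: twist_conj\<close>)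
  show ?thesis
  proof (rule star_conj_transpositions[of "{3..n}" 5])
    fix p q assume "p \<in> twist True" "q \<in> twist True"
    then show "p \<circ> q \<circ> p \<in> twist True"
      using twist_comp[OF twist_comp[of p True q True], of p True] by (simp add: comp_assoc)
  qed (use star assms in auto)
qed

lemma H_transpositions:
  assumes "a \<in> {2..n}" "b \<in> {2..n}" "a \<noteq> b"
  shows "T a b \<in> H"
proof -
  \<comment> \<open>Conjugation by \<delta> also exchanges 2 and 3, which gives the cycle 2, 4, 7,
    ..., n and brings the point 2 within reach.\<close>
  let ?u = "pinv \<delta> \<circ> c \<circ> \<delta>"
  have u: "?u \<in> H" by (rule H_conj_delta[OF c(2,1)])
  have d: "pinv (T 2 3 \<circ> T 4 6) = T 4 6 \<circ> T 2 3" by (simp add: o_inv_distrib)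
  have star: "T 5 x \<in> H" if "x \<in> {2..n}" "x \<noteq> 5" for x
    by (rule transpose_conj_star[OF n, of ?u _ c 2])
      (use u c n T45(2) that permutes_bij[OF H_permutes[OF u]] c_bij
        in \<open>auto simp: d beta_eq c_val transpose_def transpose_commute intro: H_conj\<close>)
  show ?thesis
    by (rule star_conj_transpositions[of "{2..n}" 5])
      (use star assms perm_groupD[OF H_group] in auto)
qed

end

section \<open>Even degree\<close>

locale pt_relations_even = pt_relations n g \<alpha> \<beta> z h
  for n and g :: "(nat \<Rightarrow> nat) \<Rightarrow> 'm::monoid_mult" and \<alpha> \<beta> z h +
  assumes even: "even n"
begin

lemma n8: "n \<ge> 8"
  using n even by (cases "n = 7") auto

lemma alpha_eq: "\<alpha> = T 3 5 \<circ> T 5 4"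
  using alpha_beta(3)[OF even] by simp

lemma beta_val: "\<beta> x = (if x = n then 3 else if 3 \<le> x \<and> x < n then Suc x else x)"
  unfolding alpha_beta(4)[OF even] using n by (subst cycle_of_upt) auto

text \<open>The inverse of \<open>lam\<close>, which is the cycle 3, 5, 6, ..., n, 4.\<close>

definition k :: "nat \<Rightarrow> nat" where "k = pinv \<alpha> \<circ> \<beta>"

lemma inv_alpha: "pinv \<alpha> = T 5 4 \<circ> T 3 5"
  by (simp add: alpha_eq o_inv_distrib)

lemma k_val: "k x = (if x = n then 4 else if x = 3 then 5 else if x = 4 then 3
    else if 5 \<le> x \<and> x < n then Suc x else x)"
  using n8 by (auto simp: k_def inv_alpha beta_val transpose_def)

lemma delta_val: "\<delta> x = (if x = n then 2 else if 2 \<le> x \<and> x < n then Suc x else x)"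
  using n8 by (auto simp: beta_val transpose_def)

lemma k_lam: "k = pinv lam"
  using permutes_bij[OF alpha] permutes_bij[OF beta]
  by (simp add: k_def lam_def o_inv_distrib inv_inv_eq bij_imp_bij_inv)

lemma k: "k \<in> twist True" "k \<in> H" "bij k"
  using twist_inv[OF lam_twist] perm_groupD(3)[OF H_group lam_H] twist_permutes permutes_bij
  unfolding k_lam by blast+

lemma alpha_k: "\<beta> = \<alpha> \<circ> k"
  by (simp add: k_def fun_eq_iff permutes_inverses(1)[OF alpha])

lemma inv_beta_val: "pinv \<beta> 3 = n" "pinv \<beta> 4 = 3" "pinv \<beta> 5 = 4"
  using n8 by (auto intro!: inv_f_eq permutes_inj[OF beta] simp: beta_val)

lemma twist_three_cycles: "three_cycles_in (twist False) {3..n}"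
proof (rule three_cycles_in_chain[OF twist_group n8 k(3)])
  \<comment> \<open>The twists of \<open>k\<close> and of its conjugate \<open>?k2\<close> cancel,
    so \<open>pinv ?k2 \<circ> k\<close> is untwisted. It is the commutator of \<alpha> and \<beta>,
    hence a product of two three-cycles, which here overlap so as to leave one.\<close>
  let ?k2 = "pinv \<alpha> \<circ> k \<circ> \<alpha>"
  have bb: "bij (pinv \<beta>)" "pinv (pinv \<beta>) = \<beta>"
    using permutes_bij[OF beta] by (auto simp: bij_imp_bij_inv inv_inv_eq)
  have k2: "?k2 \<in> twist True" by (rule twist_conj_alpha[OF k(2,1)])
  have "pinv ?k2 = pinv \<alpha> \<circ> (pinv \<beta> \<circ> \<alpha>) \<circ> \<alpha>"
    using permutes_bij[OF alpha] permutes_bij[OF beta]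
    by (simp add: k_def o_inv_distrib inv_inv_eq bij_imp_bij_inv bij_comp comp_assoc)
  then have "pinv ?k2 \<circ> k = pinv \<alpha> \<circ> (pinv \<beta> \<circ> \<alpha> \<circ> \<beta>)"
    by (simp add: k_def fun_eq_iff permutes_inverses(1)[OF alpha])
  also have "pinv \<beta> \<circ> \<alpha> \<circ> \<beta> = T n 4 \<circ> T 4 3"
    using double_transpose_conj[OF bb(1), of 3 5 5 4] by (simp add: bb(2) alpha_eq inv_beta_val)
  also have "pinv \<alpha> \<circ> (T n 4 \<circ> T 4 3) = T 3 n \<circ> T n 5"
    using n8 by (auto simp: inv_alpha transpose_def fun_eq_iff)
  finally have "pinv ?k2 \<circ> k = T 3 n \<circ> T n 5" .
  moreover have "pinv ?k2 \<circ> k \<in> twist False"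
    using twist_comp[OF k(1) twist_inv[OF k2]] by simp
  ultimately have t1: "three_cycle_in (twist False) 3 n 5"
    by (simp only: three_cycle_in_def)
  \<comment> \<open>Conjugating by \<open>k\<close> gives the three-cycle on 5, 4, 6. It sends 5 to
    4 and fixes 3 and n, so it carries the first three-cycle to the one wanted.\<close>
  have t2: "three_cycle_in (twist False) (k 3) (k n) (k 5)"
    using k(3) t1 by (rule three_cycle_in_conj) (rule twist_conj[OF k(1)])
  then have th: "T 5 4 \<circ> T 4 6 \<in> twist False"
    using n8 by (simp add: three_cycle_in_def k_val)
  then have "three_cycle_in (twist False) ((T 5 4 \<circ> T 4 6) 3) ((T 5 4 \<circ> T 4 6) n) ((T 5 4 \<circ> T 4 6) 5)"
    by (intro three_cycle_in_conj[OF _ t1 twist_conj[OF th]] bij_comp bij_transpose)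
  then show "three_cycle_in (twist False) 3 n 4"
    using n8 by (simp add: transpose_def)
qed (use n8 twist_conj[OF k(1)] in \<open>auto simp: k_val\<close>)

lemma beta_cycle: "cycle [3..<Suc n]" "set [3..<Suc n] \<subseteq> {3..n}" "even (length [3..<Suc n])"
    "[3..<Suc n] \<noteq> []"
  using even n8 by auto

text \<open>Once \<alpha> is known to be untwisted, \<beta> is twisted. As a cycle of even length n
  - 2 it can be shortened to a transposition.\<close>

lemma twist_transpositions:
  assumes "a \<in> {3..n}" "b \<in> {3..n}" "a \<noteq> b"
  shows "T a b \<in> twist True"
proof -
  have a: "\<alpha> \<in> twist False"
    using twist_three_cycles n8 by (auto simp: three_cycles_in_def three_cycle_in_def alpha_eq)
  then have b: "cyc [3..<Suc n] \<in> twist True"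
    using twist_comp[OF k(1) a] alpha_k alpha_beta(4)[OF even] by simp
  have comp: "p \<circ> q \<in> twist True" if "p \<in> twist False" "q \<in> twist True" for p q
    using twist_comp[OF that(2,1)] by simp
  show ?thesis
    using transposition_of_even_cycle[OF twist_group twist_three_cycles comp beta_cycle b]
      transpositions_of_one[OF twist_three_cycles comp _ _ _ _ assms] by blast
qed

lemma double_transposition_H: "T (n - 1) 4 \<circ> T 2 3 \<in> H"
proof -
  \<comment> \<open>\<open>k\<close> is twisted, but \<open>H_conj_delta\<close> requires an
    untwisted permutation; squaring removes the twist.\<close>
  have kk: "k \<circ> k \<in> H" "k \<circ> k \<in> twist False"
    using perm_groupD(4)[OF H_group k(2) k(2)] twist_comp[OF k(1) k(1)] by auto
  \<comment> \<open>Since \<open>k\<close> and \<open>\<delta>\<close> are almost the shift by one, \<open>F\<close> moves only six points.\<close>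
  define F where "F = pinv (k \<circ> k) \<circ> (pinv \<delta> \<circ> (k \<circ> k) \<circ> \<delta>)"
  have F: "F \<in> H"
    unfolding F_def
    by (intro perm_groupD(4)[OF H_group] perm_groupD(3)[OF H_group] H_conj_delta kk)
  define F' where "F' x = (if x = n - 1 then 2 else if x = 2 then 4 else if x = 4 then 3
      else if x = 3 then n - 1 else if x = n - 2 then n else if x = n then n - 2 else x)" for x
  define d where "d = \<delta>"
  note dv = delta_val[folded d_def]
  obtain m where m: "n = m + 8" using n8 by (metis le_add_diff_inverse2)
  have cases: "x = 2 \<or> x = 3 \<or> x = 4 \<or> x = m + 6 \<or> x = m + 7 \<or> x = m + 8
      \<or> 5 \<le> x \<and> x < m + 6 \<or> x < 2 \<or> m + 8 < x" for x :: nat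
  proof -
    have "x < 2 \<or> x = 2 \<or> x = 3 \<or> x = 4 \<or> 5 \<le> x" by auto
    moreover have "x < m + 6 \<or> x = m + 6 \<or> x = m + 7 \<or> x = m + 8 \<or> m + 8 < x" by auto
    ultimately show ?thesis by blast
  qed
  have F_eq: "F x = F' x" for x
  proof -
    \<comment> \<open>The definition of \<open>F\<close> multiplied out, so that no inverse has to
      be evaluated.\<close>
    have "d (k (k (F' x))) = k (k (d x))"
      using cases[of x] by (elim disjE) (simp_all add: dv k_val F'_def m)
    then have "\<delta> (k (k (F' x))) = k (k (\<delta> x))"
      by (simp only: d_def)
    then have "pinv \<delta> (k (k (\<delta> x))) = k (k (F' x))"
      by (metis permutes_inverses(2)[OF delta])
    then show ?thesis
      using k(3) by (simp add: F_def o_inv_distrib bij_is_inj)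
  qed
  \<comment> \<open>\<open>F\<close> is the four-cycle n - 1, 2, 4, 3 times the transposition of n -
    2 and n, which disappears in the square.\<close>
  have "F \<circ> F = T (n - 1) 4 \<circ> T 2 3"
  proof
    fix x
    show "(F \<circ> F) x = (T (n - 1) 4 \<circ> T 2 3) x"
      unfolding comp_apply F_eq
      using cases[of x] by (elim disjE) (simp_all add: F'_def transpose_def m)
  qed
  then show ?thesis
    using perm_groupD(4)[OF H_group F F] by simp
qed

text \<open>Double transpositions are moved around by \<open>k\<close>, by \<delta> and by one
  another. Multiplying two of them with a common transposition cancels it: this first removes the
  point 2, and later, when the remaining transpositions meet in one point, it leaves a
  three-cycle.\<close>

lemma H_three_cycles_3: "three_cycles_in H {3..n}"
proof (rule three_cycles_in_chain[OF H_group n8 k(3)])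
  note kc = H_conj[OF k(2)] and hc = perm_groupD(4)[OF H_group]
  note tt = twist_transpositions
  have kn: "k (n - 1) = n" "k (n - 2) = n - 1" "k n = 4" "k 2 = 2" "k 3 = 5" "k 4 = 3" "k 5 = 6"
    using n8 by (auto simp: k_val)
  have D1: "T n 3 \<circ> T 2 5 \<in> H"
    using kc[OF double_transposition_H] n8 unfolding double_transpose_conj[OF k(3)] by (simp add: kn)
  have D2: "T 4 5 \<circ> T 2 6 \<in> H"
    using kc[OF D1] n8 unfolding double_transpose_conj[OF k(3)] by (simp add: kn)
  have W: "T (n - 1) 5 \<circ> T 6 3 \<in> H"
  proof -
    have "n - 1 \<noteq> 2" "n - 1 \<noteq> 6" "n - 1 \<noteq> 4" "n - 1 \<noteq> 5" using n8 by auto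
    then show ?thesis
      using H_conj[OF D2 double_transposition_H]
      by (subst (asm) double_transpose_conj) (simp_all add: transpose_def bij_comp)
  qed
  \<comment> \<open>Both transpositions avoid 1 and 2, so they are twisted and their product is
    untwisted; hence it may be conjugated by \<delta>.\<close>
  have "T (n - 1) 5 \<circ> T 6 3 \<in> twist False"
    using twist_comp[OF tt[of 6 3] tt[of "n - 1" 5]] n8 by auto
  note W' = H_conj_delta[OF W this]
  have "T (n - 2) 4 \<circ> T 5 2 \<in> H"
  proof -
    have d: "bij (pinv \<delta>)" "pinv (pinv \<delta>) = \<delta>"
      using permutes_bij[OF delta] by (auto simp: bij_imp_bij_inv inv_inv_eq)
    have "pinv \<delta> (n - 1) = n - 2" "pinv \<delta> 5 = 4" "pinv \<delta> 6 = 5" "pinv \<delta> 3 = 2"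
      using n8 by (auto intro!: inv_f_eq permutes_inj[OF delta] simp: delta_val simp del: comp_apply)
    then have "pinv \<delta> \<circ> (T (n - 1) 5 \<circ> T 6 3) \<circ> \<delta> = T (n - 2) 4 \<circ> T 5 2"
      using double_transpose_conj[OF d(1), of "n - 1" 5 6 3] unfolding d(2) by (simp only:)
    then show ?thesis using W' by (simp only:)
  qed
  \<comment> \<open>Both factors contain the transposition of 2 and 5, so the product fixes
    2.\<close>
  from hc[OF this D1] have "(T (n - 2) 4 \<circ> T 5 2) \<circ> (T n 3 \<circ> T 2 5) \<in> H" .
  moreover have "(T (n - 2) 4 \<circ> T 5 2) \<circ> (T n 3 \<circ> T 2 5) = T (n - 2) 4 \<circ> T n 3"
  proof -
    have "T n 3 \<circ> T 2 5 = T 5 2 \<circ> T n 3"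
      using n8 by (auto simp: fun_eq_iff transpose_def)
    then show ?thesis by (simp add: fun_eq_iff)
  qed
  ultimately have V0: "T (n - 2) 4 \<circ> T n 3 \<in> H" by simp
  have V1: "T (n - 1) 3 \<circ> T 4 5 \<in> H"
    using kc[OF V0] n8 unfolding double_transpose_conj[OF k(3)] by (simp add: kn)
  have V2: "T n 5 \<circ> T 3 6 \<in> H"
    using kc[OF V1] n8 unfolding double_transpose_conj[OF k(3)] by (simp add: kn)
  have "(T n 5 \<circ> T 3 6) \<circ> (T (n - 1) 5 \<circ> T 6 3) = T n 5 \<circ> T 5 (n - 1)"
    using n8 by (auto simp: fun_eq_iff transpose_def)
  then have "three_cycle_in H n 5 (n - 1)"
    using hc[OF V2 W] by (simp add: three_cycle_in_def)
  from three_cycle_in_conj[OF _ this H_conj[OF V1]]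
  have "three_cycle_in H ((T (n - 1) 3 \<circ> T 4 5) n) ((T (n - 1) 3 \<circ> T 4 5) 5) ((T (n - 1) 3 \<circ> T 4 5) (n - 1))"
    by (simp add: bij_comp)
  moreover have "n - 1 \<noteq> n" "n - 1 \<noteq> 5" "n - 1 \<noteq> 4" "n \<noteq> 3" "n \<noteq> 4" "n \<noteq> 5" using n8 by auto
  ultimately have "three_cycle_in H n 4 3"
    by (simp add: transpose_def)
  then show "three_cycle_in H 3 n 4"
    using n8 three_cycle_in_rotate[of 4 3 n] three_cycle_in_rotate[of n 4 3] by auto
qed (use n8 H_conj[OF k(2)] in \<open>auto simp: k_val\<close>)

lemma H_transpositions:
  assumes "a \<in> {2..n}" "b \<in> {2..n}" "a \<noteq> b"
  shows "T a b \<in> H"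
proof -
  have a: "\<alpha> \<in> H" "\<alpha> \<in> twist False"
    using H_three_cycles_3 twist_three_cycles n8
    by (auto simp: three_cycles_in_def three_cycle_in_def alpha_eq)
  have d: "bij (pinv \<delta>)" "pinv (pinv \<delta>) = \<delta>"
    using permutes_bij[OF delta] by (auto simp: bij_imp_bij_inv inv_inv_eq)
  have "pinv \<delta> 3 = 2" "pinv \<delta> 5 = 4" "pinv \<delta> 4 = 3"
    using n8 by (auto intro!: inv_f_eq permutes_inj[OF delta] simp: delta_val simp del: comp_apply)
  \<comment> \<open>The inverse of \<delta> shifts points down by one, so the three-cycle \<alpha>
    acquires the point 2.\<close>
  then have "pinv \<delta> \<circ> \<alpha> \<circ> \<delta> = T 2 4 \<circ> T 4 3"
    using double_transpose_conj[OF d(1), of 3 5 5 4] unfolding d(2) alpha_eq by (simp only:)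
  then have "three_cycle_in H 2 4 3"
    using H_conj_delta[OF a] by (simp only: three_cycle_in_def)
  then have "three_cycle_in H 4 3 2"
    by (rule three_cycle_in_rotate[rotated]) auto
  then have "three_cycles_in H (insert 2 {3..n})"
    using n8 by (intro three_cycles_in_insert[where p = 4 and q = 3, OF H_group H_three_cycles_3]) auto
  moreover have "insert 2 {3..n} = {2..n}" using n8 by auto
  ultimately have H: "three_cycles_in H {2..n}" by simp
  have b: "cyc [3..<Suc n] \<in> H"
    using perm_groupD(4)[OF H_group a(1) k(2)] alpha_k alpha_beta(4)[OF even] by simp
  obtain x y where "x \<in> {3..n}" "y \<in> {3..n}" "x \<noteq> y" "T x y \<in> H"
    using transposition_of_even_cycle[OF H_group H_three_cycles_3 _ beta_cycle b]
      perm_groupD(4)[OF H_group] by blast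
  then show ?thesis
    using n8 by (intro transpositions_of_one[OF H _ _ _ _ _ assms, of H x y] perm_groupD(4)[OF H_group]) auto
qed

end

section \<open>Removal of the twist\<close>

context pt_relations
begin

lemma twist_transpositions:
  assumes "a \<in> {3..n}" "b \<in> {3..n}" "a \<noteq> b"
  shows "T a b \<in> twist True"
proof (cases "odd n")
  case True
  then interpret pt_relations_odd n g \<alpha> \<beta> z h by unfold_locales
  show ?thesis using twist_transpositions assms by blast
next
  case False
  then interpret pt_relations_even n g \<alpha> \<beta> z h by unfold_locales auto
  show ?thesis using twist_transpositions assms by blast
qed

lemma H_all:
  assumes "p permutes {2..n}"
  shows "p \<in> H"
  using assms finite_atLeastAtMost
proof (induction p rule: permutes_induct)
  case (swap a b p)
  have "T a b \<in> H"
  proof (cases "odd n")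
    case True
    then interpret pt_relations_odd n g \<alpha> \<beta> z h by unfold_locales
    show ?thesis using H_transpositions swap by blast
  next
    case False
    then interpret pt_relations_even n g \<alpha> \<beta> z h by unfold_locales auto
    show ?thesis using H_transpositions swap by blast
  qed
  then show ?case using swap perm_groupD(4)[OF H_group] by blast
qed (rule perm_groupD(1)[OF H_group])

text \<open>Depending on parity, \<beta> or \<alpha> is a product of transpositions whose twist is
  known, so R6 or R5 can be stated without it.\<close>

lemma z_X: "z * X = tau * z"
proof (cases "odd n")
  case True
  have "\<beta> \<in> twist True"
    using twist_transpositions[of 4 6] alpha_beta(2)[OF True] n by simp
  then have "g (pinv \<beta>) * (z * g \<beta>) = g (pinv \<beta>) * (g \<beta> * (tau * z))"
    by (simp add: twist_def)
  then show ?thesis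
    using R6 by (simp add: X_def mult.assoc g_inv_left' permutes_1 beta)
next
  case False
  have "\<alpha> \<in> twist False"
    using twist_comp[OF twist_transpositions[of 5 4] twist_transpositions[of 3 5]]
      alpha_beta(3) False n by simp
  then have "g (pinv \<alpha>) * (z * g \<alpha>) = g (pinv \<alpha>) * (g \<alpha> * z)"
    by (simp add: twist_def)
  then have "z = tau * (z * X)"
    using R5 by (simp add: X_def mult.assoc g_inv_left' permutes_1 alpha)
  then show ?thesis by (metis tau_sq(2))
qed

end

lemma ex_permutes_extending:
  assumes "finite S" "A \<subseteq> S" "inj_on f A" "f ` A \<subseteq> S"
  shows "\<exists>p. p permutes S \<and> (\<forall>x\<in>A. p x = f x)"
proof -
  have fin: "finite A" "finite (f ` A)" using assms by (auto intro: finite_subset)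
  have "card (S - A) = card (S - f ` A)"
    using assms fin by (simp add: card_Diff_subset card_image)
  then obtain k where k: "bij_betw k (S - A) (S - f ` A)"
    using assms by (metis finite_Diff finite_same_card_bij)
  define p where "p x = (if x \<in> A then f x else if x \<in> S then k x else x)" for x
  have "bij_betw p A (f ` A)"
    using assms(3) by (subst bij_betw_cong[of _ _ f]) (auto simp: p_def intro: inj_on_imp_bij_betw)
  moreover have "bij_betw p (S - A) (S - f ` A)"
    using k by (subst bij_betw_cong[of _ _ k]) (auto simp: p_def)
  ultimately have "bij_betw p (A \<union> (S - A)) (f ` A \<union> (S - f ` A))"
    by (rule bij_betw_combine) auto
  moreover have "A \<union> (S - A) = S" "f ` A \<union> (S - f ` A) = S" using assms by auto
  ultimately have "p permutes S"
    using assms(2) by (intro bij_imp_permutes) (auto simp: p_def)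
  then show ?thesis by (auto simp: p_def)
qed

lemma ex_permutes_map:
  assumes "finite S" "distinct xs" "set xs \<subseteq> S" "distinct ys" "set ys \<subseteq> S" "length xs = length ys"
  shows "\<exists>p. p permutes S \<and> map p xs = ys"
proof -
  define f where "f x = the (map_of (zip xs ys) x)" for x
  have f: "map f xs = ys"
    using assms by (intro nth_equalityI) (auto simp: f_def map_of_zip_nth)
  then have "inj_on f (set xs)" "f ` set xs = set ys"
    using assms(4) by (auto simp: distinct_map)
  then obtain p where "p permutes S" "\<forall>x\<in>set xs. p x = f x"
    using ex_permutes_extending[of S "set xs" f] assms by auto
  then show ?thesis using f by (metis map_cong)
qed

context pt_relations
begin

lemma h_comm: "p permutes {2..n} \<Longrightarrow> h * g p = g p * h"
  using H_all by (simp add: H_def)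

text \<open>As \<gamma> now commutes with h, the left-hand side of R7 is h.\<close>

lemma h_tau_z_tau: "h * (tau * (z * tau)) = h"
proof -
  have "g (pinv \<gamma>) * (h * g \<gamma>) = h"
    unfolding h_comm[OF gamma] by (rule g_inv_left'[OF permutes_1(2)[OF gamma]])
  then show ?thesis using R7 by (simp only: mult.assoc)
qed

text \<open>Conjugate the preceding equation by the transposition of 4 and 5. This fixes h and
  \<open>tau\<close>, but z acquires a factor \<open>tau\<close> on the left, which cancels the one
  before it.\<close>

lemma h_z: "h * z = h * tau"
proof -
  let ?p = "g (T 4 5)"
  have T: "T 4 5 permutes {3..n}" "T 4 5 permutes {2..n}"
    using n by (auto intro!: permutes_T)
  have pp: "?p * ?p = 1" "\<And>x. ?p * (?p * x) = x"
    using n by (auto intro!: g_T_sq g_T_sq')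
  have "z * ?p = ?p * (tau * z)"
    using twist_transpositions[of 4 5] n by (simp add: twist_def)
  then have zp: "z * (?p * x) = ?p * (tau * (z * x))" for x
    by (simp flip: mult.assoc)
  have hp: "h * (?p * x) = ?p * (h * x)" for x
    using h_comm[OF T(2)] by (simp flip: mult.assoc)
  have "?p * (h * (tau * (z * (tau * ?p)))) = h * (z * tau)"
    by (simp add: tau_comm[OF T(1)] zp tau_comm'[OF T(1)] tau_sq hp pp)
  moreover have "?p * (h * (tau * (z * (tau * ?p)))) = ?p * ((h * (tau * (z * tau))) * ?p)"
    by (simp add: mult.assoc)
  moreover have "\<dots> = h"
    by (simp add: h_tau_z_tau h_comm[OF T(2)] pp)
  ultimately have "h * (z * tau) = h" by simp
  then have "h * (z * (tau * tau)) = h * tau" by (metis mult.assoc)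
  then show ?thesis by (simp add: tau_sq)
qed

lemma z_X': "z * (X * x) = tau * (z * x)"
  using z_X by (metis mult.assoc)

lemma h_idem: "h * h = h"
proof -
  have "h * h = h * (tau * (tau * h))" by (simp add: tau_sq)
  also have "\<dots> = h * (z * (tau * h))" using h_z by (metis mult.assoc)
  also have "\<dots> = h * (z * (X * tau))" by (simp add: X_def mult.assoc tau_sq)
  also have "\<dots> = h" by (simp add: z_X' h_tau_z_tau)
  finally show ?thesis .
qed

lemma X_idem: "X * X = X"
  by (simp add: X_def mult.assoc tau_sq) (metis h_idem mult.assoc)

text \<open>Each factor \<open>X\<close> behind z produces one \<open>tau\<close> in front of it.
  Since \<open>X\<close> is idempotent, one \<open>tau\<close> does the same as two, that is, as
  none.\<close>

lemma tau_z: "tau * z = z"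
proof -
  have "z * (X * X) = tau * (tau * z)" by (simp add: z_X' z_X)
  then show ?thesis using X_idem z_X by (simp add: tau_sq)
qed

lemma tau_z': "tau * (z * x) = z * x"
  using tau_z by (simp flip: mult.assoc)

lemma X_z: "X * z = X"
  using h_z by (simp add: X_def mult.assoc tau_z)

lemma z_idem: "z * z = z"
  using z_X'[of z] by (simp add: X_z z_X tau_z tau_z')

lemma z_comm:
  assumes "p permutes {3..n}"
  shows "z * g p = g p * z"
  using assms finite_atLeastAtMost
proof (induction p rule: permutes_induct)
  case (swap a b p)
  have T: "T a b permutes {3..n}" using swap by (intro permutes_T) auto
  have "z * g (T a b) = g (T a b) * z"
    using twist_transpositions[of a b] swap by (simp add: twist_def tau_z)
  moreover have "z * (g p * x) = g p * (z * x)" for x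
    using swap.IH by (simp flip: mult.assoc)
  moreover have "g (T a b \<circ> p) = g p * g (T a b)"
    by (rule g_comp[OF permutes_1(1)[OF swap.hyps(4)] permutes_1(1)[OF T]])
  ultimately show ?case
    by (simp only: mult.assoc)
qed (simp add: g_id[unfolded id_def])

section \<open>Conjugates of \<zeta> and \<eta> and their multiplication laws\<close>

definition cj :: "(nat \<Rightarrow> nat) \<Rightarrow> 'm \<Rightarrow> 'm" where
  "cj p x = g (pinv p) * x * g p"

lemma cj_mult: "p permutes {1..n} \<Longrightarrow> cj p (x * y) = cj p x * cj p y"
  by (simp add: cj_def mult.assoc g_inv_right')

lemma cj_comp:
  assumes "p permutes {1..n}" "q permutes {1..n}"
  shows "cj (q \<circ> p) x = cj q (cj p x)"
proof -
  have "pinv (q \<circ> p) = pinv p \<circ> pinv q"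
    using permutes_bij[OF assms(1)] permutes_bij[OF assms(2)] by (rule o_inv_distrib[rotated])
  then show ?thesis
    using assms by (simp add: cj_def g_comp permutes_inv mult.assoc)
qed

lemma cj_id: "cj id x = x"
  by (simp add: cj_def g_id)

lemma cj_T:
  assumes "p permutes {1..n}" "a \<in> {1..n}" "b \<in> {1..n}"
  shows "cj p (g (T a b)) = g (T (p a) (p b))"
proof -
  have "T (p a) (p b) = p \<circ> T a b \<circ> pinv p"
    by (rule transpose_conj[OF permutes_bij[OF assms(1)], symmetric])
  then show ?thesis
    using assms permutes_T[of a 1 b]
    by (simp add: cj_def g_comp permutes_inv permutes_compose mult.assoc)
qed

lemma cj_fixed: "p permutes {1..n} \<Longrightarrow> x * g p = g p * x \<Longrightarrow> cj p x = x"
  by (simp add: cj_def mult.assoc g_inv_left')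

lemma cj_swap: "p permutes {1..n} \<Longrightarrow> x * g p = g p * cj p x"
  by (simp add: cj_def mult.assoc g_inv_right')

text \<open>The quotient of p and q fixes the points below k, so it commutes with x. With k = 3 for
  z and k = 2 for h, this makes the definitions of \<open>e\<close> and \<open>et\<close>
  independent of the permutation chosen.\<close>

lemma cj_cong:
  assumes "p permutes {1..n}" "q permutes {1..n}" "\<And>x. x \<in> {1..<k} \<Longrightarrow> p x = q x"
    and "\<And>r. r permutes {k..n} \<Longrightarrow> x * g r = g r * x"
  shows "cj p x = cj q x"
proof -
  define r where "r = pinv p \<circ> q"
  have r: "r permutes {1..n}"
    unfolding r_def by (intro permutes_compose assms permutes_inv)
  have "r permutes {k..n}"
    using r by (rule permutes_superset)
      (use assms(3) in \<open>auto simp: r_def permutes_inverses(2)[OF assms(1)] simp flip: assms(3)\<close>)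
  then have "cj r x = x" using r assms(4) by (intro cj_fixed)
  moreover have "q = p \<circ> r"
    by (simp add: r_def fun_eq_iff permutes_inverses(1)[OF assms(1)])
  ultimately show ?thesis using cj_comp[OF r assms(1), of x] by simp
qed

definition e :: "nat \<Rightarrow> nat \<Rightarrow> 'm" where
  "e i j = cj (SOME p. p permutes {1..n} \<and> p 1 = i \<and> p 2 = j) z"

definition et :: "nat \<Rightarrow> 'm" where
  "et i = cj (SOME p. p permutes {1..n} \<and> p 1 = i) h"

lemma e_eq:
  assumes "p permutes {1..n}"
  shows "e (p 1) (p 2) = cj p z"
proof -
  let ?q = "SOME q. q permutes {1..n} \<and> q 1 = p 1 \<and> q 2 = p 2"
  have q: "?q permutes {1..n} \<and> ?q 1 = p 1 \<and> ?q 2 = p 2"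
    by (rule someI[of _ p]) (use assms in auto)
  have "{1..<3} = {1, 2::nat}" by auto
  then show ?thesis
    unfolding e_def using q assms by (intro cj_cong[of _ _ 3] z_comm) auto
qed

lemma et_eq:
  assumes "p permutes {1..n}"
  shows "et (p 1) = cj p h"
proof -
  let ?q = "SOME q. q permutes {1..n} \<and> q 1 = p 1"
  have q: "?q permutes {1..n} \<and> ?q 1 = p 1"
    by (rule someI[of _ p]) (use assms in auto)
  have "{1..<2} = {1::nat}" by auto
  then show ?thesis
    unfolding et_def using q assms by (intro cj_cong[of _ _ 2] h_comm) auto
qed

lemma ex_perm4:
  assumes "distinct [a, b, c, d]" "{a, b, c, d} \<subseteq> {1..n}"
    and "distinct [i, j, k, l]" "{i, j, k, l} \<subseteq> {1..n}"
  obtains p where "p permutes {1..n}" "p a = i" "p b = j" "p c = k" "p d = l"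
  using ex_permutes_map[of "{1..n}" "[a, b, c, d]" "[i, j, k, l]"] assms by auto

lemma ex_perm3:
  assumes "distinct [i, j, k]" "{i, j, k} \<subseteq> {1..n}"
  obtains p where "p permutes {1..n}" "p 1 = i" "p 2 = j" "p 3 = k"
  using ex_permutes_map[of "{1..n}" "[1, 2, 3]" "[i, j, k]"] assms n by auto

lemma ex_perm2:
  assumes "i \<noteq> j" "{i, j} \<subseteq> {1..n}"
  obtains p where "p permutes {1..n}" "p 1 = i" "p 2 = j"
  using ex_permutes_map[of "{1..n}" "[1, 2]" "[i, j]"] assms n by auto

lemma cj_e:
  assumes "p permutes {1..n}" "i \<noteq> j" "{i, j} \<subseteq> {1..n}"
  shows "cj p (e i j) = e (p i) (p j)"
proof -
  obtain q where q: "q permutes {1..n}" "q 1 = i" "q 2 = j"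
    using ex_perm2[OF assms(2,3)] .
  show ?thesis
    using e_eq[OF q(1)] e_eq[OF permutes_compose[OF q(1) assms(1)]] cj_comp[OF q(1) assms(1), of z] q
    by simp
qed

lemma cj_et:
  assumes "p permutes {1..n}" "i \<in> {1..n}"
  shows "cj p (et i) = et (p i)"
proof -
  have q: "T 1 i permutes {1..n}"
    using assms n by (intro permutes_T) auto
  show ?thesis
    using et_eq[OF q(1)] et_eq[OF permutes_compose[OF q(1) assms(1)]] cj_comp[OF q(1) assms(1), of h] q
    by simp
qed

lemma e12: "e 1 2 = z" and et1: "et 1 = h"
  using e_eq[OF permutes_id] et_eq[OF permutes_id] by (auto simp: cj_id)

lemma et2: "et 2 = X"
  using cj_et[OF tau_permutes, of 1] n by (simp add: et1 cj_def X_def)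

lemma e_idem:
  assumes "i \<noteq> j" "{i, j} \<subseteq> {1..n}"
  shows "e i j * e i j = e i j"
proof -
  obtain p where p: "p permutes {1..n}" "p 1 = i" "p 2 = j" using ex_perm2[OF assms] .
  show ?thesis using arg_cong[OF z_idem, of "cj p"] e_eq[OF p(1)] p by (simp add: cj_mult)
qed

lemma et_idem:
  assumes "i \<in> {1..n}"
  shows "et i * et i = et i"
proof -
  have p: "T 1 i permutes {1..n}" using assms n by (intro permutes_T) auto
  show ?thesis using arg_cong[OF h_idem, of "cj (T 1 i)"] et_eq[OF p(1)] p by (simp add: cj_mult)
qed

lemma e_et_same:
  assumes "i \<noteq> j" "{i, j} \<subseteq> {1..n}"
  shows "e i j * et j = e i j" "et j * e i j = et j"
proof -
  obtain p where p: "p permutes {1..n}" "p 1 = i" "p 2 = j" using ex_perm2[OF assms] .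
  have "cj p X = et j" using cj_et[OF p(1), of 2] n p by (simp add: et2)
  then show "e i j * et j = e i j" "et j * e i j = et j"
    using arg_cong[OF z_X, of "cj p"] arg_cong[OF X_z, of "cj p"] e_eq[OF p(1)] p
    by (simp_all add: cj_mult tau_z)
qed

lemma T_e:
  assumes "i \<noteq> j" "{i, j} \<subseteq> {1..n}"
  shows "g (T i j) * e i j = e i j" "e i j * g (T i j) = e j i"
proof -
  have *: "g (T i j) * e i j = e i j" if ij: "i \<noteq> j" "{i, j} \<subseteq> {1..n}" for i j
  proof -
    obtain p where p: "p permutes {1..n}" "p 1 = i" "p 2 = j" using ex_perm2[OF ij] .
    have "cj p tau = g (T i j)" using cj_T[OF p(1), of 1 2] n p by simp
    then show ?thesis
      using arg_cong[OF tau_z, of "cj p"] e_eq[OF p(1)] p by (simp add: cj_mult)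
  qed
  show "g (T i j) * e i j = e i j" by (rule *[OF assms])
  have T: "T i j permutes {1..n}" using assms by (intro permutes_T) auto
  have "e i j * g (T i j) = g (T i j) * e j i"
    using cj_swap[OF T, of "e i j"] cj_e[OF T assms] by simp
  then show "e i j * g (T i j) = e j i"
    using *[of j i] assms by (simp add: transpose_commute)
qed

text \<open>\<open>et j\<close> can be inserted behind the first factor; it absorbs the second
  factor and is then absorbed by the first.\<close>

lemma e_e_same:
  assumes "i \<noteq> j" "k \<noteq> j" "{i, j, k} \<subseteq> {1..n}"
  shows "e i j * e k j = e i j"
proof -
  have "e i j * e k j = e i j * et j * e k j" using assms e_et_same[of i j] by simp
  also have "\<dots> = e i j * (et j * e k j)" by (simp add: mult.assoc)
  also have "\<dots> = e i j" using assms e_et_same(1)[of i j] e_et_same(2)[of k j] by simp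
  finally show ?thesis .
qed

lemma e_et_comm:
  assumes "distinct [i, j, k]" "{i, j, k} \<subseteq> {1..n}"
  shows "e i j * et k = et k * e i j"
proof -
  have T: "T 1 3 permutes {1..n}" using n by (intro permutes_T) auto
  have "et 3 = g (T 1 3) * h * g (T 1 3)"
    using cj_et[OF T, of 1] n by (simp add: et1 cj_def)
  then have *: "z * et 3 = et 3 * z" using R3 by (simp add: mult.assoc)
  obtain p where p: "p permutes {1..n}" "p 1 = i" "p 2 = j" "p 3 = k" using ex_perm3[OF assms] .
  have "cj p (et 3) = et k" using cj_et[OF p(1), of 3] n p by simp
  then show ?thesis
    using arg_cong[OF *, of "cj p"] e_eq[OF p(1)] p by (simp add: cj_mult)
qed

text \<open>The involution in R1 maps 1 to n and 2 to 3, so R1 says that \<open>e n 3\<close>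
  commutes with \<open>e 1 2\<close>. Conjugation carries this to any four distinct points.\<close>

lemma e_e_disjoint_comm:
  assumes "distinct [i, j, k, l]" "{i, j, k, l} \<subseteq> {1..n}"
  shows "e i j * e k l = e k l * e i j"
proof -
  have s: "T 1 n \<circ> T 2 3 permutes {1..n}" using n by (intro permutes_compose permutes_T) auto
  have "T 1 n \<circ> T 2 3 = T 2 3 \<circ> T 1 n" using n by (auto simp: fun_eq_iff transpose_def)
  then have "pinv (T 1 n \<circ> T 2 3) = T 1 n \<circ> T 2 3" by (simp add: o_inv_distrib)
  then have en3: "e n 3 = g (T 1 n \<circ> T 2 3) * z * g (T 1 n \<circ> T 2 3)"
    using e_eq[OF s] n by (simp add: cj_def transpose_def)
  have *: "e n 3 * z = z * e n 3"
    unfolding en3 using R1 by (simp add: mult.assoc)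
  obtain p where p: "p permutes {1..n}" "p 1 = i" "p 2 = j" "p n = k" "p 3 = l"
    by (rule ex_perm4[of 1 2 n 3 i j k l]) (use assms n in auto)
  have "cj p (e n 3) = e k l" using cj_e[OF p(1), of n 3] n p by simp
  then show ?thesis
    using arg_cong[OF *, of "cj p"] e_eq[OF p(1)] p by (simp add: cj_mult)
qed

text \<open>With a = \<open>e 1 2\<close>, t = \<open>g (T 2 3)\<close> and b = \<open>e 1 3\<close>
  = tat, R2 reads bab = abt. Its conjugate by t is aba = bat. Evaluating abab in both ways gives abt
  = bat, so a and b commute, and R2 then says that ab absorbs t.\<close>

lemma e_e_comm:
  assumes "distinct [i, j, k]" "{i, j, k} \<subseteq> {1..n}"
  shows "e i j * e i k = e i k * e i j" "e i j * e i k * g (T j k) = e i j * e i k"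
proof -
  define a b t where "a = z" and "b = e 1 3" and "t = g (T 2 3)"
  have T: "T 2 3 permutes {1..n}" using n by (intro permutes_T) auto
  have tt: "t * t = 1" "\<And>x. t * (t * x) = x"
    unfolding t_def using n by (auto intro!: g_T_sq g_T_sq')
  have b: "b = t * (a * t)"
    using cj_e[OF T, of 1 2] n by (simp add: a_def b_def t_def e12 cj_def mult.assoc)
  have tb: "t * b = a * t" by (simp add: b tt)
  have at: "a * t = t * b" by (simp add: b tt)
  have bt: "b * t = t * a" by (simp add: b tt mult.assoc)
  have bb: "a * a = a" by (simp add: a_def z_idem)
  have bab: "b * (a * b) = a * (b * t)"
    using R2 by (simp add: b a_def t_def[symmetric] mult.assoc tt)
  have aba: "a * (b * a) = b * (a * t)"
  proof -
    have t': "t * (a * x) = b * (t * x)" "t * (b * x) = a * (t * x)" for x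
      using tb bt by (simp_all flip: mult.assoc)
    have "a * (b * a) = t * (b * (a * b)) * t" by (simp add: t' tb tt mult.assoc)
    also have "\<dots> = b * (a * t)" unfolding bab by (simp add: t' tb tt mult.assoc)
    finally show ?thesis .
  qed
  have "a * (b * t) = a * (a * (b * t))" using bb by (metis mult.assoc)
  also have "\<dots> = a * (b * a) * b" by (simp only: bab[symmetric] mult.assoc)
  also have "\<dots> = b * (a * a) * t" by (simp only: aba mult.assoc tb)
  finally have "a * b * t * t = b * a * t * t" by (simp add: bb mult.assoc)
  then have 1: "a * b = b * a" by (simp add: mult.assoc tt)
  have "b * b = b" using n by (simp add: b_def e_idem)
  then have 2: "a * b * t = a * b" using bab 1 by (metis mult.assoc)
  obtain p where p: "p permutes {1..n}" "p 1 = i" "p 2 = j" "p 3 = k" using ex_perm3[OF assms] .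
  have cb: "cj p a = e i j" "cj p b = e i k" "cj p t = g (T j k)"
    using cj_e[OF p(1), of 1 3] e_eq[OF p(1)] cj_T[OF p(1), of 2 3] n p
    by (simp_all add: a_def b_def t_def)
  show "e i j * e i k = e i k * e i j" "e i j * e i k * g (T j k) = e i j * e i k"
    using arg_cong[OF 1, of "cj p"] arg_cong[OF 2, of "cj p"] by (simp_all add: cj_mult p cb)
qed

lemma z_h: "z * h = h * X" "z * h = X * h * tau"
proof -
  show 1: "z * h = X * h * tau" using R4 by (simp add: X_def)
  have "z * h = tau * (z * h)" using tau_z by (metis mult.assoc)
  then show "z * h = h * X" unfolding 1 by (simp add: X_def mult.assoc tau_sq)
qed

lemma e_et_same_first:
  assumes "i \<noteq> j" "{i, j} \<subseteq> {1..n}"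
  shows "e i j * et i = et i * et j"
proof -
  obtain p where p: "p permutes {1..n}" "p 1 = i" "p 2 = j" using ex_perm2[OF assms] .
  have "cj p X = et j" using cj_et[OF p(1), of 2] n p by (simp add: et2)
  then show ?thesis
    using arg_cong[OF z_h(1), of "cj p"] e_eq[OF p(1)] et_eq[OF p(1)] p by (simp add: cj_mult)
qed

text \<open>R4 only gives \<open>h * X = X * h * tau\<close>. That \<open>h * X\<close> absorbs
  \<open>tau\<close> is seen with the help of the point 3: \<open>et 1\<close> absorbs
  \<open>e 3 1\<close> and \<open>et 2\<close> absorbs \<open>e 3 2\<close>, so
  \<open>e 3 1 * e 3 2\<close> can be put at the end, and this absorbs the transposition of 1 and
  2.\<close>

lemma et_et_comm:
  assumes "i \<noteq> j" "{i, j} \<subseteq> {1..n}"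
  shows "et i * et j = et j * et i"
proof -
  have c: "e 3 1 * (et 2 * x) = et 2 * (e 3 1 * x)" for x
    using e_et_comm[of 3 1 2] n by (simp flip: mult.assoc)
  have "h * X = (et 1 * e 3 1) * (et 2 * e 3 2)"
    using e_et_same(2)[of 3 1] e_et_same(2)[of 3 2] n by (simp add: et1 et2)
  also have "\<dots> = et 1 * et 2 * (e 3 1 * e 3 2)" by (simp add: mult.assoc c)
  also have "\<dots> = et 1 * et 2 * (e 3 1 * e 3 2) * tau"
    using e_e_comm(2)[of 3 1 2] n by (simp add: mult.assoc)
  also have "et 1 * et 2 * (e 3 1 * e 3 2) = (et 1 * e 3 1) * (et 2 * e 3 2)"
    by (simp add: mult.assoc c)
  also have "\<dots> = h * X"
    using e_et_same(2)[of 3 1] e_et_same(2)[of 3 2] n by (simp add: et1 et2)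
  finally have "h * X = X * h * tau * tau" using z_h by metis
  then have *: "h * X = X * h" by (simp add: mult.assoc tau_sq)
  obtain p where p: "p permutes {1..n}" "p 1 = i" "p 2 = j" using ex_perm2[OF assms] .
  have "cj p X = et j" using cj_et[OF p(1), of 2] n p by (simp add: et2)
  then show ?thesis
    using arg_cong[OF *, of "cj p"] et_eq[OF p(1)] p by (simp add: cj_mult)
qed

text \<open>Write \<open>e i j\<close> as \<open>e j i\<close> times a transposition, let the two
  factors with first index j commute, and then move the transposition back to the front.\<close>

lemma e_e_chain:
  assumes "distinct [i, j, k]" "{i, j, k} \<subseteq> {1..n}"
  shows "e j k * e i j = e i j * e i k"
proof -
  have T: "T j i permutes {1..n}" using assms by (intro permutes_T) auto
  have "e j k * e i j = e j k * e j i * g (T j i)"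
    using T_e(2)[of j i] assms by (simp add: mult.assoc)
  also have "\<dots> = e j i * (e j k * g (T j i))"
    using e_e_comm(1)[of j k i] assms by (simp add: mult.assoc)
  also have "e j k * g (T j i) = g (T j i) * e i k"
    using cj_swap[OF T, of "e j k"] cj_e[OF T, of j k] assms by simp
  also have "e j i * (g (T j i) * e i k) = e i j * e i k"
    using T_e(2)[of j i] assms by (simp flip: mult.assoc)
  finally show ?thesis .
qed

end

section \<open>Normal forms\<close>

lemma prod_list_commute:
  fixes f :: "'b \<Rightarrow> 'a::monoid_mult"
  assumes "\<And>y. y \<in> set ys \<Longrightarrow> f y * x = x * k y"
  shows "prod_list (map f ys) * x = x * prod_list (map k ys)"
  using assms
proof (induction ys)
  case (Cons y ys)
  then have "prod_list (map f (y # ys)) * x = f y * (x * prod_list (map k ys))"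
    by (simp add: mult.assoc)
  also have "\<dots> = x * prod_list (map k (y # ys))"
    using Cons.prems[of y] by (simp flip: mult.assoc)
  finally show ?case .
qed simp

context pt_relations
begin

text \<open>A map \<open>eps\<close> encodes the idempotent partial transformation \<open>x \<mapsto> eps x\<close>.\<close>

definition idem :: "(nat \<Rightarrow> nat option) \<Rightarrow> bool" where
  "idem eps \<longleftrightarrow> (\<forall>x i. eps x = Some i \<longrightarrow> x \<in> {1..n} \<and> i \<in> {1..n} \<and> eps i = Some i)"

definition idem_fac :: "(nat \<Rightarrow> nat option) \<Rightarrow> nat \<Rightarrow> 'm" where
  "idem_fac eps x = (case eps x of None \<Rightarrow> et x | Some i \<Rightarrow> if i = x then 1 else e i x)"

definition E :: "(nat \<Rightarrow> nat option) \<Rightarrow> 'm" where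
  "E eps = prod_list (map (idem_fac eps) [1..<Suc n])"

lemma idemD: "idem eps \<Longrightarrow> eps x = Some i \<Longrightarrow> x \<in> {1..n} \<and> i \<in> {1..n} \<and> eps i = Some i"
  by (auto simp: idem_def)

text \<open>Idempotence excludes the pairs of factors that fail to commute: the target of one factor
  is never a point that another factor moves or deletes.\<close>

lemma idem_fac_comm:
  assumes "idem eps" "x \<in> {1..n}" "y \<in> {1..n}" "x \<noteq> y"
  shows "idem_fac eps x * idem_fac eps y = idem_fac eps y * idem_fac eps x"
proof (cases "eps x")
  case None
  note x = None
  show ?thesis
  proof (cases "eps y")
    case None
    then show ?thesis using x assms by (simp add: idem_fac_def et_et_comm)
  next
    case (Some i)
    then have "i \<in> {1..n}" "i \<noteq> x" using idemD[OF assms(1) Some] x by auto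
    then show ?thesis using x Some assms by (auto simp: idem_fac_def e_et_comm)
  qed
next
  case (Some i)
  note x = Some and i = idemD[OF assms(1) Some]
  show ?thesis
  proof (cases "eps y")
    case None
    then have "i \<noteq> y" using i by auto
    then show ?thesis using x None assms i by (auto simp: idem_fac_def e_et_comm)
  next
    case (Some k)
    note k = idemD[OF assms(1) Some]
    show ?thesis
    proof (cases "i = x \<or> k = y")
      case True
      then show ?thesis using x Some by (auto simp: idem_fac_def)
    next
      case False
      then have "i \<noteq> y" "k \<noteq> x" using x Some i k by auto
      then show ?thesis
        using x Some False assms i k
        by (cases "i = k") (auto simp: idem_fac_def e_e_comm(1) e_e_disjoint_comm)
    qed
  qed
qed

text \<open>One list \<open>ys\<close> serves all encodings \<open>w\<close> at once, so that the
  products for two encodings can be compared factor by factor.\<close>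

lemma E_split:
  assumes "idem eps" "j \<in> {1..n}"
  shows "\<exists>ys. set ys = {1..n} - {j} \<and> (\<forall>w. idem w \<longrightarrow> E w = prod_list (map (idem_fac w) ys) * idem_fac w j)"
proof -
  have "j \<in> set [1..<Suc n]" using assms(2) by auto
  then obtain xs zs where s: "[1..<Suc n] = xs @ j # zs"
    by (metis split_list)
  have "distinct (xs @ j # zs)" unfolding s[symmetric] by simp
  moreover have "set (xs @ j # zs) = {1..n}" unfolding s[symmetric] by auto
  ultimately have set: "set (xs @ zs) = {1..n} - {j}" by auto
  have "E w = prod_list (map (idem_fac w) (xs @ zs)) * idem_fac w j" if "idem w" for w
  proof -
    have c: "prod_list (map (idem_fac w) zs) * idem_fac w j = idem_fac w j * prod_list (map (idem_fac w) zs)"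
    proof (rule prod_list_commute)
      fix y assume "y \<in> set zs"
      then have "y \<in> {1..n} - {j}" unfolding set[symmetric] by simp
      then show "idem_fac w y * idem_fac w j = idem_fac w j * idem_fac w y"
        by (intro idem_fac_comm[OF that _ assms(2)]) simp_all
    qed
    have "E w = prod_list (map (idem_fac w) xs) * (idem_fac w j * prod_list (map (idem_fac w) zs))"
      by (simp only: E_def s map_append prod_list.append list.map prod_list.Cons)
    then show ?thesis by (simp only: map_append prod_list.append mult.assoc c)
  qed
  then show ?thesis using set by blast
qed

text \<open>A point that \<open>eps\<close> moves or deletes is not in the image, so treating it
  again has no effect; its own factor does the absorbing.\<close>

lemma E_absorb:
  assumes "idem eps" "j \<in> {1..n}" "eps j \<noteq> Some j" "k \<in> {1..n}" "k \<noteq> j"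
  shows "E eps * e k j = E eps" "E eps * et j = E eps"
proof -
  obtain ys where ys: "set ys = {1..n} - {j}"
    and *: "\<And>w. idem w \<Longrightarrow> E w = prod_list (map (idem_fac w) ys) * idem_fac w j"
    using E_split[OF assms(1,2)] by blast
  have 1: "E eps = prod_list (map (idem_fac eps) ys) * idem_fac eps j" using * assms(1) by blast
  have "idem_fac eps j * e k j = idem_fac eps j \<and> idem_fac eps j * et j = idem_fac eps j"
  proof (cases "eps j")
    case None
    then show ?thesis using assms by (simp add: idem_fac_def e_et_same et_idem)
  next
    case (Some i)
    then have "i \<in> {1..n}" "i \<noteq> j" using idemD[OF assms(1) Some] assms by auto
    then show ?thesis using Some assms by (simp add: idem_fac_def e_et_same e_e_same)
  qed
  then show "E eps * e k j = E eps" "E eps * et j = E eps"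
    unfolding 1 by (simp_all add: mult.assoc)
qed

text \<open>The new factor travels from the right end to the left, and each factor that it passes
  changes from its form under \<open>eps\<close> to its form under \<open>w\<close>.\<close>

lemma E_push:
  assumes "idem eps" "idem w" "eps j = Some j"
    and "\<And>y. y \<in> {1..n} \<Longrightarrow> y \<noteq> j \<Longrightarrow> idem_fac eps y * idem_fac w j = idem_fac w j * idem_fac w y"
  shows "E eps * idem_fac w j = E w"
proof -
  have j: "j \<in> {1..n}" using idemD[OF assms(1,3)] by simp
  obtain ys where ys: "set ys = {1..n} - {j}"
    and *: "\<And>w. idem w \<Longrightarrow> E w = prod_list (map (idem_fac w) ys) * idem_fac w j"
    using E_split[OF assms(1) j] by blast
  have 1: "E eps = prod_list (map (idem_fac eps) ys)" using * assms(1,3) by (force simp: idem_fac_def)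
  have "E eps * idem_fac w j = idem_fac w j * prod_list (map (idem_fac w) ys)"
    unfolding 1 by (rule prod_list_commute, rule assms(4)) (simp_all add: ys)
  also have "\<dots> = prod_list (map (idem_fac w) ys) * idem_fac w j"
    by (rule prod_list_commute[symmetric], rule idem_fac_comm[OF assms(2) _ j]) (simp_all add: ys)
  finally show ?thesis using *[of w] assms(2) by simp
qed

text \<open>The class represented by j is attached to i: by the chain law each factor
  \<open>e j y\<close> becomes \<open>e i y\<close>.\<close>

lemma E_merge:
  assumes "idem eps" "eps i = Some i" "eps j = Some j" "i \<noteq> j"
  defines "w \<equiv> \<lambda>x. if eps x = Some j then Some i else eps x"
  shows "E eps * e i j = E w" "idem w"
proof -
  have i: "i \<in> {1..n}" and j: "j \<in> {1..n}"
    using idemD[OF assms(1,2)] idemD[OF assms(1,3)] by auto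
  show w: "idem w"
    unfolding idem_def
  proof (intro allI impI)
    fix x l assume "w x = Some l"
    then show "x \<in> {1..n} \<and> l \<in> {1..n} \<and> w l = Some l"
      using idemD[OF assms(1), of x] assms(2,4) i by (auto simp: w_def split: if_splits)
  qed
  have wj: "idem_fac w j = e i j" using assms(3,4) by (simp add: idem_fac_def w_def)
  have "idem_fac eps y * e i j = e i j * idem_fac w y" if y: "y \<in> {1..n}" "y \<noteq> j" for y
  proof (cases "eps y")
    case None
    then have "y \<noteq> i" using assms by auto
    then show ?thesis using None y i j assms(4) by (simp add: idem_fac_def w_def e_et_comm)
  next
    case (Some k)
    note k = idemD[OF assms(1) Some]
    consider "k = y" | "k = j" | "k \<noteq> y" "k \<noteq> j" by blast
    then show ?thesis
    proof cases
      case 1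
      then show ?thesis using Some y by (simp add: idem_fac_def w_def)
    next
      case 2
      then have "y \<noteq> i" using Some assms by auto
      then show ?thesis using Some y i j 2 assms(4) e_e_chain[of i j y] by (simp add: idem_fac_def w_def)
    next
      case 3
      then have "y \<noteq> i" using Some assms(2) by auto
      then show ?thesis
        using Some y i j 3 assms(4) k
        by (cases "k = i") (simp_all add: idem_fac_def w_def e_e_comm(1) e_e_disjoint_comm)
    qed
  qed
  then show "E eps * e i j = E w"
    using E_push[OF assms(1) w assms(3)] by (simp add: wj)
qed

text \<open>The class represented by j is deleted: each factor \<open>e j y\<close> becomes
  \<open>et y\<close>.\<close>

lemma E_kill:
  assumes "idem eps" "eps j = Some j"
  defines "w \<equiv> \<lambda>x. if eps x = Some j then None else eps x"
  shows "E eps * et j = E w" "idem w"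
proof -
  have j: "j \<in> {1..n}"
    using idemD[OF assms(1,2)] by auto
  show w: "idem w"
    unfolding idem_def
  proof (intro allI impI)
    fix x l assume "w x = Some l"
    then show "x \<in> {1..n} \<and> l \<in> {1..n} \<and> w l = Some l"
      using idemD[OF assms(1), of x] by (auto simp: w_def split: if_splits)
  qed
  have wj: "idem_fac w j = et j" using assms(2) by (simp add: idem_fac_def w_def)
  have "idem_fac eps y * et j = et j * idem_fac w y" if y: "y \<in> {1..n}" "y \<noteq> j" for y
  proof (cases "eps y")
    case None
    then show ?thesis using None y j by (simp add: idem_fac_def w_def et_et_comm)
  next
    case (Some k)
    note k = idemD[OF assms(1) Some]
    consider "k = y" | "k = j" | "k \<noteq> y" "k \<noteq> j" by blast
    then show ?thesis
    proof cases
      case 1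
      then show ?thesis using Some y by (simp add: idem_fac_def w_def)
    next
      case 2
      then show ?thesis using Some y j by (simp add: idem_fac_def w_def e_et_same_first)
    next
      case 3
      then show ?thesis
        using Some y j k by (simp add: idem_fac_def w_def e_et_comm)
    qed
  qed
  then show "E eps * et j = E w"
    using E_push[OF assms(1) w assms(2)] by (simp add: wj)
qed

text \<open>For a and b outside the image, \<open>e a b\<close> can be inserted for nothing. It
  turns the transposition of a and b into \<open>e b a\<close>, which is absorbed again.\<close>

lemma E_fix:
  assumes "idem eps" "s permutes {1..n}" "\<And>x. eps x = Some x \<Longrightarrow> s x = x"
  shows "E eps * g s = E eps"
proof -
  have "s permutes {x \<in> {1..n}. eps x \<noteq> Some x}"
    using assms(2) by (rule permutes_superset) (use assms(3) in auto)
  moreover have "finite {x \<in> {1..n}. eps x \<noteq> Some x}" by simp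
  ultimately show ?thesis
  proof (induction s rule: permutes_induct)
    case id
    then show ?case by (simp add: g_id[unfolded id_def])
  next
    case (swap a b p)
    then have p: "p permutes {1..n}" and T: "T a b permutes {1..n}"
      by (auto elim: permutes_subset intro: permutes_T)
    have ab: "a \<in> {1..n}" "b \<in> {1..n}" "eps a \<noteq> Some a" "eps b \<noteq> Some b"
      using swap by auto
    have "g (T a b \<circ> p) = g p * g (T a b)"
      by (rule g_comp[OF p T])
    then have "E eps * g (T a b \<circ> p) = (E eps * g p) * g (T a b)"
      by (simp only: mult.assoc)
    also have "\<dots> = E eps * e a b * g (T a b)"
      using swap.IH E_absorb(1)[OF assms(1) ab(2,4,1)] swap.hyps(3) by simp
    also have "\<dots> = E eps * e b a"
      using T_e(2)[of a b] ab swap.hyps(3) by (simp add: mult.assoc)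
    also have "\<dots> = E eps"
      using E_absorb(1)[OF assms(1) ab(1,3,2)] swap.hyps(3) by simp
    finally show ?case .
  qed
qed

text \<open>An idempotent with \<open>i \<le> x\<close> picks the least element of each class, so
  the kernel of f determines \<open>eps\<close>. The permutation is determined only on the
  image.\<close>

definition nf :: "'m \<Rightarrow> (nat \<Rightarrow> nat option) \<Rightarrow> bool" where
  "nf m f \<longleftrightarrow> (\<exists>eps p. idem eps \<and> (\<forall>x i. eps x = Some i \<longrightarrow> i \<le> x) \<and> p permutes {1..n}
     \<and> m = E eps * g p \<and> f = map_option p \<circ> eps)"

lemma nf_one: "nf 1 (\<lambda>x. if x \<in> {1..n} then Some x else None)"
proof -
  let ?eps = "\<lambda>x. if x \<in> {1..n} then Some x else None"
  have "E ?eps = prod_list (map (\<lambda>_. 1) [1..<Suc n])"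
    unfolding E_def by (intro arg_cong[where f = prod_list] map_cong) (auto simp: idem_fac_def)
  also have "\<dots> = 1" by (simp add: map_replicate_const)
  finally show ?thesis
    unfolding nf_def
    by (intro exI[of _ ?eps] exI[of _ id])
      (auto simp: idem_def g_id permutes_id option.map_id split: if_splits)
qed

lemma nf_g:
  assumes "nf m f" "q permutes {1..n}"
  shows "nf (m * g q) (map_option q \<circ> f)"
proof -
  obtain eps p where *: "idem eps" "\<forall>x i. eps x = Some i \<longrightarrow> i \<le> x" "p permutes {1..n}"
    "m = E eps * g p" "f = map_option p \<circ> eps"
    using assms(1) by (auto simp: nf_def)
  have "m * g q = E eps * g (q \<circ> p)" using g_comp[OF *(3) assms(2)] * by (simp only: mult.assoc)
  moreover have "map_option q \<circ> f = map_option (q \<circ> p) \<circ> eps"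
    using * by (simp add: fun_eq_iff option.map_comp)
  ultimately show ?thesis
    unfolding nf_def using * permutes_compose[OF *(3) assms(2)] by blast
qed

lemma nf_z_aux:
  assumes "idem eps" "\<forall>x i. eps x = Some i \<longrightarrow> i \<le> x" "p permutes {1..n}"
    and "p i = 1" "p j = 2" "eps i = Some i" "eps j = Some j" "i < j"
  shows "nf (E eps * e i j * g p) (map_option (id(2 := 1)) \<circ> (map_option p \<circ> eps))"
proof -
  let ?w = "\<lambda>x. if eps x = Some j then Some i else eps x"
  have "map_option (id(2 := 1)) (map_option p (eps x)) = map_option p (?w x)" for x
  proof (cases "eps x")
    case (Some k)
    moreover have "p k = 2 \<longleftrightarrow> k = j" using permutes_inj[OF assms(3)] assms(5) by (metis injD)
    ultimately show ?thesis using assms(4) by auto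
  qed simp
  moreover have "\<forall>x k. ?w x = Some k \<longrightarrow> k \<le> x" using assms(2,8) by (auto split: if_splits) fastforce
  moreover have "idem ?w" "E eps * e i j = E ?w" using E_merge[OF assms(1,6,7)] assms(8) by auto
  ultimately show ?thesis
    unfolding nf_def using assms(3)
    by (intro exI[of _ ?w] exI[of _ p]) (auto simp: fun_eq_iff)
qed

text \<open>Moved to the left of p, the factor z becomes \<open>e i j\<close> with
  \<open>p i = 1\<close> and \<open>p j = 2\<close>. Its effect depends on which of i and j are
  representatives, and on their order, since the smaller one has to survive.\<close>

lemma nf_z:
  assumes "nf m f"
  shows "nf (m * z) (map_option (id(2 := 1)) \<circ> f)"
proof -
  obtain eps p where *: "idem eps" "\<forall>x i. eps x = Some i \<longrightarrow> i \<le> x" "p permutes {1..n}"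
    "m = E eps * g p" "f = map_option p \<circ> eps"
    using assms(1) by (auto simp: nf_def)
  define i j where "i = pinv p 1" and "j = pinv p 2"
  have pij: "p i = 1" "p j = 2"
    using permutes_inverses(1)[OF *(3)] by (auto simp: i_def j_def)
  then have ij: "i \<noteq> j" by auto
  have "i \<in> {1..n}" "j \<in> {1..n}"
    using permutes_in_image[OF permutes_inv[OF *(3)]] n by (auto simp: i_def j_def)
  note ij = this ij
  have inj: "p k = 1 \<longleftrightarrow> k = i" "p k = 2 \<longleftrightarrow> k = j" for k
    using permutes_inj[OF *(3)] pij by (metis injD)+
  have m: "m * z = E eps * e i j * g p"
    using cj_swap[OF *(3), of "e i j"] cj_e[OF *(3), of i j] ij pij *(4)
    by (simp add: mult.assoc e12)
  consider "eps j \<noteq> Some j" | "eps j = Some j" "eps i \<noteq> Some i"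
    | "eps j = Some j" "eps i = Some i" "i < j" | "eps j = Some j" "eps i = Some i" "j < i"
    using ij by linarith
  then show ?thesis
  proof cases
    case 1
    have "map_option (id(2 := 1)) (f x) = f x" for x
    proof (cases "eps x")
      case (Some k)
      then have "k \<noteq> j" using idemD[OF *(1) Some] 1 by auto
      then show ?thesis using Some * inj(2)[of k] by simp
    qed (use * in simp)
    then have "map_option (id(2 := 1)) \<circ> f = f" by auto
    moreover have "m * z = m" using E_absorb(1)[OF *(1) ij(2) 1 ij(1,3)] m *(4) by simp
    ultimately show ?thesis using assms by simp
  next
    \<comment> \<open>Only j is a representative, so nothing is merged and the value 2 is merely
      renamed to 1. Writing \<open>e i j\<close> as \<open>e j i\<close> times a transposition, with
      \<open>e j i\<close> absorbed, puts the renaming into the permutation.\<close>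
    case 2
    have T: "T i j permutes {1..n}" using ij by (intro permutes_T) auto
    have "E eps * e i j = E eps * e j i * g (T i j)"
      using T_e(2)[of j i] ij by (simp add: mult.assoc transpose_commute)
    also have "\<dots> = E eps * g (T i j)" using E_absorb(1)[OF *(1) ij(1) 2(2) ij(2)] ij(3) by simp
    finally have "m * z = E eps * g (p \<circ> T i j)"
      using m by (simp only: g_comp[OF T *(3)] mult.assoc)
    moreover have "map_option (id(2 := 1)) (f x) = map_option (p \<circ> T i j) (eps x)" for x
    proof (cases "eps x")
      case (Some k)
      then have "k \<noteq> i" using idemD[OF *(1) Some] 2 by auto
      then show ?thesis using Some * inj[of k] pij by (auto simp: transpose_def)
    qed (use * in simp)
    ultimately show ?thesis
      unfolding nf_def using * permutes_compose[OF T *(3)]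
      by (intro exI[of _ eps] exI[of _ "p \<circ> T i j"]) (auto simp: fun_eq_iff)
  next
    case 3
    then show ?thesis using nf_z_aux[OF *(1,2,3) pij] m *(5) by simp
  next
    \<comment> \<open>The smaller representative is j, so the same identity is used to exchange the
      roles of i and j.\<close>
    case 4
    have T: "T i j permutes {1..n}" using ij by (intro permutes_T) auto
    have pT: "p \<circ> T i j permutes {1..n}" by (rule permutes_compose[OF T *(3)])
    have "E eps * e i j = E eps * e j i * g (T i j)"
      using T_e(2)[of j i] ij by (simp add: mult.assoc transpose_commute)
    then have mz: "m * z = E eps * e j i * g (p \<circ> T i j)"
      using m by (simp only: g_comp[OF T *(3)] mult.assoc)
    have "map_option (id(2 := 1)) (map_option (p \<circ> T i j) (eps x)) = map_option (id(2 := 1)) (f x)" for x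
      using * inj by (cases "eps x") (auto simp: transpose_def pij)
    then have "map_option (id(2 := 1)) \<circ> (map_option (p \<circ> T i j) \<circ> eps) = map_option (id(2 := 1)) \<circ> f"
      by auto
    then show ?thesis
      using nf_z_aux[OF *(1,2) pT, of j i] 4 pij unfolding mz by simp
  qed
qed

lemma nf_h:
  assumes "nf m f"
  shows "nf (m * h) (\<lambda>x. if f x = Some 1 then None else f x)"
proof -
  obtain eps p where *: "idem eps" "\<forall>x i. eps x = Some i \<longrightarrow> i \<le> x" "p permutes {1..n}"
    "m = E eps * g p" "f = map_option p \<circ> eps"
    using assms(1) by (auto simp: nf_def)
  define j where "j = pinv p 1"
  have pj: "p j = 1" using permutes_inverses(1)[OF *(3)] by (auto simp: j_def)
  have j: "j \<in> {1..n}"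
    using permutes_in_image[OF permutes_inv[OF *(3)]] n by (auto simp: j_def)
  have inj: "p k = 1 \<longleftrightarrow> k = j" for k
    using permutes_inj[OF *(3)] pj by (metis injD)
  have m: "m * h = E eps * et j * g p"
    using cj_swap[OF *(3), of "et j"] cj_et[OF *(3), of j] j pj *(4)
    by (simp add: mult.assoc et1)
  show ?thesis
  proof (cases "eps j = Some j")
    case True
    let ?w = "\<lambda>x. if eps x = Some j then None else eps x"
    have "(if f x = Some 1 then None else f x) = map_option p (?w x)" for x
      using * inj pj by (cases "eps x") auto
    moreover have "\<forall>x k. ?w x = Some k \<longrightarrow> k \<le> x" using * by auto
    moreover have "idem ?w" "E eps * et j = E ?w" using E_kill[OF *(1) True] by auto
    ultimately show ?thesis
      unfolding nf_def using *(3) m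
      by (intro exI[of _ ?w] exI[of _ p]) (auto simp: fun_eq_iff)
  next
    case False
    obtain k where k: "k \<in> {1..n}" "k \<noteq> j"
      using n that[of 1] that[of 2] by (cases "j = 1") auto
    have "f x \<noteq> Some 1" for x
      using * inj False idemD[OF *(1), of x] by (cases "eps x") auto
    then have "(\<lambda>x. if f x = Some 1 then None else f x) = f" by auto
    moreover have "m * h = m" using E_absorb(2)[OF *(1) j False k] m *(4) by simp
    ultimately show ?thesis using assms by simp
  qed
qed

text \<open>Equal maps have equal kernels, and representatives that are least on both sides agree.
  The two permutations then agree on the image, and \<open>E_fix\<close> absorbs their
  quotient.\<close>

lemma nf_unique:
  assumes "nf m f" "nf m' f"
  shows "m = m'"
proof -
  obtain eps p where 1: "idem eps" "\<forall>x i. eps x = Some i \<longrightarrow> i \<le> x" "p permutes {1..n}"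
    "m = E eps * g p" "f = map_option p \<circ> eps"
    using assms(1) by (auto simp: nf_def)
  obtain eps' p' where 2: "idem eps'" "\<forall>x i. eps' x = Some i \<longrightarrow> i \<le> x" "p' permutes {1..n}"
    "m' = E eps' * g p'" "f = map_option p' \<circ> eps'"
    using assms(2) by (auto simp: nf_def)
  have eq: "map_option p (eps x) = map_option p' (eps' x)" for x
    using 1(5) 2(5) by (metis comp_apply)
  have aux: "b x = Some j \<and> j \<le> i"
    if asm: "idem a" "idem b" "\<forall>x i. b x = Some i \<longrightarrow> i \<le> x" "q' permutes {1..n}"
      "\<And>x. map_option q (a x) = map_option q' (b x)" "a x = Some i" "b x = Some j"
    for a b q q' x i j
  proof -
    have "a i = Some i" using idemD[OF asm(1,6)] by simp
    then obtain k where k: "b i = Some k" "q i = q' k"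
      using asm(5)[of i] by (cases "b i") auto
    have "q' j = q i" using asm(5)[of x] asm(6,7) by simp
    then have "k = j" using k permutes_inj[OF asm(4)] by (metis injD)
    then show ?thesis using k asm by auto
  qed
  have "eps x = eps' x" for x
  proof (cases "eps x")
    case None
    then show ?thesis using eq[of x] by (cases "eps' x") auto
  next
    case (Some i)
    then obtain j where j: "eps' x = Some j" using eq[of x] by (cases "eps' x") auto
    have "j \<le> i" using aux[OF 1(1) 2(1,2,3) eq Some j] by simp
    moreover have "i \<le> j" using aux[OF 2(1) 1(1,2,3) eq[symmetric] j Some] by simp
    ultimately show ?thesis using Some j by simp
  qed
  then have eps: "eps' = eps" by auto
  define s where "s = pinv p' \<circ> p"
  have s: "s permutes {1..n}" unfolding s_def by (intro permutes_compose 1 permutes_inv 2)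
  have "s x = x" if "eps x = Some x" for x
    using eq[of x] that eps by (simp add: s_def permutes_inverses(2)[OF 2(3)])
  then have "E eps * g s = E eps" by (rule E_fix[OF 1(1) s])
  moreover have "p = p' \<circ> s" by (simp add: s_def fun_eq_iff permutes_inverses(1)[OF 2(3)])
  then have "g p = g s * g p'" using g_comp[OF s 2(3)] by simp
  ultimately show ?thesis unfolding 1(4) 2(4) eps by (simp flip: mult.assoc)
qed

end

section \<open>Words and their values\<close>

lemma cong_gen_in_lists:
  assumes "Q \<subseteq> lists X \<times> lists X" "(u, v) \<in> cong_gen X Q"
  shows "u \<in> lists X \<and> v \<in> lists X"
  using assms(2) by (induction rule: cong_gen.induct) (use assms(1) in auto)

lemma cong_gen_mono:
  assumes "X \<subseteq> Y" "Q \<subseteq> Q'" "(u, v) \<in> cong_gen X Q"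
  shows "(u, v) \<in> cong_gen Y Q'"
  using assms(3)
  by (induction rule: cong_gen.induct) (use assms(1,2) in \<open>auto intro: cong_gen.intros\<close>)

lemma PT_simps [simp]:
  "carrier (PT n) = {f. dom f \<subseteq> {1..n} \<and> ran f \<subseteq> {1..n}}"
  "f \<otimes>\<^bsub>PT n\<^esub> k = k \<circ>\<^sub>m f" "\<one>\<^bsub>PT n\<^esub> = Some |` {1..n}"
  by (simp_all add: PT_def)

lemma Sym_simps [simp]:
  "carrier (Sym n) = full_map n ` {p. p permutes {1..n}}"
  "f \<otimes>\<^bsub>Sym n\<^esub> k = k \<circ>\<^sub>m f" "\<one>\<^bsub>Sym n\<^esub> = Some |` {1..n}"
  by (simp_all add: Sym_def PT_def)

lemma PT_monoid: "Group.monoid (PT n)"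
proof
  fix x y assume xy: "x \<in> carrier (PT n)" "y \<in> carrier (PT n)"
  show "x \<otimes>\<^bsub>PT n\<^esub> y \<in> carrier (PT n)"
    using xy by (fastforce simp: map_comp_def ran_def dom_def split: option.splits)
  fix z
  show "x \<otimes>\<^bsub>PT n\<^esub> y \<otimes>\<^bsub>PT n\<^esub> z = x \<otimes>\<^bsub>PT n\<^esub> (y \<otimes>\<^bsub>PT n\<^esub> z)"
    by (auto simp: map_comp_def fun_eq_iff split: option.splits)
next
  show "\<one>\<^bsub>PT n\<^esub> \<in> carrier (PT n)"
    by (auto simp: ran_def restrict_map_def split: if_splits)
  fix x assume x: "x \<in> carrier (PT n)"
  show "\<one>\<^bsub>PT n\<^esub> \<otimes>\<^bsub>PT n\<^esub> x = x"
  proof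
    fix a
    have "x a = None" if "a \<notin> {1..n}" using x that by auto
    then show "(\<one>\<^bsub>PT n\<^esub> \<otimes>\<^bsub>PT n\<^esub> x) a = x a"
      by (simp add: map_comp_def restrict_map_def)
  qed
  show "x \<otimes>\<^bsub>PT n\<^esub> \<one>\<^bsub>PT n\<^esub> = x"
    using x by (auto simp: map_comp_def fun_eq_iff restrict_map_def ran_def split: option.splits)
qed

lemma word_value_Nil [simp]: "word_value M f [] = \<one>\<^bsub>M\<^esub>"
  by (simp add: word_value_def)

lemma word_value_Cons [simp]: "word_value M f (x # w) = f x \<otimes>\<^bsub>M\<^esub> word_value M f w"
  by (simp add: word_value_def)

lemma word_value_closed:
  assumes "Group.monoid M" "f ` set w \<subseteq> carrier M"
  shows "word_value M f w \<in> carrier M"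
  using assms(2) by (induction w) (auto intro: monoid.m_closed[OF assms(1)] monoid.one_closed[OF assms(1)])

lemma word_value_append:
  assumes "Group.monoid M" "f ` set u \<subseteq> carrier M" "f ` set v \<subseteq> carrier M"
  shows "word_value M f (u @ v) = word_value M f u \<otimes>\<^bsub>M\<^esub> word_value M f v"
  using assms(2)
proof (induction u)
  case Nil
  then show ?case by (simp add: monoid.l_one[OF assms(1)] word_value_closed assms)
next
  case (Cons x u)
  then show ?case
    using word_value_closed[OF assms(1), of f u] word_value_closed[OF assms(1,3)]
    by (simp add: monoid.m_assoc[OF assms(1)])
qed

lemma word_value_cong:
  assumes "\<And>x. x \<in> set w \<Longrightarrow> f x = k x"
  shows "word_value M f w = word_value M k w"
  using assms by (induction w) auto

lemma word_value_Sym: "word_value (Sym n) f w = word_value (PT n) f w"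
  by (induction w) auto

lemma full_map_apply: "full_map n p x = (if x \<in> {1..n} then Some (p x) else None)"
  by (simp add: full_map_def restrict_map_def)

lemma permutes_range: "p permutes {1..n} \<Longrightarrow> 1 \<le> x \<Longrightarrow> x \<le> n \<Longrightarrow> 1 \<le> p x \<and> p x \<le> n"
  using permutes_in_image[of p "{1..n}" x] by simp

lemma full_map_carrier: "p permutes {1..n} \<Longrightarrow> full_map n p \<in> carrier (PT n)"
  by (auto simp: full_map_apply ran_def permutes_range split: if_splits)

lemma full_map_id: "full_map n id = \<one>\<^bsub>PT n\<^esub>"
  by (auto simp: full_map_apply restrict_map_def)

lemma full_map_comp: "p permutes {1..n} \<Longrightarrow> full_map n q \<circ>\<^sub>m full_map n p = full_map n (q \<circ> p)"
  by (auto simp: full_map_apply map_comp_def fun_eq_iff permutes_range)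

lemma full_map_inj:
  assumes "p permutes {1..n}" "q permutes {1..n}" "full_map n p = full_map n q"
  shows "p = q"
proof
  fix x
  show "p x = q x"
    using assms(1,2) fun_cong[OF assms(3), of x]
    by (cases "x \<in> {1..n}") (auto simp: full_map_apply permutes_def)
qed

lemma zeta_apply: "zeta_map n x = (if x \<in> {1..n} then Some (if x = 2 then 1 else x) else None)"
  by (simp add: zeta_map_def full_map_apply)

lemma eta_apply: "eta_map n x = (if x \<in> {2..n} then Some x else None)"
  by (simp add: eta_map_def restrict_map_def)

lemma zeta_carrier: "zeta_map n \<in> carrier (PT n)"
  by (auto simp: ran_def zeta_apply split: if_splits)

lemma eta_carrier: "eta_map n \<in> carrier (PT n)"
  by (auto simp: ran_def eta_apply split: if_splits)

text \<open>The quotient \<open>X\<^sup>*/Q\<^sup>\<sharp>\<close> acts faithfully by right translation on the predicates invariant under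
  the congruence. This embeds it into the monoid of all self-maps of a type, so that
  it can be treated by type-class algebra.\<close>

typedef 'a endo = "UNIV :: ('a \<Rightarrow> 'a) set" morphisms ap Endo by simp

instantiation endo :: (type) monoid_mult
begin
definition "1 = Endo id"
definition "f * k = Endo (ap f \<circ> ap k)"
instance
  by standard (simp_all add: one_endo_def times_endo_def Endo_inverse ap_inverse comp_assoc)
end

definition cong_invariant :: "('a list \<times> 'a list) set \<Rightarrow> ('a list \<Rightarrow> bool) \<Rightarrow> bool" where
  "cong_invariant r F \<longleftrightarrow> (\<forall>u v. (u, v) \<in> r \<longrightarrow> F u = F v)"

text \<open>Restricting to invariant predicates makes congruent words act alike. The values at words
  outside \<open>lists X\<close> stay unchanged because only words over X may be put in front of
  congruent words.\<close>

definition transl :: "'a set \<Rightarrow> ('a list \<times> 'a list) set \<Rightarrow> 'a list \<Rightarrow> ('a list \<Rightarrow> bool) endo" where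
  "transl X Q w = Endo (\<lambda>F. if cong_invariant (cong_gen X Q) F
     then (\<lambda>u. if u \<in> lists X then F (u @ w) else F u) else F)"

lemma ap_transl:
  "ap (transl X Q w) F = (if cong_invariant (cong_gen X Q) F
     then (\<lambda>u. if u \<in> lists X then F (u @ w) else F u) else F)"
  by (simp add: transl_def Endo_inverse)

lemma endo_eqI: "(\<And>F. ap f F = ap k F) \<Longrightarrow> f = k"
  by (metis ap_inverse ext)

lemma transl_Nil: "transl X Q [] = 1"
  by (rule endo_eqI) (auto simp: ap_transl one_endo_def Endo_inverse)

lemma transl_append:
  assumes "Q \<subseteq> lists X \<times> lists X" "w \<in> lists X" "w' \<in> lists X"
  shows "transl X Q (w @ w') = transl X Q w * transl X Q w'"
proof (rule endo_eqI)
  fix F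
  show "ap (transl X Q (w @ w')) F = ap (transl X Q w * transl X Q w') F"
  proof (cases "cong_invariant (cong_gen X Q) F")
    case True
    have "cong_invariant (cong_gen X Q) (ap (transl X Q w') F)"
      unfolding cong_invariant_def
    proof (intro allI impI)
      fix u v assume uv: "(u, v) \<in> cong_gen X Q"
      have "u \<in> lists X" "v \<in> lists X" using cong_gen_in_lists[OF assms(1) uv] by auto
      moreover have "(u @ w', v @ w') \<in> cong_gen X Q"
        using uv assms(3) by (auto intro: cong_gen.intros)
      ultimately show "ap (transl X Q w') F u = ap (transl X Q w') F v"
        using True by (auto simp: ap_transl cong_invariant_def)
    qed
    then show ?thesis
      using True assms(2) by (auto simp: times_endo_def Endo_inverse ap_transl)
  qed (simp add: times_endo_def Endo_inverse ap_transl)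
qed

text \<open>The class of w is itself an invariant predicate; translated and then evaluated at the
  empty word, it tells which words are congruent to w.\<close>

lemma transl_eq_iff:
  assumes "Q \<subseteq> lists X \<times> lists X" "w \<in> lists X" "w' \<in> lists X"
  shows "transl X Q w = transl X Q w' \<longleftrightarrow> (w, w') \<in> cong_gen X Q"
proof
  assume eq: "transl X Q w = transl X Q w'"
  let ?F = "\<lambda>u. (w, u) \<in> cong_gen X Q"
  have "cong_invariant (cong_gen X Q) ?F"
    by (auto simp: cong_invariant_def intro: cong_gen.intros)
  then have "?F ([] @ w) = ?F ([] @ w')"
    using arg_cong[OF eq, of "\<lambda>t. ap t ?F []"] by (simp add: ap_transl)
  then show "(w, w') \<in> cong_gen X Q" using assms by (simp add: cong_gen.refl)
next
  assume "(w, w') \<in> cong_gen X Q"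
  then have "(u @ w, u @ w') \<in> cong_gen X Q" if "u \<in> lists X" for u
    using that by (auto intro: cong_gen.intros)
  then show "transl X Q w = transl X Q w'"
    by (intro endo_eqI) (auto simp: ap_transl cong_invariant_def fun_eq_iff)
qed

section \<open>The eight relations define \<open>PT\<^sub>n\<close>\<close>

lemma cycle_of_upt_2:
  "n \<ge> 7 \<Longrightarrow> cyc [2..<Suc n] = T 2 3 \<circ> cyc [3..<Suc n]"
  by (simp add: upt_conv_Cons del: upt_Suc)

lemma alpha_permutes: "n \<ge> 7 \<Longrightarrow> alpha_perm n permutes {3..n}"
  and beta_permutes: "n \<ge> 7 \<Longrightarrow> beta_perm n permutes {3..n}"
  unfolding alpha_perm_def beta_perm_def
  by (auto intro!: permutes_subset[OF cycle_permutes] simp del: cycle_of_list.simps upt_Suc)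

lemma gamma_perm_eq: "n \<ge> 7 \<Longrightarrow> gamma_perm n = T 2 3 \<circ> alpha_perm n"
  and delta_perm_eq: "n \<ge> 7 \<Longrightarrow> delta_perm n = T 2 3 \<circ> beta_perm n"
  by (simp_all add: gamma_perm_def alpha_perm_def delta_perm_def beta_perm_def cycle_of_upt_2 del: upt_Suc)

text \<open>Evaluates one side of a relation from its factors, whatever words are chosen for the
  permutations.\<close>

primrec factor_product :: "nat \<Rightarrow> ('a \<Rightarrow> nat \<rightharpoonup> nat) \<Rightarrow> 'a factor list \<Rightarrow> nat \<rightharpoonup> nat" where
  "factor_product n f [] = Some |` {1..n}"
| "factor_product n f (x # fs) =
     factor_product n f fs \<circ>\<^sub>m (case x of Perm p \<Rightarrow> full_map n p | Letter a \<Rightarrow> f a)"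

lemma factor_product_apply:
  "factor_product n f [] x = (if x \<in> {1..n} then Some x else None)"
  "factor_product n f (Perm p # fs) x = (if x \<in> {1..n} then factor_product n f fs (p x) else None)"
  "factor_product n f (Letter a # fs) x = (case f a x of None \<Rightarrow> None | Some y \<Rightarrow> factor_product n f fs y)"
  by (simp_all add: restrict_map_def map_comp_def full_map_apply)

fun valid_factor :: "nat \<Rightarrow> 'a set \<Rightarrow> 'a factor \<Rightarrow> bool" where
  "valid_factor n L (Perm p) \<longleftrightarrow> p permutes {1..n}"
| "valid_factor n L (Letter a) \<longleftrightarrow> a \<in> L"

lemma factor_product_conj_zeta:
  assumes n: "n \<ge> 7" and f: "f \<zeta> = zeta_map n" and p: "p permutes {3..n}"
  shows "factor_product n f [Perm (pinv p), Letter \<zeta>, Perm p] = zeta_map n"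
proof
  fix x
  have p1: "p permutes {1..n}" using p by (rule permutes_subset) auto
  have p2: "p 1 = 1" "p 2 = 2" using p by (auto simp: permutes_def)
  then have "pinv p x = 2 \<longleftrightarrow> x = 2" "p (pinv p x) = x"
    using permutes_inverses[OF p1] by metis+
  moreover have "1 \<le> pinv p x \<and> pinv p x \<le> n" if "1 \<le> x" "x \<le> n"
    using permutes_range[OF permutes_inv[OF p1]] that by simp
  ultimately show "factor_product n f [Perm (pinv p), Letter \<zeta>, Perm p] x = zeta_map n x"
    using n p2 by (auto simp: factor_product_apply f zeta_apply simp del: factor_product.simps)
qed

lemma factor_product_conj_eta:
  assumes n: "n \<ge> 7" and f: "f \<eta> = eta_map n" and p: "p permutes {2..n}"
  shows "factor_product n f [Perm (pinv p), Letter \<eta>, Perm p] = eta_map n"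
proof
  fix x
  have p1: "p permutes {1..n}" using p by (rule permutes_subset) auto
  have p2: "p 1 = 1" using p by (auto simp: permutes_def)
  then have "pinv p x = 1 \<longleftrightarrow> x = 1" "p (pinv p x) = x"
    using permutes_inverses[OF p1] by metis+
  moreover have "2 \<le> pinv p x \<and> pinv p x \<le> n" if "2 \<le> x" "x \<le> n"
    using permutes_in_image[OF permutes_inv[OF p], of x] that by simp
  ultimately show "factor_product n f [Perm (pinv p), Letter \<eta>, Perm p] x = eta_map n x"
    using n p2 by (auto simp: factor_product_apply f eta_apply simp del: factor_product.simps)
qed

lemma PT_relations_sound:
  assumes n: "n \<ge> 7" and f: "f \<zeta> = zeta_map n" "f \<eta> = eta_map n"
    and lr: "(l, r) \<in> set (PT_relations n \<zeta> \<eta>)"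
  shows "factor_product n f l = factor_product n f r"
proof -
  have ab: "alpha_perm n permutes {3..n}" "beta_perm n permutes {3..n}"
    using alpha_permutes beta_permutes n by auto
  have cd: "gamma_perm n permutes {2..n}" "delta_perm n permutes {2..n}"
    unfolding gamma_perm_eq[OF n] delta_perm_eq[OF n]
    using n by (auto intro!: permutes_compose permutes_swap_id
        permutes_subset[OF ab(1)] permutes_subset[OF ab(2)])
  let ?z = "Letter \<zeta>" and ?e = "Letter \<eta>" and ?s = "Perm (cyc [1, n] \<circ> cyc [2, 3])"
    and ?t12 = "Perm (cyc [1, 2])" and ?t13 = "Perm (cyc [1, 3])" and ?t23 = "Perm (cyc [2, 3])"
  let ?F = "factor_product n f"
  note eval = factor_product_apply f zeta_apply eta_apply transpose_def
  \<comment> \<open>The permutations that are written out move only 1, 2, 3 and n. The last four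
    relations need no computation with \<alpha>, ..., \<delta>: both sides are shown to equal
    \<open>zeta_map n\<close> or \<open>eta_map n\<close>.\<close>
  have cases: "x < 1 \<or> n < x \<or> x = 1 \<or> x = 2 \<or> x = 3 \<or> x = n \<or> 4 \<le> x \<and> x < n" for x :: nat
    by auto
  have 1: "?F [?s, ?z, ?s, ?z] = ?F [?z, ?s, ?z, ?s]"
  proof
    fix x show "?F [?s, ?z, ?s, ?z] x = ?F [?z, ?s, ?z, ?s] x"
      using cases[of x] n by (elim disjE) (simp_all add: eval del: factor_product.simps)
  qed
  have 2: "?F [?t23, ?z, ?t23, ?z, ?t23, ?z, ?t23] = ?F [?z, ?t23, ?z]"
  proof
    fix x show "?F [?t23, ?z, ?t23, ?z, ?t23, ?z, ?t23] x = ?F [?z, ?t23, ?z] x"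
      using cases[of x] n by (elim disjE) (simp_all add: eval del: factor_product.simps)
  qed
  have 3: "?F [?t13, ?e, ?t13, ?z] = ?F [?z, ?t13, ?e, ?t13]"
  proof
    fix x show "?F [?t13, ?e, ?t13, ?z] x = ?F [?z, ?t13, ?e, ?t13] x"
      using cases[of x] n by (elim disjE) (simp_all add: eval del: factor_product.simps)
  qed
  have 4: "?F [?t12, ?e, ?t12, ?e, ?t12] = ?F [?z, ?e]"
  proof
    fix x show "?F [?t12, ?e, ?t12, ?e, ?t12] x = ?F [?z, ?e] x"
      using cases[of x] n by (elim disjE) (simp_all add: eval del: factor_product.simps)
  qed
  have 5: "?F [?t12, ?z, ?t12, ?e, ?t12] = zeta_map n"
  proof
    fix x show "?F [?t12, ?z, ?t12, ?e, ?t12] x = zeta_map n x"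
      using cases[of x] n by (elim disjE) (simp_all add: eval del: factor_product.simps)
  qed
  have 6: "?F [?z, ?t12, ?e, ?t12] = zeta_map n"
  proof
    fix x show "?F [?z, ?t12, ?e, ?t12] x = zeta_map n x"
      using cases[of x] n by (elim disjE) (simp_all add: eval del: factor_product.simps)
  qed
  have 7: "?F [?e, ?t12, ?z, ?t12] = eta_map n"
  proof
    fix x show "?F [?e, ?t12, ?z, ?t12] x = eta_map n x"
      using cases[of x] n by (elim disjE) (simp_all add: eval del: factor_product.simps)
  qed
  note conj = factor_product_conj_zeta[where f = f and \<zeta> = \<zeta>, OF n f(1) ab(1)]
    factor_product_conj_zeta[where f = f and \<zeta> = \<zeta>, OF n f(1) ab(2)]
    factor_product_conj_eta[where f = f and \<eta> = \<eta>, OF n f(2) cd(1)]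
    factor_product_conj_eta[where f = f and \<eta> = \<eta>, OF n f(2) cd(2)]
  show ?thesis
    using lr unfolding PT_relations_def Let_def list.set
    by (elim insertE emptyE) (simp_all only: prod.inject 1 2 3 4 5 6 7 conj)
qed

lemma PT_relations_valid:
  assumes n: "n \<ge> 7" and lr: "(l, r) \<in> set (PT_relations n \<zeta> \<eta>)"
  shows "list_all (valid_factor n {\<zeta>, \<eta>}) l" "list_all (valid_factor n {\<zeta>, \<eta>}) r"
proof -
  have ab: "alpha_perm n permutes {1..n}" "beta_perm n permutes {1..n}"
    using alpha_permutes[OF n] beta_permutes[OF n] by (auto elim: permutes_subset)
  have T: "T i j permutes {1..n}" if "i \<in> {1..n}" "j \<in> {1..n}" for i j
    using that by (rule permutes_swap_id)
  have cd: "gamma_perm n permutes {1..n}" "delta_perm n permutes {1..n}"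
    unfolding gamma_perm_eq[OF n] delta_perm_eq[OF n]
    using n by (auto intro!: permutes_compose T ab)
  have s: "T 1 n \<circ> T 2 3 permutes {1..n}" using n by (auto intro!: permutes_compose T)
  have t: "T 1 2 permutes {1..n}" "T 1 3 permutes {1..n}" "T 2 3 permutes {1..n}"
    using n by (auto intro!: T)
  show "list_all (valid_factor n {\<zeta>, \<eta>}) l" "list_all (valid_factor n {\<zeta>, \<eta>}) r"
    using lr ab cd t s permutes_inv[OF ab(1)] permutes_inv[OF ab(2)] permutes_inv[OF cd(1)]
      permutes_inv[OF cd(2)]
    by (auto simp: PT_relations_def Let_def)
qed

section \<open>The monoid defined by the presentation\<close>

locale PT_presentation =
  fixes n :: nat and A :: "'a set" and R \<pi> \<zeta> \<eta> rels
  assumes n: "n \<ge> 7" and sym: "presentation_for (Sym n) A R \<pi>"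
    and new: "\<zeta> \<notin> A" "\<eta> \<notin> A" "\<zeta> \<noteq> \<eta>"
    and rels: "list_all2 (\<lambda>(l, r) (u, v). u \<in> product_words n A \<pi> l \<and> v \<in> product_words n A \<pi> r)
              (PT_relations n \<zeta> \<eta>) rels"
begin

definition X where "X = A \<union> {\<zeta>, \<eta>}"
definition Q where "Q = R \<union> set rels"
definition \<phi> where "\<phi> = \<pi>(\<zeta> := zeta_map n, \<eta> := eta_map n)"
abbreviation val where "val \<equiv> word_value (PT n) \<phi>"
abbreviation tr where "tr \<equiv> transl X Q"

text \<open>The choice of the word is harmless, since R already identifies all words for the same
  permutation (\<open>g_word\<close>).\<close>

definition g :: "(nat \<Rightarrow> nat) \<Rightarrow> ('a list \<Rightarrow> bool) endo" where
  "g p = tr (SOME w. w \<in> lists A \<and> val w = full_map n p)"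

lemma phi_simps [simp]: "\<phi> \<zeta> = zeta_map n" "\<phi> \<eta> = eta_map n" "x \<in> A \<Longrightarrow> \<phi> x = \<pi> x"
  using new by (auto simp: \<phi>_def)

lemma lists_A_X: "w \<in> lists A \<Longrightarrow> w \<in> lists X"
  by (auto simp: X_def)

lemma letters_X [simp]: "\<zeta> \<in> X" "\<eta> \<in> X" "x \<in> A \<Longrightarrow> x \<in> X"
  by (auto simp: X_def)

lemma sym_facts:
  "finite A" "finite R" "R \<subseteq> lists A \<times> lists A" "\<pi> ` A \<subseteq> full_map n ` {p. p permutes {1..n}}"
  "word_value (Sym n) \<pi> ` lists A = full_map n ` {p. p permutes {1..n}}"
  "{(u, v). u \<in> lists A \<and> v \<in> lists A \<and> word_value (Sym n) \<pi> u = word_value (Sym n) \<pi> v} = cong_gen A R"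
  using sym by (auto simp: presentation_for_def)

lemma val_A: "w \<in> lists A \<Longrightarrow> word_value (Sym n) \<pi> w = val w"
  unfolding word_value_Sym using new by (intro word_value_cong) auto

lemma phi_X: "x \<in> X \<Longrightarrow> \<phi> x \<in> carrier (PT n)"
  using sym_facts(4) full_map_carrier zeta_carrier eta_carrier
  by (auto simp: X_def simp del: PT_simps)

lemma phi_word: "u \<in> lists X \<Longrightarrow> \<phi> ` set u \<subseteq> carrier (PT n)"
  using phi_X by (auto simp del: PT_simps)

lemma val_append: "u \<in> lists X \<Longrightarrow> v \<in> lists X \<Longrightarrow> val (u @ v) = val v \<circ>\<^sub>m val u"
  using word_value_append[OF PT_monoid phi_word phi_word] by simp

lemma val_carrier: "u \<in> lists X \<Longrightarrow> val u \<in> carrier (PT n)"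
  by (rule word_value_closed[OF PT_monoid phi_word])

lemma val_letter: "x \<in> X \<Longrightarrow> val [x] = \<phi> x"
  using monoid.r_one[OF PT_monoid phi_X, of x] by simp

lemma perm_word:
  assumes "p permutes {1..n}"
  shows "\<exists>w. w \<in> lists A \<and> val w = full_map n p"
proof -
  have "full_map n p \<in> word_value (Sym n) \<pi> ` lists A" using sym_facts(5) assms by auto
  then show ?thesis using val_A by fastforce
qed

lemma factor_words_lists:
  "valid_factor n {\<zeta>, \<eta>} f \<Longrightarrow> w \<in> factor_words n A \<pi> f \<Longrightarrow> w \<in> lists X"
  by (cases f) (auto simp: lists_A_X)

lemma product_words_val:
  assumes "list_all (valid_factor n {\<zeta>, \<eta>}) fs" "w \<in> product_words n A \<pi> fs"
  shows "w \<in> lists X \<and> val w = factor_product n \<phi> fs"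
proof -
  obtain ws where ws: "list_all2 (\<lambda>f w. w \<in> factor_words n A \<pi> f) fs ws" "w = concat ws"
    using assms(2) by (auto simp: product_words_def)
  have "concat ws \<in> lists X \<and> val (concat ws) = factor_product n \<phi> fs"
    using ws(1) assms(1)
  proof (induction fs ws rule: list_all2_induct)
    case Nil
    then show ?case by simp
  next
    case (Cons f fs w ws)
    have w: "w \<in> lists X" using Cons factor_words_lists[of f w] by auto
    have "val w = (case f of Perm p \<Rightarrow> full_map n p | Letter a \<Rightarrow> \<phi> a)"
    proof (cases f)
      case (Perm p)
      then show ?thesis using Cons.hyps(1) val_A[of w] by auto
    next
      case (Letter a)
      then have "w = [a]" "a \<in> X" using Cons by auto
      then show ?thesis using Letter val_letter[of a] by simp
    qed
    then show ?case using Cons w val_append[of w "concat ws"] by simp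
  qed
  then show ?thesis using ws(2) by simp
qed

lemma rels_nth:
  assumes "i < length (PT_relations n \<zeta> \<eta>)" "PT_relations n \<zeta> \<eta> ! i = (l, r)" "rels ! i = (u, v)"
  shows "u \<in> product_words n A \<pi> l" "v \<in> product_words n A \<pi> r"
  using list_all2_nthD[OF rels assms(1)] assms(2,3) by auto

lemma rels_length: "length rels = length (PT_relations n \<zeta> \<eta>)"
  using list_all2_lengthD[OF rels] by simp

lemma rels_pair:
  assumes "(u, v) \<in> set rels"
  obtains l r where "(l, r) \<in> set (PT_relations n \<zeta> \<eta>)"
    "u \<in> product_words n A \<pi> l" "v \<in> product_words n A \<pi> r"
proof -
  obtain i where i: "i < length rels" "rels ! i = (u, v)" using assms by (auto simp: in_set_conv_nth)
  obtain l r where lr: "PT_relations n \<zeta> \<eta> ! i = (l, r)" by fastforce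
  have "(l, r) \<in> set (PT_relations n \<zeta> \<eta>)" using i(1) lr nth_mem rels_length by metis
  then show ?thesis using that rels_nth[OF _ lr i(2)] i(1) rels_length by simp
qed

lemma rels_facts:
  assumes "(u, v) \<in> set rels"
  shows "u \<in> lists X" "v \<in> lists X" "val u = val v"
proof -
  obtain l r where lr: "(l, r) \<in> set (PT_relations n \<zeta> \<eta>)"
    "u \<in> product_words n A \<pi> l" "v \<in> product_words n A \<pi> r" using rels_pair[OF assms] .
  note valid = PT_relations_valid[OF n lr(1)]
  show "u \<in> lists X" "v \<in> lists X" "val u = val v"
    using product_words_val[OF valid(1) lr(2)] product_words_val[OF valid(2) lr(3)]
      PT_relations_sound[OF n _ _ lr(1), of \<phi>] new by auto
qed

lemma Q_lists: "Q \<subseteq> lists X \<times> lists X"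
proof
  fix w assume w: "w \<in> Q"
  obtain u v where uv: "w = (u, v)" by (cases w)
  have "u \<in> lists X \<and> v \<in> lists X"
  proof (cases "(u, v) \<in> R")
    case True
    then show ?thesis using sym_facts(3) lists_A_X by blast
  next
    case False
    then show ?thesis using w rels_facts[of u v] by (simp add: Q_def uv)
  qed
  then show "w \<in> lists X \<times> lists X" by (simp add: uv)
qed

lemma finite_Q: "finite X" "finite Q"
  using sym_facts by (auto simp: X_def Q_def)

lemma cong_A: "(u, v) \<in> cong_gen A R \<Longrightarrow> (u, v) \<in> cong_gen X Q"
  by (rule cong_gen_mono[of A _ R]) (auto simp: X_def Q_def)

lemma sound: "(u, v) \<in> cong_gen X Q \<Longrightarrow> val u = val v"
proof (induction rule: cong_gen.induct)
  case (base u v)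
  then show ?case
    unfolding Q_def
  proof
    assume uv: "(u, v) \<in> R"
    then have "(u, v) \<in> cong_gen A R" by (rule cong_gen.base)
    then have "u \<in> lists A" "v \<in> lists A" "word_value (Sym n) \<pi> u = word_value (Sym n) \<pi> v"
      using sym_facts(6) by blast+
    then show ?thesis using val_A by metis
  qed (use rels_facts in auto)
next
  case (append u v u' v')
  then show ?case
    using cong_gen_in_lists[OF Q_lists] val_append by metis
qed auto

lemma g_word: 
  assumes "p permutes {1..n}" "w \<in> lists A" "val w = full_map n p"
  shows "tr w = g p"
proof -
  let ?w = "SOME w. w \<in> lists A \<and> val w = full_map n p"
  have w: "?w \<in> lists A \<and> val ?w = full_map n p"
    by (rule someI_ex[OF perm_word[OF assms(1)]])
  then have "(w, ?w) \<in> cong_gen A R"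
    using assms val_A unfolding sym_facts(6)[symmetric] by auto
  then have "(w, ?w) \<in> cong_gen X Q" by (rule cong_A)
  then show ?thesis
    unfolding g_def using cong_gen_in_lists[OF Q_lists] transl_eq_iff[OF Q_lists] by blast
qed

definition ft :: "'a factor \<Rightarrow> ('a list \<Rightarrow> bool) endo" where
  "ft f = (case f of Perm p \<Rightarrow> g p | Letter a \<Rightarrow> tr [a])"

lemma tr_product_words:
  assumes "list_all (valid_factor n {\<zeta>, \<eta>}) fs" "w \<in> product_words n A \<pi> fs"
  shows "tr w = prod_list (map ft fs)"
proof -
  obtain ws where ws: "list_all2 (\<lambda>f w. w \<in> factor_words n A \<pi> f) fs ws" "w = concat ws"
    using assms(2) by (auto simp: product_words_def)
  have "concat ws \<in> lists X \<and> tr (concat ws) = prod_list (map ft fs)"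
    using ws(1) assms(1)
  proof (induction fs ws rule: list_all2_induct)
    case Nil
    then show ?case by (simp add: transl_Nil)
  next
    case (Cons f fs w ws)
    have w: "w \<in> lists X" using Cons factor_words_lists[of f w] by auto
    have "tr w = ft f"
    proof (cases f)
      case (Perm p)
      then show ?thesis using Cons g_word[of p w] val_A[of w] by (auto simp: ft_def)
    next
      case (Letter a)
      then show ?thesis using Cons by (auto simp: ft_def)
    qed
    then show ?case using Cons w transl_append[OF Q_lists, of w "concat ws"] by simp
  qed
  then show ?thesis using ws(2) by simp
qed

lemma relation_tr:
  assumes "(l, r) \<in> set (PT_relations n \<zeta> \<eta>)"
  shows "prod_list (map ft l) = prod_list (map ft r)"
proof -
  obtain i where i: "i < length (PT_relations n \<zeta> \<eta>)" "PT_relations n \<zeta> \<eta> ! i = (l, r)"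
    using assms by (auto simp: in_set_conv_nth)
  obtain u v where uv: "rels ! i = (u, v)" by (cases "rels ! i")
  then have *: "(u, v) \<in> set rels" "u \<in> product_words n A \<pi> l" "v \<in> product_words n A \<pi> r"
    using rels_nth[OF i uv] i(1) rels_length nth_mem[of i rels] by auto
  have "(u, v) \<in> cong_gen X Q" using *(1) by (intro cong_gen.base) (simp add: Q_def)
  then have "tr u = tr v"
    using transl_eq_iff[OF Q_lists] rels_facts[OF *(1)] by blast
  then show ?thesis
    using tr_product_words *(2,3) PT_relations_valid[OF n assms] by metis
qed

lemma g_id: "g id = 1"
  using g_word[of id "[]"] by (simp add: full_map_id transl_Nil permutes_id)

lemma g_comp:
  assumes "p permutes {1..n}" "q permutes {1..n}"
  shows "g (q \<circ> p) = g p * g q"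
proof -
  obtain u v where u: "u \<in> lists A" "val u = full_map n p" and v: "v \<in> lists A" "val v = full_map n q"
    using perm_word assms by metis
  have X: "u \<in> lists X" "v \<in> lists X" using u v lists_A_X by auto
  have "val (u @ v) = full_map n (q \<circ> p)"
    unfolding val_append[OF X] u v by (rule full_map_comp[OF assms(1)])
  then have "tr (u @ v) = g (q \<circ> p)"
    using u v by (intro g_word permutes_compose assms) auto
  then show ?thesis
    using g_word[OF assms(1) u] g_word[OF assms(2) v] transl_append[OF Q_lists X] by simp
qed

lemma pt_relations_tr: "pt_relations n g (alpha_perm n) (beta_perm n) (tr [\<zeta>]) (tr [\<eta>])"
proof (unfold_locales, goal_cases)
  case 1 show ?case by (rule n)
next
  case 2 show ?case by (rule g_id)
next
  case (3 p q) then show ?case by (rule g_comp)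
next
  case 4 show ?case by (rule alpha_permutes[OF n])
next
  case 5 show ?case by (rule beta_permutes[OF n])
next
  case 6 then show ?case by (simp add: alpha_perm_def)
next
  case 7 then show ?case by (simp add: beta_perm_def)
next
  case 8 then show ?case by (simp add: alpha_perm_def)
next
  case 9 then show ?case by (simp add: beta_perm_def)
next
  case 10 show ?case
    using relation_tr[of "fst (PT_relations n \<zeta> \<eta> ! 0)" "snd (PT_relations n \<zeta> \<eta> ! 0)"]
    by (simp add: PT_relations_def Let_def ft_def mult.assoc)
next
  case 11 show ?case
    using relation_tr[of "fst (PT_relations n \<zeta> \<eta> ! 1)" "snd (PT_relations n \<zeta> \<eta> ! 1)"]
    by (simp add: PT_relations_def Let_def ft_def mult.assoc)
next
  case 12 show ?case
    using relation_tr[of "fst (PT_relations n \<zeta> \<eta> ! 2)" "snd (PT_relations n \<zeta> \<eta> ! 2)"]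
    by (simp add: PT_relations_def Let_def ft_def mult.assoc)
next
  case 13 show ?case
    using relation_tr[of "fst (PT_relations n \<zeta> \<eta> ! 3)" "snd (PT_relations n \<zeta> \<eta> ! 3)"]
    by (simp add: PT_relations_def Let_def ft_def mult.assoc)
next
  case 14 show ?case
    using relation_tr[of "fst (PT_relations n \<zeta> \<eta> ! 4)" "snd (PT_relations n \<zeta> \<eta> ! 4)"]
    by (simp add: PT_relations_def Let_def ft_def mult.assoc)
next
  case 15 show ?case
    using relation_tr[of "fst (PT_relations n \<zeta> \<eta> ! 5)" "snd (PT_relations n \<zeta> \<eta> ! 5)"]
    by (simp add: PT_relations_def Let_def ft_def mult.assoc)
next
  case 16 show ?case
    using relation_tr[of "fst (PT_relations n \<zeta> \<eta> ! 6)" "snd (PT_relations n \<zeta> \<eta> ! 6)"]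
    unfolding gamma_perm_eq[OF n, symmetric]
    by (simp add: PT_relations_def Let_def ft_def mult.assoc)
next
  case 17 show ?case
    using relation_tr[of "fst (PT_relations n \<zeta> \<eta> ! 7)" "snd (PT_relations n \<zeta> \<eta> ! 7)"]
    unfolding delta_perm_eq[OF n, symmetric]
    by (simp add: PT_relations_def Let_def ft_def mult.assoc)
qed

interpretation pt: pt_relations n g "alpha_perm n" "beta_perm n" "tr [\<zeta>]" "tr [\<eta>]"
  by (rule pt_relations_tr)

text \<open>The induction runs from the right end of the word because normal forms are stable under
  right multiplication by generators.\<close>

lemma nf_val:
  assumes "w \<in> lists X"
  shows "pt.nf (tr w) (val w)"
  using assms
proof (induction w rule: rev_induct)
  case Nil
  show ?case using pt.nf_one by (simp add: transl_Nil restrict_map_def)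
next
  case (snoc x w)
  then have w: "w \<in> lists X" and x: "x \<in> X" by auto
  have tr: "tr (w @ [x]) = tr w * tr [x]"
    using w x by (intro transl_append[OF Q_lists]) auto
  note v1 = val_letter[OF x]
  have val: "val (w @ [x]) = \<phi> x \<circ>\<^sub>m val w"
    using val_append[of w "[x]"] w x v1 by simp
  have IH: "pt.nf (tr w) (val w)" using snoc w by simp
  have ran: "1 \<le> a \<and> a \<le> n" if "val w y = Some a" for y a
    using val_carrier[OF w] that by (auto simp: ran_def)
  consider "x \<in> A" | "x = \<zeta>" | "x = \<eta>" using x by (auto simp: X_def)
  then show ?case
  proof cases
    case 1
    then obtain p where p: "p permutes {1..n}" "\<phi> x = full_map n p"
      using sym_facts(4) by auto
    have "tr [x] = g p" using 1 p v1 by (intro g_word) auto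
    moreover have "full_map n p \<circ>\<^sub>m val w = map_option p \<circ> val w"
      by (auto simp: fun_eq_iff map_comp_def full_map_apply split: option.splits dest: ran)
    ultimately show ?thesis using pt.nf_g[OF IH p(1)] unfolding tr val p(2) by (simp only:)
  next
    case 2
    then have "\<phi> x \<circ>\<^sub>m val w = map_option (id(2 := 1)) \<circ> val w"
      by (auto simp: fun_eq_iff map_comp_def zeta_apply split: option.splits dest: ran)
    then show ?thesis unfolding tr val using pt.nf_z[OF IH] by (simp only: 2)
  next
    case 3
    have "\<phi> x \<circ>\<^sub>m val w = (\<lambda>y. if val w y = Some 1 then None else val w y)"
    proof
      fix y
      show "(\<phi> x \<circ>\<^sub>m val w) y = (if val w y = Some 1 then None else val w y)"
        using ran[of y] by (cases "val w y") (auto simp: map_comp_def eta_apply 3)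
    qed
    then show ?thesis unfolding tr val using pt.nf_h[OF IH] by (simp only: 3)
  qed
qed

lemma complete:
  assumes "u \<in> lists X" "v \<in> lists X" "val u = val v"
  shows "(u, v) \<in> cong_gen X Q"
  using pt.nf_unique[OF nf_val[OF assms(1)]] nf_val[OF assms(2)] assms transl_eq_iff[OF Q_lists]
  by metis

lemma val_mult: "f \<in> val ` lists X \<Longrightarrow> k \<in> val ` lists X \<Longrightarrow> k \<circ>\<^sub>m f \<in> val ` lists X"
  by (elim imageE) (auto simp: val_append[symmetric] simp del: in_lists_conv_set)

lemma val_perm: "p permutes {1..n} \<Longrightarrow> full_map n p \<in> val ` lists X"
  using perm_word[of p] lists_A_X by (metis image_eqI)

lemma val_zeta: "zeta_map n \<in> val ` lists X" and val_eta: "eta_map n \<in> val ` lists X"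
  by (rule image_eqI[of _ _ "[\<zeta>]"], simp_all add: val_letter del: word_value_Cons)
    (rule image_eqI[of _ _ "[\<eta>]"], simp_all add: val_letter del: word_value_Cons)

text \<open>Induction on the corank. A map that is not a permutation misses some y; it is a
  conjugate of \<open>eta_map n\<close> or \<open>zeta_map n\<close> followed by a map that takes y
  as an additional value at a point now avoided.\<close>

lemma surj:
  assumes "dom f \<subseteq> {1..n}" "ran f \<subseteq> {1..n}"
  shows "f \<in> val ` lists X"
  using assms
proof (induction "n - card (ran f)" arbitrary: f rule: less_induct)
  case less
  have fin: "finite (ran f)" using less.prems(2) by (rule finite_subset) simp
  have step: "k \<in> val ` lists X"
    if "y \<in> {1..n}" "y \<notin> ran f" "dom k \<subseteq> {1..n}" "ran k = insert y (ran f)" for k y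
  proof (rule less.hyps)
    have "ran k \<subseteq> {1..n}" using that less.prems by simp
    then have "card (ran k) \<le> n" using card_mono[of "{1..n}" "ran k"] by simp
    moreover have "card (ran k) = Suc (card (ran f))" using that fin by simp
    ultimately show "n - card (ran k) < n - card (ran f)" by simp
  qed (use that less.prems in auto)
  have ex: "\<exists>y. y \<in> {1..n} \<and> y \<notin> ran f" if "card (ran f) < n"
    using that card_mono[OF fin, of "{1..n}"] by fastforce
  have ran_dom: "ran f = (\<lambda>x. the (f x)) ` dom f" by (force simp: ran_def dom_def)
  consider (undef) i where "i \<in> {1..n}" "f i = None"
    | (noninj) i j where "dom f = {1..n}" "i \<in> {1..n}" "j \<in> {1..n}" "i \<noteq> j" "f i = f j"
    | (perm) "dom f = {1..n}" "inj_on f {1..n}"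
  proof -
    have "{1..n} \<subseteq> dom f" if "\<not> (\<exists>i\<in>{1..n}. f i = None)" using that by auto
    then have "dom f = {1..n} \<or> (\<exists>i\<in>{1..n}. f i = None)" using less.prems(1) by blast
    then show ?thesis using that unfolding inj_on_def by blast
  qed
  then show ?case
  proof cases
    case undef
    have "card (ran f) \<le> card (dom f)"
      unfolding ran_dom by (rule card_image_le[OF finite_subset[OF less.prems(1)]]) simp
    also have "\<dots> < card {1..n}"
    proof (rule psubset_card_mono)
      have "i \<notin> dom f" using undef by auto
      then show "dom f \<subset> {1..n}" using undef(1) less.prems(1) by blast
    qed simp
    finally obtain y where y: "y \<in> {1..n}" "y \<notin> ran f" using ex by auto
    have "f(i \<mapsto> y) \<in> val ` lists X"
      using y undef less.prems by (intro step[of y]) auto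
    moreover have T: "full_map n (T 1 i) \<in> val ` lists X"
      using undef n by (intro val_perm permutes_swap_id) auto
    ultimately have "f(i \<mapsto> y) \<circ>\<^sub>m (full_map n (T 1 i) \<circ>\<^sub>m (eta_map n \<circ>\<^sub>m full_map n (T 1 i))) \<in> val ` lists X"
      by (intro val_mult val_eta)
    moreover have "f(i \<mapsto> y) \<circ>\<^sub>m (full_map n (T 1 i) \<circ>\<^sub>m (eta_map n \<circ>\<^sub>m full_map n (T 1 i))) = f"
    proof
      fix x
      have "f x = None" if "x \<notin> {1..n}" using less.prems(1) that by auto
      then show "(f(i \<mapsto> y) \<circ>\<^sub>m (full_map n (T 1 i) \<circ>\<^sub>m (eta_map n \<circ>\<^sub>m full_map n (T 1 i)))) x = f x"
        using undef n by (auto simp: map_comp_def full_map_apply eta_apply transpose_def)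
    qed
    ultimately show ?thesis by simp
  next
    case noninj
    have "ran f \<subseteq> (\<lambda>x. the (f x)) ` ({1..n} - {j})"
    proof
      fix v assume "v \<in> ran f"
      then obtain x where x: "x \<in> {1..n}" "v = the (f x)" unfolding ran_dom noninj(1) by blast
      show "v \<in> (\<lambda>x. the (f x)) ` ({1..n} - {j})"
      proof (cases "x = j")
        case True
        then show ?thesis using x noninj by (intro image_eqI[of _ _ i]) simp_all
      qed (use x in blast)
    qed
    then have "card (ran f) \<le> card ({1..n} - {j})" by (rule surj_card_le[rotated]) simp
    also have "\<dots> < n" using noninj(3) n by simp
    finally obtain y where y: "y \<in> {1..n}" "y \<notin> ran f" using ex by auto
    have "ran (f(j \<mapsto> y)) = insert y (ran f)"
    proof (intro equalityI subsetI)
      fix v assume "v \<in> insert y (ran f)"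
      then consider "v = y" | a where "f a = Some v" by (auto simp: ran_def)
      then show "v \<in> ran (f(j \<mapsto> y))"
      proof cases
        case 1
        then show ?thesis by (auto simp: ran_def)
      next
        case 2
        then have "(f(j \<mapsto> y)) (if a = j then i else a) = Some v" using noninj(4,5) by auto
        then show ?thesis by (rule ranI)
      qed
    qed (auto simp: ran_def split: if_splits)
    then have "f(j \<mapsto> y) \<in> val ` lists X"
      using y noninj less.prems by (intro step[of y]) auto
    moreover obtain p where p: "p permutes {1..n}" "p 1 = i" "p 2 = j"
      using pt.ex_perm2[of i j] noninj by auto
    moreover have p': "full_map n p \<in> val ` lists X" "full_map n (pinv p) \<in> val ` lists X"
      using p by (auto intro: val_perm permutes_inv)
    ultimately have "f(j \<mapsto> y) \<circ>\<^sub>m (full_map n p \<circ>\<^sub>m (zeta_map n \<circ>\<^sub>m full_map n (pinv p))) \<in> val ` lists X"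
      by (intro val_mult val_zeta)
    moreover have "f(j \<mapsto> y) \<circ>\<^sub>m (full_map n p \<circ>\<^sub>m (zeta_map n \<circ>\<^sub>m full_map n (pinv p))) = f"
    proof
      fix x
      have 1: "f x = None" if "x \<notin> {1..n}" using less.prems(1) that by auto
      have 2: "pinv p x = 2 \<longleftrightarrow> x = j" "p (pinv p x) = x"
        using permutes_inverses[OF p(1)] p(3) by metis+
      have "1 \<le> pinv p x \<and> pinv p x \<le> n" if "x \<in> {1..n}"
        using that permutes_range[OF permutes_inv[OF p(1)]] by simp
      then show "(f(j \<mapsto> y) \<circ>\<^sub>m (full_map n p \<circ>\<^sub>m (zeta_map n \<circ>\<^sub>m full_map n (pinv p)))) x = f x"
        using noninj n 1 2 p(2) by (auto simp: map_comp_def full_map_apply zeta_apply)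
    qed
    ultimately show ?thesis by simp
  next
    case perm
    define p where "p x = (if x \<in> {1..n} then the (f x) else x)" for x
    have f: "f x = Some (p x)" if "x \<in> {1..n}" for x
    proof -
      have "x \<in> dom f" using that perm(1) by simp
      then obtain y where "f x = Some y" by blast
      then show ?thesis using that by (simp add: p_def)
    qed
    have "p x \<in> {1..n}" if "x \<in> {1..n}" for x
    proof -
      have "p x \<in> ran f" using f[OF that] by (rule ranI)
      then show ?thesis using less.prems(2) by auto
    qed
    then have "p ` {1..n} \<subseteq> {1..n}" by blast
    moreover have "inj_on p {1..n}"
    proof (rule inj_onI)
      fix x y assume "x \<in> {1..n}" "y \<in> {1..n}" "p x = p y"
      then show "x = y" using f[of x] f[of y] inj_onD[OF perm(2), of x y] by simp
    qed
    ultimately have "bij_betw p {1..n} {1..n}"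
      by (simp add: bij_betw_def endo_inj_surj)
    then have "p permutes {1..n}"
      by (rule bij_imp_permutes) (auto simp: p_def)
    moreover have "f = full_map n p"
      using f perm(1) by (auto simp: fun_eq_iff full_map_apply)
    ultimately show ?thesis using val_perm by simp
  qed
qed

theorem presentation: "presentation_for (PT n) X Q \<phi>"
  unfolding presentation_for_def
proof (intro conjI)
  show "word_value (PT n) \<phi> ` lists X = carrier (PT n)"
  proof
    show "val ` lists X \<subseteq> carrier (PT n)" using val_carrier by blast
    show "carrier (PT n) \<subseteq> val ` lists X" using surj by (intro subsetI) simp
  qed
  show "{(u, v). u \<in> lists X \<and> v \<in> lists X \<and> val u = val v} = cong_gen X Q"
  proof (intro equalityI subrelI)
    fix u v assume "(u, v) \<in> {(u, v). u \<in> lists X \<and> v \<in> lists X \<and> val u = val v}"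
    then have "u \<in> lists X \<and> v \<in> lists X \<and> val u = val v" by (simp only: mem_Collect_eq case_prod_conv)
    then show "(u, v) \<in> cong_gen X Q" using complete by blast
  next
    fix u v assume "(u, v) \<in> cong_gen X Q"
    then have "u \<in> lists X \<and> v \<in> lists X \<and> val u = val v"
      using sound cong_gen_in_lists[OF Q_lists] by blast
    then show "(u, v) \<in> {(u, v). u \<in> lists X \<and> v \<in> lists X \<and> val u = val v}"
      by (simp only: mem_Collect_eq case_prod_conv)
  qed
qed (use finite_Q Q_lists phi_X in blast)+

end

section \<open>Necessity of eight relations\<close>

text \<open>Powers on both sides replace integer exponents. Each equation makes its transposition
  commute with q, which forces q to swap its two points. Then the first equation evaluated at c says
  that i and j have the same parity, and evaluated at a that they do not. The point d may coincide
  with a or b.\<close>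

lemma two_transpositions_not_cyclic:
  fixes q :: "'a \<Rightarrow> 'a"
  assumes q: "inj q" and d: "a \<noteq> b" "c \<noteq> d" "c \<noteq> a" "c \<noteq> b"
    and 1: "(q ^^ i) \<circ> T a b = q ^^ j" and 2: "(q ^^ k) \<circ> T c d = q ^^ l"
  shows False
proof -
  have swap: "q a = b \<and> q b = a" if "a \<noteq> b" "(q ^^ i) \<circ> T a b = q ^^ j" for a b :: 'a and i j
  proof -
    have inj: "inj (q ^^ i)" using q by (rule inj_fn)
    have "(q ^^ i) (T a b (q x)) = (q ^^ i) (q (T a b x))" for x
    proof -
      have "(q ^^ i) (T a b (q x)) = (q ^^ j) (q x)" using that(2) by (metis comp_apply)
      also have "\<dots> = q ((q ^^ j) x)" by (rule funpow_swap1[symmetric])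
      also have "\<dots> = q ((q ^^ i) (T a b x))" using that(2) by (metis comp_apply)
      finally show ?thesis by (simp add: funpow_swap1)
    qed
    then have comm: "T a b (q x) = q (T a b x)" for x using inj by (metis injD)
    have "q a \<noteq> a"
    proof
      assume a: "q a = a"
      then have b: "q b = b" using comm[of a] by simp
      have fixed: "(q ^^ m) a = a" "(q ^^ m) b = b" for m using a b by (induction m) auto
      show False using fun_cong[OF that(2), of a] that(1) by (simp add: fixed)
    qed
    moreover have "q b \<noteq> q a" using q that(1) by (metis injD)
    ultimately show ?thesis using comm[of a] comm[of b] that(1)
      by (auto simp: transpose_def split: if_splits)
  qed
  have pow: "(q ^^ m) x = (if even m then x else y)" if "q x = y" "q y = x" for x y m
    using that by (induction m) auto
  have ab: "q a = b" "q b = a" and cd: "q c = d" "q d = c" using swap d 1 2 by blast+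
  have "(q ^^ i) c = (q ^^ j) c" using fun_cong[OF 1, of c] d by simp
  then have "even i = even j" unfolding pow[OF cd] using d(2) by (auto split: if_splits)
  moreover have "(q ^^ i) b = (q ^^ j) a" using fun_cong[OF 1, of a] by simp
  ultimately show False unfolding pow[OF ab] pow[OF ab(2,1)] using d(1) by (auto split: if_splits)
qed

text \<open>Undefined points are made equivalent to the extra point \<open>0\<close>.\<close>

definition kern :: "nat \<Rightarrow> (nat \<rightharpoonup> nat) \<Rightarrow> (nat \<times> nat) set" where
  "kern n f = {(x, y). x \<in> {0..n} \<and> y \<in> {0..n} \<and> f x = f y}"

text \<open>The first entry is the sum of the squares of the class sizes, the second is one more
  than the number of undefined points. This pair is unchanged by relabelling points and tells the
  six types in question apart.\<close>

definition kern_type :: "(nat \<times> nat) set \<Rightarrow> nat \<times> nat" where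
  "kern_type K = (card K, card {x. (x, 0) \<in> K})"

text \<open>For elements of PT_n this is the rank plus one, since \<open>None\<close> always occurs
  as the value at 0.\<close>

definition num_classes :: "nat \<Rightarrow> (nat \<rightharpoonup> nat) \<Rightarrow> nat" where
  "num_classes n f = card (f ` {0..n})"

text \<open>Inclusion of the kernels means that k factors through f on these points.\<close>

lemma kern_subset_classes:
  assumes "kern n f \<subseteq> kern n k"
  shows "num_classes n k \<le> num_classes n f" "num_classes n k = num_classes n f \<Longrightarrow> kern n f = kern n k"
proof -
  define \<psi> where "\<psi> v = k (SOME x. x \<in> {0..n} \<and> f x = v)" for v
  have \<psi>: "\<psi> (f x) = k x" if "x \<in> {0..n}" for x
  proof -
    let ?y = "SOME y. y \<in> {0..n} \<and> f y = f x"
    have "?y \<in> {0..n} \<and> f ?y = f x" by (rule someI[of _ x]) (use that in simp)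
    then have "(?y, x) \<in> kern n f" using that by (simp add: kern_def)
    then show ?thesis using assms by (auto simp: \<psi>_def kern_def)
  qed
  then have im: "k ` {0..n} = \<psi> ` f ` {0..n}" by (auto simp: image_image)
  show "num_classes n k \<le> num_classes n f" unfolding num_classes_def im by (rule card_image_le) simp
  assume "num_classes n k = num_classes n f"
  then have "inj_on \<psi> (f ` {0..n})" unfolding num_classes_def im by (intro eq_card_imp_inj_on) auto
  then have "f x = f y" if "x \<in> {0..n}" "y \<in> {0..n}" "k x = k y" for x y
    using inj_onD[of \<psi> "f ` {0..n}" "f x" "f y"] that \<psi> by simp
  then show "kern n f = kern n k" using assms by (auto simp: kern_def)
qed

definition unit_map :: "nat \<Rightarrow> (nat \<rightharpoonup> nat) \<Rightarrow> bool" where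
  "unit_map n f \<longleftrightarrow> f \<in> full_map n ` {p. p permutes {1..n}}"

lemma carrier_zero: "f \<in> carrier (PT n) \<Longrightarrow> f 0 = None"
  by fastforce

text \<open>With n + 1 classes, f is injective even together with the value \<open>None\<close> at
  0, hence total and a permutation.\<close>

lemma not_unit_classes:
  assumes "f \<in> carrier (PT n)" "\<not> unit_map n f"
  shows "num_classes n f \<le> n"
proof (rule ccontr)
  assume "\<not> num_classes n f \<le> n"
  moreover have "num_classes n f \<le> card {0..n}" unfolding num_classes_def by (rule card_image_le) simp
  ultimately have "card (f ` {0..n}) = card {0..n}" by (simp add: num_classes_def)
  then have inj: "inj_on f {0..n}" by (intro eq_card_imp_inj_on) auto
  have def: "f x \<noteq> None" if "x \<in> {1..n}" for x
    using inj_onD[OF inj, of x 0] carrier_zero[OF assms(1)] that by auto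
  define p where "p x = (if x \<in> {1..n} then the (f x) else x)" for x
  have f: "f x = Some (p x)" if "x \<in> {1..n}" for x
    using that def[OF that] by (auto simp: p_def)
  have "p x \<in> {1..n}" if "x \<in> {1..n}" for x
  proof -
    have "p x \<in> ran f" using f[OF that] by (rule ranI)
    then show ?thesis using assms(1) by auto
  qed
  then have "p ` {1..n} \<subseteq> {1..n}" by blast
  moreover have "inj_on p {1..n}"
  proof (rule inj_onI)
    fix x y assume "x \<in> {1..n}" "y \<in> {1..n}" "p x = p y"
    then show "x = y" using f inj_onD[OF inj, of x y] by auto
  qed
  ultimately have "bij_betw p {1..n} {1..n}"
    by (simp add: bij_betw_def endo_inj_surj)
  then have "p permutes {1..n}"
    by (rule bij_imp_permutes) (auto simp: p_def)
  moreover have "f = full_map n p"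
  proof
    fix x
    have "f x = None" if "x \<notin> {1..n}" using assms(1) that by auto
    then show "f x = full_map n p x" using f by (auto simp: full_map_apply)
  qed
  ultimately show False using assms(2) by (auto simp: unit_map_def)
qed

lemma kern_comp: "kern n f \<subseteq> kern n (k \<circ>\<^sub>m f)"
  by (auto simp: kern_def map_comp_def)

lemma full_map_comp_apply:
  assumes "p permutes {1..n}" "f 0 = None" "x \<in> {0..n}"
  shows "(f \<circ>\<^sub>m full_map n p) x = f (p x)" "p x \<in> {0..n}"
proof -
  have "p 0 = 0" using assms(1) by (auto simp: permutes_def)
  then show "(f \<circ>\<^sub>m full_map n p) x = f (p x)"
    using assms by (cases "x = 0") (auto simp: map_comp_def full_map_apply)
  show "p x \<in> {0..n}"
    using \<open>p 0 = 0\<close> permutes_range[OF assms(1), of x] assms(3) by (cases "x = 0") auto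
qed

lemma permutes_image_zero:
  fixes n :: nat
  assumes "p permutes {1..n}"
  shows "p ` {0..n} = {0..n}"
proof -
  have "p permutes {0..n}" by (rule permutes_subset[OF assms]) auto
  then show ?thesis by (rule permutes_image)
qed

lemma kern_full_map:
  assumes p: "p permutes {1..n}" and f: "f 0 = None"
  shows "kern n (f \<circ>\<^sub>m full_map n p) = {(x, y). (p x, p y) \<in> kern n f}"
proof -
  have "x \<in> {0..n}" if "p x \<in> {0..n}" for x
  proof -
    have "p permutes {0..n}" by (rule permutes_subset[OF p]) auto
    then show ?thesis using that permutes_in_image by metis
  qed
  note in_range = this
  have "((x, y) \<in> kern n (f \<circ>\<^sub>m full_map n p)) = ((p x, p y) \<in> kern n f)" for x y
  proof (cases "x \<in> {0..n} \<and> y \<in> {0..n}")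
    case True
    then show ?thesis
      using full_map_comp_apply[where f = f, OF p f, of x] full_map_comp_apply[where f = f, OF p f, of y]
      by (simp add: kern_def)
  next
    case False
    then show ?thesis using in_range by (auto simp: kern_def)
  qed
  then show ?thesis by auto
qed

lemma kern_type_full_map:
  assumes p: "p permutes {1..n}" and f: "f 0 = None"
  shows "kern_type (kern n (f \<circ>\<^sub>m full_map n p)) = kern_type (kern n f)"
proof -
  have bij: "bij p" by (rule permutes_bij[OF p])
  have 0: "p 0 = 0" using p by (auto simp: permutes_def)
  have "bij_betw (map_prod p p) {(x, y). (p x, p y) \<in> kern n f} (kern n f)"
    by (rule bij_betw_byWitness[where f' = "map_prod (pinv p) (pinv p)"])
      (auto simp: permutes_inverses[OF p])
  moreover have "bij_betw p {x. (p x, p 0) \<in> kern n f} {x. (x, 0) \<in> kern n f}"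
    by (rule bij_betw_byWitness[where f' = "pinv p"])
      (auto simp: permutes_inverses[OF p] 0)
  ultimately show ?thesis
    unfolding kern_type_def kern_full_map[where f = f, OF p f]
    using bij_betw_same_card[of "map_prod p p"] bij_betw_same_card[of p] by (simp add: 0)
qed

lemma classes_full_map:
  assumes p: "p permutes {1..n}" and f: "f 0 = None"
  shows "num_classes n (f \<circ>\<^sub>m full_map n p) = num_classes n f"
proof -
  have "(f \<circ>\<^sub>m full_map n p) ` {0..n} = (\<lambda>x. f (p x)) ` {0..n}"
    using full_map_comp_apply[where f = f, OF p f] by (intro image_cong) auto
  also have "\<dots> = f ` p ` {0..n}" by (simp add: image_image)
  finally show ?thesis unfolding permutes_image_zero[OF p] num_classes_def by simp
qed

section \<open>The leading part of a word and its invariance\<close>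

locale PT_over_Sym =
  fixes n :: nat and A B :: "'b set" and R S \<phi>
  assumes n: "n \<ge> 4" and disj: "A \<inter> B = {}"
    and PT: "presentation_for (PT n) (A \<union> B) (R \<union> S) \<phi>"
    and Sym: "presentation_for (Sym n) A R \<phi>"
begin

definition X where "X = A \<union> B"

abbreviation val where "val \<equiv> word_value (PT n) \<phi>"

lemma finite_S: "finite S"
  using PT by (auto simp: presentation_for_def)

lemma phi_X: "x \<in> X \<Longrightarrow> \<phi> x \<in> carrier (PT n)"
  using PT unfolding presentation_for_def X_def by blast

lemma phi_word: "u \<in> lists X \<Longrightarrow> \<phi> ` set u \<subseteq> carrier (PT n)"
  using phi_X by (auto simp del: PT_simps)

lemma val_append: "u \<in> lists X \<Longrightarrow> v \<in> lists X \<Longrightarrow> val (u @ v) = val v \<circ>\<^sub>m val u"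
  using word_value_append[OF PT_monoid phi_word phi_word] by simp

lemma val_carrier: "u \<in> lists X \<Longrightarrow> val u \<in> carrier (PT n)"
  by (rule word_value_closed[OF PT_monoid phi_word])

lemma ex_word: "f \<in> carrier (PT n) \<Longrightarrow> \<exists>w. w \<in> lists X \<and> val w = f"
proof -
  assume f: "f \<in> carrier (PT n)"
  have "val ` lists X = carrier (PT n)"
    using PT unfolding presentation_for_def X_def by (elim conjE)
  then have "f \<in> val ` lists X" using f by (simp only:)
  then show ?thesis by (elim imageE) metis
qed

lemma cong_iff: "(u, v) \<in> cong_gen X (R \<union> S) \<longleftrightarrow> u \<in> lists X \<and> v \<in> lists X \<and> val u = val v"
proof -
  have "{(u, v). u \<in> lists X \<and> v \<in> lists X \<and> val u = val v} = cong_gen X (R \<union> S)"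
    using PT unfolding presentation_for_def X_def by (elim conjE)
  from arg_cong[OF this, of "\<lambda>r. (u, v) \<in> r"] show ?thesis by (simp del: in_lists_conv_set)
qed

lemma rels_cong:
  assumes "(u, v) \<in> R \<union> S"
  shows "u \<in> lists X \<and> v \<in> lists X \<and> val u = val v"
  using cong_gen.base[OF assms, of X] unfolding cong_iff .

lemma phi_A: "x \<in> A \<Longrightarrow> unit_map n (\<phi> x)"
  using Sym unfolding presentation_for_def unit_map_def Sym_simps by blast

lemma R_A: "R \<subseteq> lists A \<times> lists A"
  using Sym unfolding presentation_for_def by blast

definition perm_of :: "(nat \<rightharpoonup> nat) \<Rightarrow> nat \<Rightarrow> nat" where
  "perm_of f = (SOME p. p permutes {1..n} \<and> f = full_map n p)"

lemma perm_of:
  assumes "unit_map n f"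
  shows "perm_of f permutes {1..n} \<and> f = full_map n (perm_of f)"
proof -
  have "\<exists>p. p permutes {1..n} \<and> f = full_map n p" using assms by (auto simp: unit_map_def)
  then show ?thesis unfolding perm_of_def by (rule someI_ex)
qed

lemma perm_of_full_map: "p permutes {1..n} \<Longrightarrow> perm_of (full_map n p) = p"
  using perm_of[of "full_map n p"] by (intro full_map_inj[of _ n]) (auto simp: unit_map_def)

text \<open>Describes the shortest nonunit prefix by the permutation that its unit letters produce
  and by its last letter. The first letter of the word acts first and so stands rightmost in the
  composition.\<close>

primrec lead :: "'b list \<Rightarrow> ((nat \<Rightarrow> nat) \<times> 'b) option" where
  "lead [] = None"
| "lead (x # w) = (if unit_map n (\<phi> x) then map_option (\<lambda>(p, y). (p \<circ> perm_of (\<phi> x), y)) (lead w)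
     else Some (id, x))"

lemma unit_full_map: "p permutes {1..n} \<Longrightarrow> unit_map n (full_map n p)"
  by (auto simp: unit_map_def)

text \<open>The letters behind the prefix act later and can only enlarge the kernel.\<close>

lemma val_lead_aux:
  assumes "w \<in> lists X"
  shows "(lead w = None \<longrightarrow> unit_map n (val w)) \<and> (\<forall>p y. lead w = Some (p, y) \<longrightarrow>
    p permutes {1..n} \<and> y \<in> X \<and> \<not> unit_map n (\<phi> y) \<and>
    kern n (\<phi> y \<circ>\<^sub>m full_map n p) \<subseteq> kern n (val w))"
  using assms
proof (induction w)
  case Nil
  show ?case using unit_full_map[OF permutes_id] full_map_id by simp
next
  case (Cons x w)
  then have w: "w \<in> lists X" and xX: "x \<in> X" by auto
  note IH = Cons.IH
  show ?case
  proof (cases "unit_map n (\<phi> x)")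
    case True
    note x = perm_of[OF True]
    have v: "val (x # w) = val w \<circ>\<^sub>m full_map n (perm_of (\<phi> x))" using x by simp
    have 1: "unit_map n (val (x # w))" if "lead w = None"
    proof -
      have u: "unit_map n (val w)" using IH that by blast
      note p = perm_of[OF u]
      have "val (x # w) = full_map n (perm_of (val w) \<circ> perm_of (\<phi> x))"
        using v p x full_map_comp[of "perm_of (\<phi> x)" n "perm_of (val w)"] by metis
      then show ?thesis
        using unit_full_map[OF permutes_compose, of "perm_of (\<phi> x)" "perm_of (val w)"] x p by metis
    qed
    have 2: "(p \<circ> perm_of (\<phi> x)) permutes {1..n} \<and> y \<in> X \<and> \<not> unit_map n (\<phi> y) \<and>
        kern n (\<phi> y \<circ>\<^sub>m full_map n (p \<circ> perm_of (\<phi> x))) \<subseteq> kern n (val (x # w))"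
      if "lead w = Some (p, y)" for p y
    proof -
      have p: "p permutes {1..n}" "y \<in> X" "\<not> unit_map n (\<phi> y)"
        "kern n (\<phi> y \<circ>\<^sub>m full_map n p) \<subseteq> kern n (val w)" using IH that by blast+
      have e1: "\<phi> y \<circ>\<^sub>m full_map n (p \<circ> perm_of (\<phi> x)) =
          (\<phi> y \<circ>\<^sub>m full_map n p) \<circ>\<^sub>m full_map n (perm_of (\<phi> x))"
        using x by (auto simp: map_comp_def fun_eq_iff full_map_apply permutes_range split: option.splits)
      have e2: "(\<phi> y \<circ>\<^sub>m full_map n p) 0 = None" by (simp add: map_comp_def full_map_apply)
      have 1: "kern n (\<phi> y \<circ>\<^sub>m full_map n (p \<circ> perm_of (\<phi> x))) =
          {(a, b). (perm_of (\<phi> x) a, perm_of (\<phi> x) b) \<in> kern n (\<phi> y \<circ>\<^sub>m full_map n p)}"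
        unfolding e1 by (rule kern_full_map, rule conjunct1[OF x], rule e2)
      have e3: "val w 0 = None" by (rule carrier_zero[OF val_carrier[OF w]])
      have "kern n (val (x # w)) = {(a, b). (perm_of (\<phi> x) a, perm_of (\<phi> x) b) \<in> kern n (val w)}"
        unfolding v by (rule kern_full_map, rule conjunct1[OF x], rule e3)
      then show ?thesis using 1 p x by (auto intro: permutes_compose)
    qed
    show ?thesis using True 1 2 by auto
  next
    case False
    moreover have "\<phi> x \<circ>\<^sub>m full_map n id = \<phi> x"
      using monoid.l_one[OF PT_monoid phi_X[OF xX]] by (simp add: full_map_id)
    moreover have "lead (x # w) = Some (id, x)" using False by simp
    moreover have "kern n (\<phi> x) \<subseteq> kern n (val (x # w))" using kern_comp[of n "\<phi> x" "val w"] by simp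
    ultimately show ?thesis using xX permutes_id[of "{1..n}"] unfolding id_def by auto
  qed
qed

lemmas val_lead = conjunct1[OF val_lead_aux, rule_format] conjunct2[OF val_lead_aux, rule_format]

lemma kern_unit:
  assumes "unit_map n f" "(x, y) \<in> kern n f"
  shows "x = y"
proof -
  obtain p where p: "p permutes {1..n}" "f = full_map n p" using assms(1) by (auto simp: unit_map_def)
  then show ?thesis
    using assms(2) permutes_inj[OF p(1)]
    by (cases "x = 0"; cases "y = 0") (auto simp: kern_def full_map_apply inj_eq)
qed

lemma classes_unit: "unit_map n f \<Longrightarrow> num_classes n f = Suc n"
proof -
  assume f: "unit_map n f"
  have "inj_on f {0..n}" using kern_unit[OF f] by (auto simp: inj_on_def kern_def)
  then show ?thesis by (simp add: num_classes_def card_image)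
qed

text \<open>A nonunit prefix has a nontrivial kernel, which would persist in the value of the whole
  word.\<close>

lemma unit_lead:
  assumes "w \<in> lists X" "unit_map n (val w)"
  shows "lead w = None"
proof (rule ccontr)
  assume "lead w \<noteq> None"
  then obtain p y where l: "lead w = Some (p, y)" by auto
  note * = val_lead(2)[OF assms(1) l]
  have "num_classes n (val w) \<le> num_classes n (\<phi> y \<circ>\<^sub>m full_map n p)"
    using * kern_subset_classes(1) by blast
  also have "\<dots> = num_classes n (\<phi> y)"
    using * carrier_zero[OF phi_X] by (intro classes_full_map) auto
  also have "\<dots> \<le> n" using * not_unit_classes phi_X by blast
  finally show False using classes_unit[OF assms(2)] by simp
qed

lemma lead_append:
  assumes "u \<in> lists X"
  shows "lead (u @ v) = (case lead u of Some r \<Rightarrow> Some r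
    | None \<Rightarrow> map_option (\<lambda>(p, y). (p \<circ> perm_of (val u), y)) (lead v))"
  using assms
proof (induction u)
  case Nil
  have "perm_of (full_map n id) = id" by (rule perm_of_full_map[OF permutes_id])
  then show ?case by (simp add: full_map_id option.map_id)
next
  case (Cons x u)
  show ?case
  proof (cases "unit_map n (\<phi> x) \<and> lead u = None")
    case True
    then have x: "unit_map n (\<phi> x)" "unit_map n (val u)" "u \<in> lists X"
      using val_lead(1)[of u] Cons by auto
    have "val (x # u) = full_map n (perm_of (val u) \<circ> perm_of (\<phi> x))"
      using perm_of[OF x(1)] perm_of[OF x(2)] full_map_comp[of "perm_of (\<phi> x)" n "perm_of (val u)"]
      by simp
    then have "perm_of (val (x # u)) = perm_of (val u) \<circ> perm_of (\<phi> x)"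
      using perm_of[OF x(1)] perm_of[OF x(2)] by (simp add: perm_of_full_map permutes_compose)
    then show ?thesis
      using True Cons x(3) by (cases "lead v") (auto simp: comp_def split: prod.splits)
  next
    case False
    then show ?thesis using Cons by (auto split: option.splits)
  qed
qed

text \<open>The scheme behind all lower bounds. Relations in R have only unit letters and so no
  leading part. Goodness passes from a product to its first factor and, if this is a unit, to the
  second, so in the induction over the congruence only the good relations of S have to be
  checked.\<close>

lemma lead_invariant:
  assumes good: "\<And>f k. f \<in> carrier (PT n) \<Longrightarrow> k \<in> carrier (PT n) \<Longrightarrow> good (k \<circ>\<^sub>m f) \<Longrightarrow> good f"
    "\<And>p f. p permutes {1..n} \<Longrightarrow> f \<in> carrier (PT n) \<Longrightarrow> good (f \<circ>\<^sub>m full_map n p) \<Longrightarrow> good f"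
    and E: "\<And>r. E r r" "\<And>r s. E r s \<Longrightarrow> E s r" "\<And>r s t. E r s \<Longrightarrow> E s t \<Longrightarrow> E r t"
      "\<And>p y p' y' q. E (p, y) (p', y') \<Longrightarrow> q permutes {1..n} \<Longrightarrow> E (p \<circ> q, y) (p' \<circ> q, y')"
    and S_base: "\<And>u v r s. (u, v) \<in> S \<Longrightarrow> u \<in> lists X \<Longrightarrow> v \<in> lists X \<Longrightarrow> val u = val v \<Longrightarrow>
      good (val u) \<Longrightarrow> lead u = Some r \<Longrightarrow> lead v = Some s \<Longrightarrow> E r s"
    and uv: "(u, v) \<in> cong_gen X (R \<union> S)" "good (val u)" "lead u = Some r" "lead v = Some s"
  shows "E r s"
  using uv
proof (induction arbitrary: r s rule: cong_gen.induct)
  case (base u v)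
  then have c: "u \<in> lists X \<and> v \<in> lists X \<and> val u = val v"
    using rels_cong[of u v] by (simp del: in_lists_conv_set)
  show ?case
  proof (cases "(u, v) \<in> R")
    case True
    then have "u \<in> lists A" using R_A by auto
    then have "lead u = None" by (induction u) (auto simp: phi_A)
    then show ?thesis using base by simp
  next
    case False
    then have "(u, v) \<in> S" using base.hyps by simp
    then show ?thesis using c base.prems by (intro S_base) simp_all
  qed
next
  case (refl w)
  then show ?case using E(1) by simp
next
  case (sym u v)
  then show ?case using cong_iff E(2) by metis
next
  case (trans u v w)
  have c: "v \<in> lists X" "val u = val v" "w \<in> lists X" "u \<in> lists X" using trans cong_iff by blast+
  have "lead v \<noteq> None"
  proof
    assume "lead v = None"
    then have "unit_map n (val u)" using val_lead(1)[OF c(1)] c(2) by simp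
    then show False using unit_lead[OF c(4)] trans.prems(2) by simp
  qed
  then obtain t where t: "lead v = Some t" by blast
  have "E r t" by (rule trans.IH(1)[OF trans.prems(1,2) t])
  moreover have "E t s" using trans.IH(2)[OF _ t trans.prems(3)] trans.prems(1) c(2) by simp
  ultimately show ?case by (rule E(3))
next
  case (append u v u' v')
  have c: "u \<in> lists X" "v \<in> lists X" "val u = val v" "u' \<in> lists X" "v' \<in> lists X" "val u' = val v'"
    using append cong_iff by blast+
  have val: "val (u @ u') = val u' \<circ>\<^sub>m val u" using c val_append by simp
  show ?case
  proof (cases "unit_map n (val u)")
    case True
    then have l: "lead u = None" "lead v = None" using unit_lead c by auto
    obtain p y where p: "lead u' = Some (p, y)" "r = (p \<circ> perm_of (val u), y)"
      using append.prems l lead_append[OF c(1)] by auto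
    obtain p' y' where p': "lead v' = Some (p', y')" "s = (p' \<circ> perm_of (val v), y')"
      using append.prems l lead_append[OF c(2)] by auto
    note q = perm_of[OF True]
    have "good (val u')"
      using good(2)[of "perm_of (val u)" "val u'"] q val append.prems(1) val_carrier[OF c(4)] by simp
    then have "E (p, y) (p', y')" using append p p' by blast
    then show ?thesis using E(4) q p p' c(3) by simp
  next
    case False
    then have l: "lead u \<noteq> None" "lead v \<noteq> None" using val_lead(1) c by metis+
    then obtain r' s' where rs: "lead u = Some r'" "lead v = Some s'" by auto
    have "good (val u)" using good(1) val append.prems(1) val_carrier c by metis
    then have "E r' s'" using append rs by blast
    then show ?thesis using append.prems rs lead_append c by simp
  qed
qed

text \<open>Up to relabelling points, h factors through f. Such f are the values that prefixes of
  words for h can take, and this is the notion of goodness used below.\<close>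

definition below :: "(nat \<rightharpoonup> nat) \<Rightarrow> (nat \<rightharpoonup> nat) \<Rightarrow> bool" where
  "below h f \<longleftrightarrow> (\<exists>p. p permutes {1..n} \<and> kern n f \<subseteq> kern n (h \<circ>\<^sub>m full_map n p))"

lemma below_self:
  assumes "h \<in> carrier (PT n)"
  shows "below h h"
proof -
  have "h \<circ>\<^sub>m full_map n id = h"
    using monoid.l_one[OF PT_monoid assms] by (simp add: full_map_id[symmetric] del: PT_simps(3))
  then show ?thesis unfolding below_def by (intro exI[of _ id]) (simp add: permutes_id)
qed

lemma below_comp: "below h (k \<circ>\<^sub>m f) \<Longrightarrow> below h f"
  unfolding below_def using kern_comp[of n f k] by blast

lemma below_perm:
  assumes h: "h \<in> carrier (PT n)" and p: "p permutes {1..n}" and f: "f \<in> carrier (PT n)"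
    and b: "below h (f \<circ>\<^sub>m full_map n p)"
  shows "below h f"
proof -
  obtain q where q: "q permutes {1..n}" "kern n (f \<circ>\<^sub>m full_map n p) \<subseteq> kern n (h \<circ>\<^sub>m full_map n q)"
    using b by (auto simp: below_def)
  have p': "pinv p permutes {1..n}" by (rule permutes_inv[OF p])
  have h0: "h 0 = None" and f0: "f 0 = None" using carrier_zero h f by auto
  have "(x, y) \<in> kern n (h \<circ>\<^sub>m full_map n (q \<circ> pinv p))" if "(x, y) \<in> kern n f" for x y
  proof -
    have "(pinv p x, pinv p y) \<in> kern n (f \<circ>\<^sub>m full_map n p)"
      using that by (simp add: kern_full_map[where f = f, OF p f0] permutes_inverses[OF p])
    then show ?thesis
      using q by (auto simp: kern_full_map[where f = h, OF _ h0] permutes_compose[OF p'])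
  qed
  then show ?thesis
    unfolding below_def using permutes_compose[OF p' q(1)] by auto
qed

lemma below_type:
  assumes "h \<in> carrier (PT n)" "below h f" "num_classes n f = num_classes n h"
  shows "kern_type (kern n f) = kern_type (kern n h)"
proof -
  obtain p where p: "p permutes {1..n}" "kern n f \<subseteq> kern n (h \<circ>\<^sub>m full_map n p)"
    using assms(2) by (auto simp: below_def)
  have h0: "h 0 = None" using carrier_zero assms(1) by auto
  have "kern n f = kern n (h \<circ>\<^sub>m full_map n p)"
    using kern_subset_classes(2)[OF p(2)] classes_full_map[where f = h, OF p(1) h0] assms(3) by simp
  then show ?thesis using kern_type_full_map[where f = h, OF p(1) h0] by simp
qed

lemma below_classes:
  assumes "h \<in> carrier (PT n)" "below h f"
  shows "num_classes n h \<le> num_classes n f"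
proof -
  obtain p where p: "p permutes {1..n}" "kern n f \<subseteq> kern n (h \<circ>\<^sub>m full_map n p)"
    using assms(2) by (auto simp: below_def)
  have h0: "h 0 = None" using carrier_zero assms(1) by auto
  then show ?thesis
    using kern_subset_classes(1)[OF p(2)] classes_full_map[where f = h, OF p(1) h0] by simp
qed

text \<open>A nonunit letter has at most n classes, so for a value with n classes the rest of the
  word cannot enlarge the kernel of the prefix.\<close>

lemma lead_kern:
  assumes w: "w \<in> lists X" "lead w = Some (p, y)" "num_classes n (val w) = n"
  shows "kern n (\<phi> y \<circ>\<^sub>m full_map n p) = kern n (val w)"
proof (rule kern_subset_classes(2))
  note * = val_lead(2)[OF w(1,2)]
  show sub: "kern n (\<phi> y \<circ>\<^sub>m full_map n p) \<subseteq> kern n (val w)" using * by simp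
  have "num_classes n (\<phi> y \<circ>\<^sub>m full_map n p) = num_classes n (\<phi> y)"
    using * carrier_zero[OF phi_X] by (intro classes_full_map) auto
  also have "\<dots> \<le> n" using * not_unit_classes phi_X by blast
  finally show "num_classes n (val w) = num_classes n (\<phi> y \<circ>\<^sub>m full_map n p)"
    using kern_subset_classes(1)[OF sub] w(3) by simp
qed

definition rels_of_type :: "nat \<times> nat \<Rightarrow> ('b list \<times> 'b list) set" where
  "rels_of_type t = {(u, v) \<in> S. kern_type (kern n (val u)) = t}"

lemma lead_of_classes:
  assumes "w \<in> lists X" "num_classes n (val w) \<le> n"
  obtains p y where "lead w = Some (p, y)" "p permutes {1..n}"
proof -
  have "lead w \<noteq> None"
  proof
    assume "lead w = None"
    then show False using classes_unit[OF val_lead(1)[OF assms(1)]] assms(2) by simp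
  qed
  then obtain p y where l: "lead w = Some (p, y)" by auto
  show ?thesis by (rule that[OF l]) (use val_lead(2)[OF assms(1) l] in blast)
qed

text \<open>The two orders of multiplying words for e and k give congruent words, led by the kernels
  of e and of k. A relation that is good for h and not of its type has n classes, and then both of
  its sides lead with the kernel of their common value.\<close>

lemma rels_of_type_product:
  assumes e: "e \<in> carrier (PT n)" "num_classes n e = n" and k: "k \<in> carrier (PT n)" "num_classes n k = n"
    and ek: "k \<circ>\<^sub>m e = e \<circ>\<^sub>m k" "num_classes n (k \<circ>\<^sub>m e) = n - 1" "kern n e \<noteq> kern n k"
  shows "rels_of_type (kern_type (kern n (k \<circ>\<^sub>m e))) \<noteq> {}"
proof
  assume none: "rels_of_type (kern_type (kern n (k \<circ>\<^sub>m e))) = {}"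
  let ?h = "k \<circ>\<^sub>m e"
  define E where "E r s \<longleftrightarrow> kern n (\<phi> (snd r) \<circ>\<^sub>m full_map n (fst r)) = kern n (\<phi> (snd s) \<circ>\<^sub>m full_map n (fst s))"
    for r s :: "(nat \<Rightarrow> nat) \<times> 'b"
  have h: "?h \<in> carrier (PT n)" using monoid.m_closed[OF PT_monoid e(1) k(1)] by simp
  obtain u where u: "u \<in> lists X" "val u = e" using ex_word e by blast
  obtain v where v: "v \<in> lists X" "val v = k" using ex_word k by blast
  obtain p y where pu: "lead u = Some (p, y)" using lead_of_classes[OF u(1)] u(2) e(2) by (metis order_refl)
  obtain q y' where qv: "lead v = Some (q, y')" using lead_of_classes[OF v(1)] v(2) k(2) by (metis order_refl)
  have uv: "(u @ v, v @ u) \<in> cong_gen X (R \<union> S)"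
    using u v ek(1) by (simp add: cong_iff val_append)
  have "E (p, y) (q, y')"
  proof (rule lead_invariant[of "below ?h" E, OF _ _ _ _ _ _ _ uv])
    show "below ?h (val (u @ v))" using below_self[OF h] u v by (simp add: val_append)
    show "lead (u @ v) = Some (p, y)" "lead (v @ u) = Some (q, y')"
      using pu qv by (simp_all add: lead_append u v)
  next
    fix w w' r s
    assume w: "(w, w') \<in> S" "w \<in> lists X" "w' \<in> lists X" "val w = val w'" "below ?h (val w)"
      "lead w = Some r" "lead w' = Some s"
    have "kern_type (kern n (val w)) \<noteq> kern_type (kern n ?h)" using none w(1) by (auto simp: rels_of_type_def)
    then have "num_classes n (val w) \<noteq> n - 1" using below_type[OF h w(5)] ek(2) by auto
    moreover have "n - 1 \<le> num_classes n (val w)" using below_classes[OF h w(5)] ek(2) by simp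
    moreover have "num_classes n (val w) \<le> n"
      using not_unit_classes[OF val_carrier[OF w(2)]] unit_lead[OF w(2)] w(6) by auto
    ultimately have "num_classes n (val w) = n" by simp
    then show "E r s"
      using lead_kern[OF w(2), of "fst r" "snd r"] lead_kern[OF w(3), of "fst s" "snd s"] w
      by (simp add: E_def)
  next
    fix p y p' y' q assume E: "E (p, y) (p', y')" and q: "q permutes {1..n}"
    have *: "kern n (\<phi> y \<circ>\<^sub>m full_map n (p \<circ> q)) =
      {(a, b). (q a, q b) \<in> kern n (\<phi> y \<circ>\<^sub>m full_map n p)}" for p y
    proof -
      have "\<phi> y \<circ>\<^sub>m full_map n (p \<circ> q) = (\<phi> y \<circ>\<^sub>m full_map n p) \<circ>\<^sub>m full_map n q"
        using q by (auto simp: map_comp_def fun_eq_iff full_map_apply permutes_range split: option.splits)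
      moreover have "(\<phi> y \<circ>\<^sub>m full_map n p) 0 = None" by (simp add: map_comp_def full_map_apply)
      ultimately show ?thesis using kern_full_map[OF q] by simp
    qed
    show "E (p \<circ> q, y) (p' \<circ> q, y')" using E by (simp add: E_def *)
  qed (use below_comp below_perm[OF h] in \<open>auto simp: E_def simp del: PT_simps\<close>)
  then have "kern n (\<phi> y \<circ>\<^sub>m full_map n p) = kern n (\<phi> y' \<circ>\<^sub>m full_map n q)" by (simp add: E_def)
  then show False
    using lead_kern[OF u(1) pu] lead_kern[OF v(1) qv] u v e k ek(3) by simp
qed

text \<open>A transposition before e can be traded for s or t after e. So two congruent words have
  unit prefixes that differ by this transposition, and up to conjugation by p it would be a power of
  the single permutation q.\<close>

lemma rels_of_type_idempotent:
  assumes e: "e \<in> carrier (PT n)" "num_classes n e = n"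
    and abc: "a \<noteq> b" "c \<noteq> d" "c \<noteq> a" "c \<noteq> b" "{a, b, c, d} \<subseteq> {1..n}"
    and fix1: "s permutes {1..n}" "full_map n s \<circ>\<^sub>m e = e \<circ>\<^sub>m full_map n (T a b)"
    and fix2: "t permutes {1..n}" "full_map n t \<circ>\<^sub>m e = e \<circ>\<^sub>m full_map n (T c d)"
  shows "card (rels_of_type (kern_type (kern n e))) \<ge> 2"
proof (rule ccontr)
  let ?S = "rels_of_type (kern_type (kern n e))"
  assume "\<not> 2 \<le> card ?S"
  moreover have "finite ?S" using finite_S by (rule rev_finite_subset) (auto simp: rels_of_type_def)
  moreover have "card ?S \<le> Suc 0" using calculation(1) by simp
  ultimately have single: "\<And>x y. x \<in> ?S \<Longrightarrow> y \<in> ?S \<Longrightarrow> x = y"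
    using card_le_Suc0_iff_eq[of ?S] by blast
  \<comment> \<open>The quotient of the unit prefixes on the two sides of the only relation of this
    type, or the identity if there is none.\<close>
  define q where "q = (if ?S = {} then id else let (u, v) = (SOME x. x \<in> ?S) in
    fst (the (lead v)) \<circ> pinv (fst (the (lead u))))"
  \<comment> \<open>Agreement of the unit prefixes up to powers of \<open>q\<close>; exponents on
    both sides avoid inverses, and the leading letters are disregarded.\<close>
  define E where "E r s \<longleftrightarrow> (\<exists>i j. (q ^^ i) \<circ> fst r = (q ^^ j) \<circ> fst s)"
    for r s :: "(nat \<Rightarrow> nat) \<times> 'b"
  have S_lists: "u \<in> lists X \<and> v \<in> lists X \<and> val u = val v" if "(u, v) \<in> S" for u v
    using that rels_cong[of u v] by (simp del: in_lists_conv_set)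
  have q_rel: "q = fst (the (lead v)) \<circ> pinv (fst (the (lead u)))" if "(u, v) \<in> ?S" for u v
  proof -
    have "(SOME x. x \<in> ?S) = (u, v)" using someI[of "\<lambda>x. x \<in> ?S", OF that] single that by blast
    then show ?thesis using that by (auto simp: q_def)
  qed
  obtain w where w: "w \<in> lists X" "val w = e" using ex_word e by blast
  obtain p y where pw: "lead w = Some (p, y)" "p permutes {1..n}"
    using lead_of_classes[OF w(1)] w(2) e(2) by (metis order_refl)
  have E_trans: "E r t" if rst: "E r s" "E s t" for r s t
  proof -
    obtain i j where 1: "(q ^^ i) \<circ> fst r = (q ^^ j) \<circ> fst s" using rst by (auto simp: E_def)
    obtain k l where 2: "(q ^^ k) \<circ> fst s = (q ^^ l) \<circ> fst t" using rst by (auto simp: E_def)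
    have "(q ^^ (k + i)) \<circ> fst r = (q ^^ k) \<circ> ((q ^^ j) \<circ> fst s)"
      by (simp only: funpow_add comp_assoc 1)
    also have "\<dots> = (q ^^ j) \<circ> ((q ^^ k) \<circ> fst s)"
      by (metis add.commute comp_assoc funpow_add)
    also have "\<dots> = (q ^^ (j + l)) \<circ> fst t"
      by (simp only: funpow_add comp_assoc 2)
    finally show ?thesis unfolding E_def by blast
  qed
  have E_cong: "E r s" if uv: "(u, v) \<in> cong_gen X (R \<union> S)" "below e (val u)" "lead u = Some r" "lead v = Some s"
    for u v r s
  proof (rule lead_invariant[of "below e" E, OF _ _ _ _ _ _ _ uv])
    fix r s t assume "E r s" "E s t" then show "E r t" by (rule E_trans)
  next
    fix r s assume "E r s" then show "E s r" unfolding E_def by metis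
  next
    fix p y p' y' and q' :: "nat \<Rightarrow> nat" assume "E (p, y) (p', y')"
    then obtain i j where "(q ^^ i) \<circ> p = (q ^^ j) \<circ> p'" by (auto simp: E_def)
    then have "(q ^^ i) \<circ> (p \<circ> q') = (q ^^ j) \<circ> (p' \<circ> q')" by (metis comp_assoc)
    then show "E (p \<circ> q', y) (p' \<circ> q', y')" by (auto simp: E_def)
  next
    fix w w' r s
    assume w: "(w, w') \<in> S" "w \<in> lists X" "w' \<in> lists X" "val w = val w'" "below e (val w)"
      "lead w = Some r" "lead w' = Some s"
    have "n \<le> num_classes n (val w)" using below_classes[OF e(1) w(5)] e(2) by simp
    moreover have "num_classes n (val w) \<le> n"
      using not_unit_classes[OF val_carrier[OF w(2)]] unit_lead[OF w(2)] w(6) by auto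
    ultimately have "num_classes n (val w) = num_classes n e" using e(2) by simp
    then have "(w, w') \<in> ?S" using below_type[OF e(1) w(5)] w(1) by (simp add: rels_of_type_def)
    then have "q = fst s \<circ> pinv (fst r)" using q_rel w by fastforce
    moreover have "fst r permutes {1..n}" using val_lead(2)[OF w(2), of "fst r" "snd r"] w(6) by simp
    ultimately have "(q ^^ Suc 0) \<circ> fst r = (q ^^ 0) \<circ> fst s"
      by (simp add: fun_eq_iff permutes_inverses)
    then show "E r s" unfolding E_def by blast
  qed (use below_comp below_perm[OF e(1)] in \<open>auto simp: E_def simp del: PT_simps\<close>)
  \<comment> \<open>For \<open>q\<close> to be a permutation, both sides must have a leading part.
    They do, because a unit has a smaller kernel than e.\<close>
  have inj: "inj q"
  proof (cases "?S = {}")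
    case True
    then show ?thesis by (simp add: q_def)
  next
    case False
    then obtain u v where uv: "(u, v) \<in> ?S" by fastforce
    then have c: "u \<in> lists X" "v \<in> lists X" "val u = val v" "kern_type (kern n (val u)) = kern_type (kern n e)"
      using S_lists by (auto simp: rels_of_type_def)
    have not_unit: "\<not> unit_map n (val u)"
    proof
      assume un: "unit_map n (val u)"
      have "kern n (val u) = kern n (full_map n id)"
        using kern_unit[OF un] kern_unit[OF unit_full_map[OF permutes_id]] by (fastforce simp: kern_def)
      moreover have "kern n (full_map n id) \<subset> kern n e"
      proof -
        have "kern n (full_map n id) \<subseteq> kern n e"
          using kern_unit[OF unit_full_map[OF permutes_id]] by (fastforce simp: kern_def)
        moreover have "kern n (full_map n id) \<noteq> kern n e"
        proof
          assume "kern n (full_map n id) = kern n e"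
          then have "num_classes n (full_map n id) = num_classes n e"
            using kern_subset_classes(1)[of n "full_map n id" e] kern_subset_classes(1)[of n e "full_map n id"]
            by simp
          then show False using classes_unit[OF unit_full_map[OF permutes_id]] e(2) by simp
        qed
        ultimately show ?thesis by blast
      qed
      moreover have "finite (kern n e)"
        by (rule finite_subset[of _ "{0..n} \<times> {0..n}"]) (auto simp: kern_def)
      ultimately have "card (kern n (val u)) < card (kern n e)" by (simp add: psubset_card_mono)
      then show False using c(4) by (simp add: kern_type_def)
    qed
    have cl: "num_classes n (val u) \<le> n" "num_classes n (val v) \<le> n"
      using not_unit_classes[OF val_carrier[OF c(1)] not_unit] c(3) by auto
    obtain p1 y1 where 1: "lead u = Some (p1, y1)" "p1 permutes {1..n}" using lead_of_classes[OF c(1) cl(1)] .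
    obtain p2 y2 where 2: "lead v = Some (p2, y2)" "p2 permutes {1..n}" using lead_of_classes[OF c(2) cl(2)] .
    have "q = p2 \<circ> pinv p1" using q_rel[OF uv] 1 2 by simp
    then show ?thesis using permutes_inj[OF permutes_compose[OF permutes_inv[OF 1(2)] 2(2)]] by simp
  qed
  have cyclic: "\<exists>i j. (q ^^ i) \<circ> T (p a) (p b) = q ^^ j"
    if ab: "a \<in> {1..n}" "b \<in> {1..n}" "s permutes {1..n}" "full_map n s \<circ>\<^sub>m e = e \<circ>\<^sub>m full_map n (T a b)"
    for a b s
  proof -
    have T: "T a b permutes {1..n}" using ab by (intro permutes_swap_id)
    obtain u where u: "u \<in> lists X" "val u = full_map n (T a b)" using ex_word full_map_carrier[OF T] by blast
    obtain v where v: "v \<in> lists X" "val v = full_map n s" using ex_word full_map_carrier[OF ab(3)] by blast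
    have uv: "(u @ w, w @ v) \<in> cong_gen X (R \<union> S)"
      using u v w ab(4) by (simp add: cong_iff val_append)
    have lu: "lead u = None" using unit_lead[OF u(1)] unit_full_map[OF T] u by simp
    have l: "lead (u @ w) = Some (p \<circ> T a b, y)" "lead (w @ v) = Some (p, y)"
      using pw lu by (simp_all add: lead_append u w perm_of_full_map[OF T])
    have "below e (val (u @ w))"
      using below_comp[of e "full_map n s" e]
    proof -
      have "kern n (val (u @ w)) = kern n (e \<circ>\<^sub>m full_map n (T a b))" using u w by (simp add: val_append)
      then show ?thesis unfolding below_def using T by auto
    qed
    then have "E (p \<circ> T a b, y) (p, y)" using E_cong[OF uv _ l] by blast
    then obtain i j where "(q ^^ i) \<circ> (p \<circ> T a b) = (q ^^ j) \<circ> p" by (auto simp: E_def)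
    then have "(q ^^ i) \<circ> (p \<circ> T a b \<circ> pinv p) = (q ^^ j) \<circ> (p \<circ> pinv p)" by (metis comp_assoc)
    then show ?thesis
      unfolding transpose_conj[OF permutes_bij[OF pw(2)]] permutes_inv_o(1)[OF pw(2)] by auto
  qed
  have "inj p" using pw(2) by (rule permutes_inj)
  then have "p a \<noteq> p b" "p c \<noteq> p d" "p c \<noteq> p a" "p c \<noteq> p b" using abc by (auto simp: inj_eq)
  then show False
    using two_transpositions_not_cyclic[OF inj] cyclic[of a b s] cyclic[of c d t] abc(5) fix1 fix2
    by (metis insert_subset)
qed

end

section \<open>The six kernel types\<close>

lemma kern_type_eq:
  assumes "kern n f = Id_on {0..n} \<union> F" "F \<subseteq> {0..n} \<times> {0..n}" "\<And>x. (x, x) \<notin> F"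
  shows "kern_type (kern n f) = (n + 1 + card F, Suc (card {x. (x, 0) \<in> F}))"
proof -
  have fin: "finite F" using assms(2) by (rule finite_subset) simp
  have "Id_on {0..n} = (\<lambda>x. (x, x)) ` {0..n}" by auto
  then have "card (Id_on {0..n}) = n + 1" by (simp add: card_image inj_on_def)
  moreover have "finite (Id_on {0..n})" by (rule finite_subset[of _ "{0..n} \<times> {0..n}"]) auto
  moreover have "Id_on {0..n} \<inter> F = {}" using assms(3) by auto
  ultimately have 1: "card (Id_on {0..n} \<union> F) = n + 1 + card F"
    using fin by (simp add: card_Un_disjoint)
  have "{x. (x, 0) \<in> Id_on {0..n} \<union> F} = insert 0 {x. (x, 0) \<in> F}" by auto
  moreover have "finite {x. (x, 0) \<in> F}"
    by (rule finite_subset[of _ "{0..n}"]) (use assms(2) in auto)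
  ultimately have 2: "card {x. (x, 0) \<in> Id_on {0..n} \<union> F} = Suc (card {x. (x, 0) \<in> F})"
    using assms(3)[of 0] by simp
  show ?thesis unfolding kern_type_def assms(1) 1 2 ..
qed

text \<open>The function c picks a representative of each class, and 0 represents the undefined
  points.\<close>

lemma kern_canonical:
  assumes "\<And>x. x \<in> {0..n} \<Longrightarrow> f x = (if c x = 0 then None else Some (c x))"
    and "\<And>x y. c x = c y \<longleftrightarrow> x = y \<or> (x, y) \<in> F" and "F \<subseteq> {0..n} \<times> {0..n}"
  shows "kern n f = Id_on {0..n} \<union> F"
proof -
  have "f x = f y \<longleftrightarrow> c x = c y" if "x \<in> {0..n}" "y \<in> {0..n}" for x y
    using assms(1)[OF that(1)] assms(1)[OF that(2)] by simp
  then have "(x, y) \<in> kern n f \<longleftrightarrow> (x, y) \<in> Id_on {0..n} \<union> F" for x y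
    using assms(2)[of x y] assms(3) by (auto simp: kern_def)
  then show ?thesis by auto
qed

lemma num_classes_canonical:
  assumes "\<And>x. x \<in> {0..n} \<Longrightarrow> f x = (if c x = 0 then None else Some (c x))"
    and "\<And>x. x \<in> {0..n} \<Longrightarrow> c x \<in> {0..n} \<and> c (c x) = c x"
    and "{x \<in> {0..n}. c x \<noteq> x} = D"
  shows "num_classes n f = Suc n - card D"
proof -
  have "c ` {0..n} = {0..n} - D"
  proof (intro equalityI subsetI)
    fix y assume "y \<in> c ` {0..n}"
    then show "y \<in> {0..n} - D" using assms(2) unfolding assms(3)[symmetric] by blast
  next
    fix y assume "y \<in> {0..n} - D"
    then have "y \<in> {0..n}" "c y = y" unfolding assms(3)[symmetric] by blast+
    then show "y \<in> c ` {0..n}" by (metis image_eqI)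
  qed
  moreover have "D \<subseteq> {0..n}" using assms(3) by auto
  moreover have "f ` {0..n} = (\<lambda>y. if y = 0 then None else Some y) ` c ` {0..n}"
    unfolding image_image by (rule image_cong) (simp_all add: assms(1))
  moreover have "inj_on (\<lambda>y :: nat. if y = 0 then None else Some y) (c ` {0..n})"
    by (auto simp: inj_on_def)
  ultimately have "num_classes n f = card ({0..n} - D)"
    unfolding num_classes_def by (metis card_image)
  also have "\<dots> = Suc n - card D"
    using \<open>D \<subseteq> {0..n}\<close> finite_subset[of D "{0..n}"] by (simp add: card_Diff_subset)
  finally show ?thesis .
qed

definition merge_map :: "nat \<Rightarrow> nat \<Rightarrow> nat \<Rightarrow> nat \<rightharpoonup> nat" where
  "merge_map n a b x = (if x \<in> {1..n} then Some (if x = b then a else x) else None)"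

definition delete_map :: "nat \<Rightarrow> nat \<Rightarrow> nat \<rightharpoonup> nat" where
  "delete_map n c x = (if x \<in> {1..n} \<and> x \<noteq> c then Some x else None)"

lemma merge_map_carrier: "a \<in> {1..n} \<Longrightarrow> merge_map n a b \<in> carrier (PT n)"
  by (auto simp: merge_map_def ran_def split: if_splits)

lemma delete_map_carrier: "delete_map n c \<in> carrier (PT n)"
  by (auto simp: delete_map_def ran_def split: if_splits)

lemma num_classes_merge:
  assumes "a \<in> {1..n}" "b \<in> {1..n}" "a \<noteq> b"
  shows "num_classes n (merge_map n a b) = n"
proof -
  have "num_classes n (merge_map n a b) = Suc n - card {b}"
    by (rule num_classes_canonical[of _ _ "\<lambda>x. if x = b then a else x"])
      (use assms in \<open>auto simp: merge_map_def\<close>)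
  then show ?thesis by simp
qed

lemma num_classes_delete:
  assumes "c \<in> {1..n}"
  shows "num_classes n (delete_map n c) = n"
proof -
  have "num_classes n (delete_map n c) = Suc n - card {c}"
    by (rule num_classes_canonical[of _ _ "\<lambda>x. if x = c then 0 else x"])
      (use assms in \<open>auto simp: delete_map_def\<close>)
  then show ?thesis by simp
qed

lemma kern_merge:
  assumes "a \<in> {1..n}" "b \<in> {1..n}" "a \<noteq> b"
  shows "kern n (merge_map n a b) = Id_on {0..n} \<union> {(a, b), (b, a)}"
  by (rule kern_canonical[of _ _ "\<lambda>x. if x = b then a else x"])
    (use assms in \<open>auto simp: merge_map_def\<close>)

lemma kern_delete:
  assumes "c \<in> {1..n}"
  shows "kern n (delete_map n c) = Id_on {0..n} \<union> {(0, c), (c, 0)}"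
  by (rule kern_canonical[of _ _ "\<lambda>x. if x = c then 0 else x"])
    (use assms in \<open>auto simp: delete_map_def\<close>)

context PT_over_Sym
begin

lemma card_rels_merge: "card (rels_of_type (n + 3, 1)) \<ge> 2"
proof -
  let ?e = "merge_map n 1 2"
  define F :: "(nat \<times> nat) set" where "F = {(1, 2), (2, 1)}"
  have "kern n ?e = Id_on {0..n} \<union> F"
    unfolding F_def by (rule kern_merge) (use n in auto)
  then have "kern_type (kern n ?e) = (n + 1 + card F, Suc (card {x. (x, 0) \<in> F}))"
    by (rule kern_type_eq) (use n in \<open>auto simp: F_def\<close>)
  moreover have "{x. (x, 0) \<in> F} = {}" by (auto simp: F_def)
  moreover have "card F = 2" by (simp add: F_def)
  ultimately have t: "kern_type (kern n ?e) = (n + 3, 1)" by (simp add: One_nat_def)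
  have "2 \<le> card (rels_of_type (kern_type (kern n ?e)))"
  \<comment> \<open>The transposition of 1 and 2 is swallowed by the merging, whence the identity;
    that of 3 and 4 commutes with it.\<close>
  proof (rule rels_of_type_idempotent[of _ 1 2 3 4 id "T 3 4"])
    show "full_map n id \<circ>\<^sub>m ?e = ?e \<circ>\<^sub>m full_map n (T 1 2)"
      using n by (auto simp: fun_eq_iff map_comp_def full_map_apply merge_map_def transpose_def)
    show "full_map n (T 3 4) \<circ>\<^sub>m ?e = ?e \<circ>\<^sub>m full_map n (T 3 4)"
      using n by (auto simp: fun_eq_iff map_comp_def full_map_apply merge_map_def transpose_def)
    show "?e \<in> carrier (PT n)" using n by (intro merge_map_carrier) auto
    show "num_classes n ?e = n" using n by (intro num_classes_merge) auto
    show "T 3 4 permutes {1..n}" using n by (intro permutes_swap_id) auto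
  qed (use n permutes_id in auto)
  then show ?thesis unfolding t .
qed

lemma card_rels_delete: "card (rels_of_type (n + 3, 2)) \<ge> 2"
proof -
  let ?e = "delete_map n 1"
  define F :: "(nat \<times> nat) set" where "F = {(0, 1), (1, 0)}"
  have "kern n ?e = Id_on {0..n} \<union> F"
    unfolding F_def by (rule kern_delete) (use n in auto)
  then have "kern_type (kern n ?e) = (n + 1 + card F, Suc (card {x. (x, 0) \<in> F}))"
    by (rule kern_type_eq) (use n in \<open>auto simp: F_def\<close>)
  moreover have "{x. (x, 0) \<in> F} = {1}" by (auto simp: F_def)
  moreover have "card F = 2" by (simp add: F_def)
  ultimately have t: "kern_type (kern n ?e) = (n + 3, 2)" by (simp add: One_nat_def)
  have "2 \<le> card (rels_of_type (kern_type (kern n ?e)))"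
  \<comment> \<open>If n = 4, only the points 2, 3, 4 are left, so the two transpositions have to
    share a point.\<close>
  proof (rule rels_of_type_idempotent[of _ 2 3 4 3 "T 2 3" "T 4 3"])
    show "full_map n (T 2 3) \<circ>\<^sub>m ?e = ?e \<circ>\<^sub>m full_map n (T 2 3)"
      using n by (auto simp: fun_eq_iff map_comp_def full_map_apply delete_map_def transpose_def)
    show "full_map n (T 4 3) \<circ>\<^sub>m ?e = ?e \<circ>\<^sub>m full_map n (T 4 3)"
      using n by (auto simp: fun_eq_iff map_comp_def full_map_apply delete_map_def transpose_def)
    show "?e \<in> carrier (PT n)" by (rule delete_map_carrier)
    show "num_classes n ?e = n" using n by (intro num_classes_delete) auto
    show "T 2 3 permutes {1..n}" "T 4 3 permutes {1..n}" using n by (auto intro: permutes_swap_id)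
  qed (use n in auto)
  then show ?thesis unfolding t .
qed

lemma rels_merge_merge_disjoint: "rels_of_type (n + 5, 1) \<noteq> {}"
proof -
  let ?e = "merge_map n 1 2" and ?k = "merge_map n 3 4"
  let ?h = "?k \<circ>\<^sub>m ?e"
  have h: "?h x = (if x \<in> {1..n} then Some (if x = 2 then 1 else if x = 4 then 3 else x) else None)" for x
    using n by (auto simp: map_comp_def merge_map_def)
  define F :: "(nat \<times> nat) set" where "F = {(1, 2), (2, 1), (3, 4), (4, 3)}"
  have "kern n ?h = Id_on {0..n} \<union> F"
    by (rule kern_canonical[of _ _ "\<lambda>x. if x = 2 then 1 else if x = 4 then 3 else x"]) (use n in \<open>auto simp: h F_def\<close>)
  then have "kern_type (kern n ?h) = (n + 1 + card F, Suc (card {x. (x, 0) \<in> F}))"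
    by (rule kern_type_eq) (use n in \<open>auto simp: F_def\<close>)
  moreover have "{x. (x, 0) \<in> F} = {}" by (auto simp: F_def)
  moreover have "card F = 4" by (simp add: F_def)
  ultimately have t: "kern_type (kern n ?h) = (n + 5, 1)" by (simp add: One_nat_def)
  have "num_classes n ?h = Suc n - card {2::nat, 4}"
    by (rule num_classes_canonical[of _ _ "\<lambda>x. if x = 2 then 1 else if x = 4 then 3 else x"]) (use n in \<open>auto simp: h\<close>)
  then have "num_classes n ?h = n - 1" by simp
  moreover have "?h = ?e \<circ>\<^sub>m ?k"
    using n by (auto simp: fun_eq_iff h) (auto simp: map_comp_def merge_map_def)
  moreover have "(1, 2) \<in> kern n ?e" "(1, 2) \<notin> kern n ?k" using n by (auto simp: kern_merge)
  ultimately have "rels_of_type (kern_type (kern n ?h)) \<noteq> {}"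
    using n by (intro rels_of_type_product merge_map_carrier num_classes_merge) auto
  then show ?thesis unfolding t .
qed

lemma rels_merge_merge: "rels_of_type (n + 7, 1) \<noteq> {}"
proof -
  let ?e = "merge_map n 1 2" and ?k = "merge_map n 1 3"
  let ?h = "?k \<circ>\<^sub>m ?e"
  have h: "?h x = (if x \<in> {1..n} then Some (if x = 2 \<or> x = 3 then 1 else x) else None)" for x
    using n by (auto simp: map_comp_def merge_map_def)
  define F :: "(nat \<times> nat) set" where "F = {(1, 2), (2, 1), (1, 3), (3, 1), (2, 3), (3, 2)}"
  have "kern n ?h = Id_on {0..n} \<union> F"
    by (rule kern_canonical[of _ _ "\<lambda>x. if x = 2 then 1 else if x = 3 then 1 else x"]) (use n in \<open>auto simp: h F_def\<close>)
  then have "kern_type (kern n ?h) = (n + 1 + card F, Suc (card {x. (x, 0) \<in> F}))"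
    by (rule kern_type_eq) (use n in \<open>auto simp: F_def\<close>)
  moreover have "{x. (x, 0) \<in> F} = {}" by (auto simp: F_def)
  moreover have "card F = 6" by (simp add: F_def)
  ultimately have t: "kern_type (kern n ?h) = (n + 7, 1)" by (simp add: One_nat_def)
  have "num_classes n ?h = Suc n - card {2::nat, 3}"
    by (rule num_classes_canonical[of _ _ "\<lambda>x. if x = 2 then 1 else if x = 3 then 1 else x"]) (use n in \<open>auto simp: h\<close>)
  then have "num_classes n ?h = n - 1" by simp
  moreover have "?h = ?e \<circ>\<^sub>m ?k"
    using n by (auto simp: fun_eq_iff h) (auto simp: map_comp_def merge_map_def)
  moreover have "(1, 2) \<in> kern n ?e" "(1, 2) \<notin> kern n ?k" using n by (auto simp: kern_merge)
  ultimately have "rels_of_type (kern_type (kern n ?h)) \<noteq> {}"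
    using n by (intro rels_of_type_product merge_map_carrier num_classes_merge) auto
  then show ?thesis unfolding t .
qed

lemma rels_merge_delete: "rels_of_type (n + 5, 2) \<noteq> {}"
proof -
  let ?e = "merge_map n 1 2" and ?k = "delete_map n 3"
  let ?h = "?k \<circ>\<^sub>m ?e"
  have h: "?h x = (if x \<in> {1..n} \<and> x \<noteq> 3 then Some (if x = 2 then 1 else x) else None)" for x
    using n by (auto simp: map_comp_def merge_map_def delete_map_def)
  define F :: "(nat \<times> nat) set" where "F = {(1, 2), (2, 1), (0, 3), (3, 0)}"
  have "kern n ?h = Id_on {0..n} \<union> F"
    by (rule kern_canonical[of _ _ "\<lambda>x. if x = 2 then 1 else if x = 3 then 0 else x"]) (use n in \<open>auto simp: h F_def\<close>)
  then have "kern_type (kern n ?h) = (n + 1 + card F, Suc (card {x. (x, 0) \<in> F}))"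
    by (rule kern_type_eq) (use n in \<open>auto simp: F_def\<close>)
  moreover have "{x. (x, 0) \<in> F} = {3}" by (auto simp: F_def)
  moreover have "card F = 4" by (simp add: F_def)
  ultimately have t: "kern_type (kern n ?h) = (n + 5, 2)" by (simp add: One_nat_def)
  have "num_classes n ?h = Suc n - card {2::nat, 3}"
    by (rule num_classes_canonical[of _ _ "\<lambda>x. if x = 2 then 1 else if x = 3 then 0 else x"]) (use n in \<open>auto simp: h\<close>)
  then have "num_classes n ?h = n - 1" by simp
  moreover have "?h = ?e \<circ>\<^sub>m ?k"
    using n by (auto simp: fun_eq_iff h) (auto simp: map_comp_def merge_map_def delete_map_def)
  moreover have "(1, 2) \<in> kern n ?e" "(1, 2) \<notin> kern n ?k" using n by (auto simp: kern_merge kern_delete)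
  ultimately have "rels_of_type (kern_type (kern n ?h)) \<noteq> {}"
    using n by (intro rels_of_type_product merge_map_carrier num_classes_merge
        delete_map_carrier num_classes_delete) auto
  then show ?thesis unfolding t .
qed

lemma rels_delete_delete: "rels_of_type (n + 7, 3) \<noteq> {}"
proof -
  let ?e = "delete_map n 1" and ?k = "delete_map n 2"
  let ?h = "?k \<circ>\<^sub>m ?e"
  have h: "?h x = (if x \<in> {1..n} \<and> x \<noteq> 1 \<and> x \<noteq> 2 then Some x else None)" for x
    using n by (auto simp: map_comp_def delete_map_def)
  define F :: "(nat \<times> nat) set" where "F = {(1, 2), (2, 1), (0, 1), (1, 0), (0, 2), (2, 0)}"
  have "kern n ?h = Id_on {0..n} \<union> F"
    by (rule kern_canonical[of _ _ "\<lambda>x. if x = 1 then 0 else if x = 2 then 0 else x"]) (use n in \<open>auto simp: h F_def\<close>)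
  then have "kern_type (kern n ?h) = (n + 1 + card F, Suc (card {x. (x, 0) \<in> F}))"
    by (rule kern_type_eq) (use n in \<open>auto simp: F_def\<close>)
  moreover have "{x. (x, 0) \<in> F} = {1, 2}" by (auto simp: F_def)
  moreover have "card F = 6" by (simp add: F_def)
  ultimately have t: "kern_type (kern n ?h) = (n + 7, 3)" by (simp add: One_nat_def)
  have "num_classes n ?h = Suc n - card {1, 2::nat}"
    by (rule num_classes_canonical[of _ _ "\<lambda>x. if x = 1 then 0 else if x = 2 then 0 else x"]) (use n in \<open>auto simp: h\<close>)
  then have "num_classes n ?h = n - 1" by simp
  moreover have "?h = ?e \<circ>\<^sub>m ?k"
    using n by (auto simp: fun_eq_iff h) (auto simp: map_comp_def delete_map_def)
  moreover have "(0, 1) \<in> kern n ?e" "(0, 1) \<notin> kern n ?k" using n by (auto simp: kern_delete)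
  ultimately have "rels_of_type (kern_type (kern n ?h)) \<noteq> {}"
    using n by (intro rels_of_type_product delete_map_carrier num_classes_delete) auto
  then show ?thesis unfolding t .
qed

theorem card_S: "card S \<ge> 8"
proof -
  \<comment> \<open>The two types of rank n - 1 come first, then the four of rank n - 2. The second
    entry separates types with equal first entry.\<close>
  let ?t = "{(n + 3, 1), (n + 3, 2), (n + 5, 1), (n + 7, 1), (n + 5, 2), (n + 7, 3)}"
  have fin: "finite (rels_of_type t)" for t
    using finite_S by (rule rev_finite_subset) (auto simp: rels_of_type_def)
  have "card (\<Union>t\<in>?t. rels_of_type t) = (\<Sum>t\<in>?t. card (rels_of_type t))"
    by (rule card_UN_disjoint) (use fin in \<open>auto simp: rels_of_type_def\<close>)
  also have "\<dots> = card (rels_of_type (n + 3, 1)) + card (rels_of_type (n + 3, 2)) +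
      card (rels_of_type (n + 5, 1)) + card (rels_of_type (n + 7, 1)) +
      card (rels_of_type (n + 5, 2)) + card (rels_of_type (n + 7, 3))"
    by simp
  also have "\<dots> \<ge> 8"
  proof -
    have "card (rels_of_type t) \<ge> 1" if "rels_of_type t \<noteq> {}" for t
      using that fin[of t] by (simp add: Suc_le_eq card_gt_0_iff One_nat_def)
    from this[OF rels_merge_merge_disjoint] this[OF rels_merge_merge] this[OF rels_merge_delete]
      this[OF rels_delete_delete] card_rels_merge card_rels_delete
    show ?thesis by linarith
  qed
  finally have "8 \<le> card (\<Union>t\<in>?t. rels_of_type t)" .
  also have "\<dots> \<le> card S"
    by (rule card_mono[OF finite_S]) (auto simp: rels_of_type_def)
  finally show ?thesis .
qed

end

theorem theorem1p6:
  shows "(\<forall>(n::nat) (A::'a set) R \<pi> \<zeta> \<eta> rels.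
            n \<ge> 7 \<longrightarrow>
            presentation_for (Sym n) A R \<pi> \<longrightarrow>
            \<zeta> \<notin> A \<longrightarrow> \<eta> \<notin> A \<longrightarrow> \<zeta> \<noteq> \<eta> \<longrightarrow>
            list_all2 (\<lambda>(l, r) (u, v). u \<in> product_words n A \<pi> l \<and> v \<in> product_words n A \<pi> r)
              (PT_relations n \<zeta> \<eta>) rels \<longrightarrow>
            presentation_for (PT n) (A \<union> {\<zeta>, \<eta>}) (R \<union> set rels)
              (\<pi>(\<zeta> := zeta_map n, \<eta> := eta_map n)))
       \<and> (\<forall>(n::nat) (A::'b set) B R S \<phi>.
            n \<ge> 4 \<longrightarrow>
            A \<inter> B = {} \<longrightarrow>
            presentation_for (PT n) (A \<union> B) (R \<union> S) \<phi> \<longrightarrow>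
            presentation_for (Sym n) A R \<phi> \<longrightarrow>
            card S \<ge> 8)"
proof (intro conjI allI impI)
  fix n :: nat and A :: "'a set" and R \<pi> \<zeta> \<eta> rels
  assume "n \<ge> 7" "presentation_for (Sym n) A R \<pi>" "\<zeta> \<notin> A" "\<eta> \<notin> A" "\<zeta> \<noteq> \<eta>"
    and "list_all2 (\<lambda>(l, r) (u, v). u \<in> product_words n A \<pi> l \<and> v \<in> product_words n A \<pi> r)
      (PT_relations n \<zeta> \<eta>) rels"
  then interpret PT_presentation n A R \<pi> \<zeta> \<eta> rels by unfold_locales
  show "presentation_for (PT n) (A \<union> {\<zeta>, \<eta>}) (R \<union> set rels)
      (\<pi>(\<zeta> := zeta_map n, \<eta> := eta_map n))"
    using presentation unfolding X_def Q_def \<phi>_def .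
next
  fix n :: nat and A B :: "'b set" and R S \<phi>
  assume "n \<ge> 4" "A \<inter> B = {}" "presentation_for (PT n) (A \<union> B) (R \<union> S) \<phi>"
    "presentation_for (Sym n) A R \<phi>"
  then interpret PT_over_Sym n A B R S \<phi> by unfold_locales
  show "card S \<ge> 8" by (rule card_S)
qed

end
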